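(* If a sequence of positive integers $(r_n)_{n \ge 1}$ satisfies $r_n / (g(n) n^{1/\theta}) \to \infty$ and $r_n = o(n)$, then the total variation distance between the laws of \[ \left(F_0(\mathsf{T}_n^\Omega), (F_i(\mathsf{T}_n^\Omega))_{1 \le i \le \mathbb{P}(\xi \in \Omega)^{-1}(1 - \mathbb{E}[\xi])n - r_n} \right) \quad\text{and}\quad \left(\mathsf{T}^\bullet, (\mathsf{T}^i)_{1 \le i \le \mathbb{P}(\xi \in \Omega)^{-1}(1 - \mathbb{E}[\xi]) n - r_n}\right) \] tends to zero as $n\to\infty$.
   Context: Setting. $\xi$ is a random variable with values in $\mathbb{N}_0=\{0,1,2,\dots\}$ such that $\mathbb{P}(\xi=0)>0$, $\mathbb{P}(\xi\le 1)<1$, $\mathbb{E}[\xi]<1$, and there are a slowly varying function $f$ and a constant $\alpha>1$ with $\mathbb{P}(\xi=n)=f(n)n^{-1-\alpha}$ for all large enough integers $n$. Set $\theta=\min(\alpha,2)$. $\Omega\subset\mathbb{N}_0$ is a fixed non-empty set with $\mathbb{P}(\xi\in\Omega)>0$ such that $\Omega$ or its complement $\mathbb{N}_0\setminus\Omega$ is finite. $\mathsf{T}$ is a Galton--Watson tree with offspring distribution $\xi$, regarded as a plane tree (rooted tree in which the offspring of each vertex is linearly ordered). The outdegree of a vertex is its number of children. For a finite plane tree $T$, $L_\Omega(T)$ is the number of vertices with outdegree in $\Omega$, and $\Delta(T)$ the maximal outdegree. For $n$ large enough, $\mathsf{T}_n^\Omega$ denotes $\mathsf{T}$ conditioned on $L_\Omega(\mathsf{T})=n$.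 The function $g$. Let $h$ be the density of $X_1$, where $(X_t)_{t\ge0}$ is the spectrally positive L\'evy process with $\mathbb{E}[\exp(-\lambda X_t)]=\exp(t\lambda^\theta)$, $\lambda\ge0$. $g$ is a slowly varying function such that the sums $S_n=\xi_1+\dots+\xi_n$ of independent copies of $\xi$ satisfy $\lim_{n\to\infty}\sup_{\ell\in\mathbb{Z}}\left|g(n)n^{1/\theta}\mathbb{P}(S_n=\ell)-h\left(\frac{\ell-n\mathbb{E}[\xi]}{g(n)n^{1/\theta}}\right)\right|=0$ (such $g$ exists). Decomposition. The fringe subtree of a plane tree at a vertex is the subtree consisting of the vertex and all its descendants. For a finite plane tree $T$, let $v$ be the lexicographically first (i.e. first in depth-first-search order) vertex of maximal outdegree. $(F_i(T))_{1\le i\le\Delta(T)}$ is the ordered list of the fringe subtrees at the children of $v$, and $F_0(T)$ is the marked plane tree obtained from $T$ by marking $v$ and cutting away all descendants of $v$. The tree $\mathsf{T}^\bullet$. Let $\hat\xi$ have values in $\mathbb{N}\cup\{\infty\}$ with $\mathbb{P}(\hat\xi=k)=k\,\mathbb{P}(\xi=k)$ for $k<\infty$ and $\mathbb{P}(\hat\xi=\infty)=1-\mathbb{E}[\xi]$. $\mathsf{T}^\bullet$ is the random plane tree with a marked leaf constructed as follows: start with a root vertex and sample an independent copy of $\hat\xi$. If it equals infinity, mark the root and stop. Otherwise give the root that many offspring, choose one of them uniformly at random and declare it special, identify each non-special offspring with the root of an independent copy of $\mathsf{T}$, and iterate the construction at the special offspring vertex (with fresh independent copies). $(\mathsf{T}^i)_{i\ge1}$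 are independent copies of $\mathsf{T}$, independent of $\mathsf{T}^\bullet$. *)

theory Defs
  imports
    "HOL-Probability.Probability"
    "HOL-Library.Landau_Symbols"
    "HOL-Library.List_Lexorder"
begin

section \<open>Slowly varying functions\<close>

text \<open>Positivity and measurability are only required on a neighbourhood of infinity.\<close>

definition slowly_varying :: "(real \<Rightarrow> real) \<Rightarrow> bool" where
  "slowly_varying f \<longleftrightarrow>
     (\<exists>a. set_borel_measurable borel {a..} f \<and> (\<forall>x\<ge>a. f x > 0)) \<and>
     (\<forall>t>0. ((\<lambda>x. f (t * x) / f x) \<longlongrightarrow> 1) at_top)"


section \<open>Levy processes\<close>

text \<open>The process is indexed by \<open>real\<close>, but only times \<open>t \<ge> 0\<close> matter.\<close>

definition levy_process :: "'a measure \<Rightarrow> (real \<Rightarrow> 'a \<Rightarrow> real) \<Rightarrow> bool" where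
  "levy_process M X \<longleftrightarrow>
     prob_space M \<and>
     (\<forall>t\<ge>0. X t \<in> borel_measurable M) \<and>
     (AE \<omega> in M. X 0 \<omega> = 0) \<and>
     (\<forall>(n::nat) (\<tau>::nat \<Rightarrow> real). 0 \<le> \<tau> 0 \<and> mono \<tau> \<longrightarrow>
        prob_space.indep_vars M (\<lambda>_. borel) (\<lambda>i \<omega>. X (\<tau> (Suc i)) \<omega> - X (\<tau> i) \<omega>) {..<n}) \<and>
     (\<forall>s\<ge>0. \<forall>t\<ge>0. distr M borel (\<lambda>\<omega>. X (s + t) \<omega> - X s \<omega>) = distr M borel (X t)) \<and>
     (AE \<omega> in M. \<forall>t\<ge>0.
        ((\<lambda>s. X s \<omega>) \<longlongrightarrow> X t \<omega>) (at_right t) \<and>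
        (t > 0 \<longrightarrow> (\<exists>l. ((\<lambda>s. X s \<omega>) \<longlongrightarrow> l) (at_left t))))"

text \<open>Spectrally positive: no negative jumps.\<close>

definition spectrally_positive :: "'a measure \<Rightarrow> (real \<Rightarrow> 'a \<Rightarrow> real) \<Rightarrow> bool" where
  "spectrally_positive M X \<longleftrightarrow>
     (AE \<omega> in M. \<forall>t>0. \<forall>l. ((\<lambda>s. X s \<omega>) \<longlongrightarrow> l) (at_left t) \<longrightarrow> l \<le> X t \<omega>)"


section \<open>Plane trees\<close>

datatype plane_tree = Node (children: "plane_tree list")

text \<open>Vertices are addressed in Ulam--Harris fashion: \<open>[]\<close> is the root, and \<open>i # v\<close> is the
  vertex \<open>v\<close> of the fringe subtree at the \<open>i\<close>-th child of the root, counting from 0.\<close>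

primrec is_vertex :: "nat list \<Rightarrow> plane_tree \<Rightarrow> bool" where
  "is_vertex [] T \<longleftrightarrow> True"
| "is_vertex (i # v) T \<longleftrightarrow> i < length (children T) \<and> is_vertex v (children T ! i)"

definition vertices :: "plane_tree \<Rightarrow> nat list set" where
  "vertices T = {v. is_vertex v T}"

primrec fringe :: "nat list \<Rightarrow> plane_tree \<Rightarrow> plane_tree" where
  "fringe [] T = T"
| "fringe (i # v) T = fringe v (children T ! i)"

definition outdegree :: "plane_tree \<Rightarrow> nat list \<Rightarrow> nat" where
  "outdegree T v = length (children (fringe v T))"

definition L :: "nat set \<Rightarrow> plane_tree \<Rightarrow> nat" where
  "L \<Omega> T = card {v \<in> vertices T. outdegree T v \<in> \<Omega>}"

definition max_outdegree :: "plane_tree \<Rightarrow> nat" where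
  "max_outdegree T = Max (outdegree T ` vertices T)"

text \<open>The minimum is with respect to the lexicographic order on addresses, in which every proper
  prefix precedes its extensions; this is depth-first-search order.\<close>

definition first_max_vertex :: "plane_tree \<Rightarrow> nat list" where
  "first_max_vertex T = Min {v \<in> vertices T. outdegree T v = max_outdegree T}"

primrec cut_below :: "nat list \<Rightarrow> plane_tree \<Rightarrow> plane_tree" where
  "cut_below [] T = Node []"
| "cut_below (i # v) T = Node ((children T)[i := cut_below v (children T ! i)])"

text \<open>A marked plane tree is a plane tree together with the address of the marked vertex.\<close>

type_synonym marked_tree = "plane_tree \<times> nat list"

definition F0 :: "plane_tree \<Rightarrow> marked_tree" where
  "F0 T = (cut_below (first_max_vertex T) T, first_max_vertex T)"

text \<open>The list of \<open>F\<^sub>1(T), F\<^sub>2(T), \<dots>\<close>, whose length is the maximal outdegree of \<open>T\<close>.\<close>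

definition Fs :: "plane_tree \<Rightarrow> plane_tree list" where
  "Fs T = children (fringe (first_max_vertex T) T)"

lemma vertices_Node:
  "vertices (Node ts) = insert [] (\<Union>i<length ts. (#) i ` vertices (ts ! i))" (is "?A = ?B")
proof (rule set_eqI)
  fix v show "v \<in> ?A \<longleftrightarrow> v \<in> ?B"
    by (cases v) (auto simp: vertices_def)
qed

lemma finite_vertices: "finite (vertices T)"
  by (induction T) (auto simp: vertices_Node)

lemma first_max_vertex:
  "first_max_vertex T \<in> vertices T" "outdegree T (first_max_vertex T) = max_outdegree T"
proof -
  have "[] \<in> vertices T"
    by (simp add: vertices_def)
  then have "max_outdegree T \<in> outdegree T ` vertices T"
    unfolding max_outdegree_def by (intro Max_in) (auto simp: finite_vertices)
  then have "first_max_vertex T \<in> {v \<in> vertices T. outdegree T v = max_outdegree T}"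
    unfolding first_max_vertex_def by (intro Min_in) (auto simp: finite_vertices)
  then show "first_max_vertex T \<in> vertices T"
    "outdegree T (first_max_vertex T) = max_outdegree T"
    by auto
qed

lemma length_Fs: "length (Fs T) = max_outdegree T"
  using first_max_vertex(2)[of T] by (simp add: Fs_def outdegree_def)


section \<open>Galton--Watson trees\<close>

text \<open>The law of \<open>n\<close> independent samples from \<open>q\<close>.\<close>

primrec iid_spmf :: "nat \<Rightarrow> 'a spmf \<Rightarrow> 'a list spmf" where
  "iid_spmf 0 q = return_spmf []"
| "iid_spmf (Suc n) q = bind_spmf q (\<lambda>x. map_spmf ((#) x) (iid_spmf n q))"

lemma iid_spmf_mono [partial_function_mono]:
  assumes "mono_spmf B"
  shows "mono_spmf (\<lambda>f. iid_spmf n (B f))"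
  by (induction n) (auto intro!: partial_function_mono assms)

text \<open>The root has \<open>k\<close> children with probability \<open>P(\<xi> = k)\<close>, and the fringe subtrees at the
  children are independent Galton--Watson trees. The mass missing from the subprobability
  \<open>GW \<xi>\<close> is the probability of the tree being infinite; see \<open>lossless_GW\<close>.\<close>

partial_function (spmf) GW :: "nat pmf \<Rightarrow> plane_tree spmf" where
  "GW \<xi> = bind_spmf (spmf_of_pmf \<xi>) (\<lambda>k. map_spmf Node (iid_spmf k (GW \<xi>)))"

definition GW_cond :: "nat pmf \<Rightarrow> nat set \<Rightarrow> nat \<Rightarrow> plane_tree spmf" where
  "GW_cond \<xi> \<Omega> n = cond_spmf (GW \<xi>) {T. L \<Omega> T = n}"

abbreviation mean :: "nat pmf \<Rightarrow> real" where
  "mean \<xi> \<equiv> measure_pmf.expectation \<xi> real"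

definition xi_hat :: "nat pmf \<Rightarrow> enat pmf" where
  "xi_hat \<xi> = embed_pmf (\<lambda>k. case k of enat j \<Rightarrow> real j * pmf \<xi> j | \<infinity> \<Rightarrow> 1 - mean \<xi>)"

partial_function (spmf) GW_bullet :: "nat pmf \<Rightarrow> marked_tree spmf" where
  "GW_bullet \<xi> = bind_spmf (spmf_of_pmf (xi_hat \<xi>)) (\<lambda>k.
     if k = \<infinity> then return_spmf (Node [], [])
     else bind_spmf (spmf_of_set {..<the_enat k}) (\<lambda>i.
          bind_spmf (iid_spmf i (GW \<xi>)) (\<lambda>ls.
          bind_spmf (GW_bullet \<xi>) (\<lambda>(S, v).
          bind_spmf (iid_spmf (the_enat k - 1 - i) (GW \<xi>)) (\<lambda>rs.
          return_spmf (Node (ls @ S # rs), i # v))))))"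

lemma pmf_xi_hat:
  assumes "integrable (measure_pmf \<xi>) real" "mean \<xi> \<le> 1"
  shows "pmf (xi_hat \<xi>) (enat j) = real j * pmf \<xi> j" "pmf (xi_hat \<xi>) \<infinity> = 1 - mean \<xi>"
proof -
  let ?p = "\<lambda>k. case k of enat j \<Rightarrow> real j * pmf \<xi> j | \<infinity> \<Rightarrow> 1 - mean \<xi>"
  have nonneg: "0 \<le> ?p k" for k
    using assms(2) by (cases k) auto
  have "ennreal (?p k) = ennreal (?p k) * indicator (range enat) k
      + ennreal (?p k) * indicator {\<infinity>} k" for k
    by (cases k) (auto simp: indicator_def)
  then have "(\<integral>\<^sup>+k. ennreal (?p k) \<partial>count_space UNIV)
      = (\<integral>\<^sup>+k. ennreal (?p k) * indicator (range enat) k + ennreal (?p k) * indicator {\<infinity>} k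
           \<partial>count_space UNIV)"
    by (intro nn_integral_cong) blast
  also have "\<dots>
      = (\<integral>\<^sup>+k. ennreal (?p k) \<partial>count_space (range enat)) +
        (\<integral>\<^sup>+k. ennreal (?p k) \<partial>count_space {\<infinity>})"
    by (subst nn_integral_add) (simp_all add: nn_integral_count_space_indicator)
  also have "(\<integral>\<^sup>+k. ennreal (?p k) \<partial>count_space (range enat))
      = (\<integral>\<^sup>+j. ennreal (real j * pmf \<xi> j) \<partial>count_space UNIV)"
    by (subst nn_integral_bij_count_space[symmetric, where g = enat and A = UNIV])
      (auto simp: bij_betw_def inj_on_def)
  also have "\<dots> = (\<integral>\<^sup>+j. ennreal (real j) \<partial>measure_pmf \<xi>)"
    by (auto simp: nn_integral_measure_pmf ennreal_mult' mult.commute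
        intro!: nn_integral_cong)
  also have "\<dots> = ennreal (mean \<xi>)"
    using assms(1) by (intro nn_integral_eq_integral) auto
  also have "(\<integral>\<^sup>+k. ennreal (?p k) \<partial>count_space {\<infinity>}) = ennreal (1 - mean \<xi>)"
    by (simp add: nn_integral_count_space_finite)
  also have "ennreal (mean \<xi>) + ennreal (1 - mean \<xi>) = 1"
    using assms(2) by (subst ennreal_plus[symmetric]) auto
  finally have total: "(\<integral>\<^sup>+k. ennreal (?p k) \<partial>count_space UNIV) = 1" .
  show "pmf (xi_hat \<xi>) (enat j) = real j * pmf \<xi> j" "pmf (xi_hat \<xi>) \<infinity> = 1 - mean \<xi>"
    unfolding xi_hat_def by (simp_all add: pmf_embed_pmf[OF nonneg total])
qed

lemma weight_iid_spmf: "weight_spmf (iid_spmf n q) = weight_spmf q ^ n"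
  by (induction n) (simp_all add: weight_bind_spmf o_def)

lemma lossless_GW:
  assumes int: "integrable (measure_pmf \<xi>) real" and sub: "mean \<xi> < 1"
  shows "lossless_spmf (GW \<xi>)"
proof -
  define a where "a = weight_spmf (GW \<xi>)"
  have a: "0 \<le> a" "a \<le> 1"
    by (auto simp: a_def weight_spmf_nonneg weight_spmf_le_1)
  have int_pow: "integrable (measure_pmf \<xi>) (\<lambda>k. a ^ k)"
    by (rule measure_pmf.integrable_const_bound[where B = 1]) (use a in \<open>auto simp: power_le_one\<close>)
  have "a = measure_pmf.expectation \<xi> (\<lambda>k. a ^ k)"
    using arg_cong[OF GW.simps[of \<xi>], of weight_spmf]
    by (simp del: bind_spmf_of_pmf
        add: weight_bind_spmf o_def weight_iid_spmf a_def measure_spmf_spmf_of_pmf)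
  then have "1 - a = measure_pmf.expectation \<xi> (\<lambda>k. 1 - a ^ k)"
    by (subst Bochner_Integration.integral_diff) (auto simp: int_pow)
  also have "\<dots> \<le> measure_pmf.expectation \<xi> (\<lambda>k. real k * (1 - a))"
  proof (rule integral_mono)
    show "1 - a ^ k \<le> real k * (1 - a)" for k
      using Bernoulli_inequality[of "a - 1" k] a by (simp add: algebra_simps)
  qed (auto simp: int int_pow)
  also have "\<dots> = mean \<xi> * (1 - a)"
    by simp
  finally have "(1 - mean \<xi>) * (1 - a) \<le> 0"
    by (simp add: algebra_simps)
  with sub a have "a = 1"
    by (smt (verit) mult_pos_pos)
  then show ?thesis
    by (simp add: lossless_spmf_def a_def)
qed

lemma lossless_GW_bullet:
  assumes int: "integrable (measure_pmf \<xi>) real" and sub: "mean \<xi> < 1"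
  shows "lossless_spmf (GW_bullet \<xi>)"
proof -
  define b where "b = weight_spmf (GW_bullet \<xi>)"
  have w: "weight_spmf (iid_spmf n (GW \<xi>)) = 1" for n
    using lossless_GW[OF assms] by (simp add: weight_iid_spmf lossless_spmf_def)
  have pos: "k \<noteq> 0" if "k \<in> set_pmf (xi_hat \<xi>)" for k
    using that pmf_xi_hat(1)[OF int, of 0] sub by (auto simp: set_pmf_iff zero_enat_def)
  define Q where "Q = (\<lambda>k. if k = \<infinity> then return_spmf (Node [], [])
     else bind_spmf (spmf_of_set {..<the_enat k}) (\<lambda>i.
          bind_spmf (iid_spmf i (GW \<xi>)) (\<lambda>ls.
          bind_spmf (GW_bullet \<xi>) (\<lambda>(S, v).
          bind_spmf (iid_spmf (the_enat k - 1 - i) (GW \<xi>)) (\<lambda>rs.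
          return_spmf (Node (ls @ S # rs), i # v))))))"
  have Q: "weight_spmf (Q k) = b + indicator {\<infinity>} k * (1 - b)"
    if "k \<in> set_pmf (xi_hat \<xi>)" for k
  proof (cases k)
    case (enat j)
    then have "j \<noteq> 0"
      using pos[OF that] by (auto simp: zero_enat_def)
    then show ?thesis
      using enat by (simp add: Q_def weight_bind_spmf o_def case_prod_unfold w b_def
          weight_spmf_of_set lessThan_empty_iff)
  qed (simp add: Q_def)
  have "b = measure_pmf.expectation (xi_hat \<xi>) (\<lambda>k. weight_spmf (Q k))"
    using arg_cong[OF GW_bullet.simps[of \<xi>], of weight_spmf]
    by (simp del: bind_spmf_of_pmf
        add: weight_bind_spmf o_def b_def measure_spmf_spmf_of_pmf Q_def)
  also have "\<dots> = measure_pmf.expectation (xi_hat \<xi>) (\<lambda>k. b + indicator {\<infinity>} k * (1 - b))"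
    by (rule integral_cong_AE) (auto simp: AE_measure_pmf_iff Q)
  also have "\<dots> = b + pmf (xi_hat \<xi>) \<infinity> * (1 - b)"
  proof (subst Bochner_Integration.integral_add)
    show "integrable (measure_pmf (xi_hat \<xi>)) (\<lambda>k. indicator {\<infinity>} k * (1 - b))"
      by (intro integrable_mult_left measure_pmf.integrable_const_bound[where B = 1]) auto
  qed (auto simp: pmf.rep_eq)
  finally have "pmf (xi_hat \<xi>) \<infinity> * (1 - b) = 0"
    by simp
  then have "b = 1"
    using pmf_xi_hat(2)[OF int] sub by simp
  then show ?thesis
    by (simp add: lossless_spmf_def b_def)
qed


section \<open>Total variation distance\<close>

definition tv_dist :: "'a measure \<Rightarrow> 'a measure \<Rightarrow> real" where
  "tv_dist P Q = (SUP A\<in>sets P. \<bar>measure P A - measure Q A\<bar>)"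

end

theory Submission
  imports Defs "HOL-Real_Asymp.Real_Asymp" "HOL-Computational_Algebra.Formal_Power_Series"
begin

text \<open>Let \<open>c = (1 - E[\<xi>]) / P(\<xi> \<in> \<Omega>)\<close>, so that \<open>1 / c\<close> is the mean of \<open>L \<Omega>\<close> under the law of the
  unconditioned tree. A tree can be recovered from \<open>F0\<close> and the list \<open>Fs\<close>, and the weight of a tree
  factorises accordingly: up to the factor \<open>1 / (1 - E[\<xi>])\<close> it is the probability that the tree with
  a marked leaf equals \<open>F0\<close>, times \<open>P(\<xi> = d)\<close> for the length \<open>d\<close> of \<open>Fs\<close>, times the weights of the
  entries of \<open>Fs\<close> (\<open>pmf_gw_decompose\<close>). So at a marked tree \<open>S\<close> and trees \<open>t\<^sub>1, \<dots>, t\<^sub>N\<close> the ratio of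
  the two probabilities that are compared is essentially

  \<open>(\<Sum>k. P(\<xi> = N + k) * P(Z\<^sub>k = m)) / ((1 - E[\<xi>]) * P(L = n))\<close>,

  where \<open>Z\<^sub>k\<close> is the total of \<open>L \<Omega>\<close> over \<open>k\<close> independent trees and \<open>m\<close> is the part of \<open>n\<close> that \<open>S\<close> and
  \<open>t\<^sub>1, \<dots>, t\<^sub>N\<close> leave over. Two probability measures are close in total variation as soon as
  this ratio is at least \<open>1 - \<epsilon>\<close> on a set that is likely for the second one (\<open>tv_dist_le\<close>). Hence a
  lower bound of the numerator, an upper bound of the denominator and a typical set suffice.

  Numerator (\<open>typical_ratio\<close>): if \<open>m\<close> is large but small compared with \<open>n\<close>, then
  \<open>\<Sum>k. P(Z\<^sub>k = m)\<close> is close to \<open>c\<close> by the renewal theorem, only \<open>k\<close> small compared with \<open>n\<close> contribute,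
  and \<open>P(\<xi> = N + k)\<close> is close to \<open>f(n) (c n)\<^bsup>-1-\<alpha>\<^esup>\<close> for these \<open>k\<close> by slow variation. The condition
  that no other outdegree reaches \<open>N\<close> costs little, since \<open>n P(\<xi> \<ge> N)\<close> tends to zero.

  Denominator (\<open>prob_L_upper\<close>): a tree with \<open>L = n\<close> needs a vertex with at least \<open>\<delta> n\<close> children,
  because on the complementary event a suitable exponential moment of \<open>L\<close> is bounded, which makes its
  probability at most of order \<open>n\<^bsup>-3-\<alpha>\<^esup>\<close> (\<open>no_big_jump\<close>). If there is such a vertex, then the decomposition
  and the renewal theorem give the upper bound \<open>c f(n) (c n)\<^bsup>-1-\<alpha>\<^esup> / (1 - E[\<xi>])\<close>.

  Typical set (\<open>typical_whp\<close>): the point is that the first \<open>N\<close> trees do not use up \<open>n\<close>, that is, that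
  \<open>m\<close> is large. A forest is explored by a random walk with steps \<open>\<xi> - 1\<close>
  (\<open>prob_walk_le_forest\<close>). The local limit theorem makes this walk tight on the scale
  \<open>g(n) n\<^bsup>1/\<theta>\<^esup>\<close> (\<open>tight_of_local_limit\<close>), and that scale is at least of order \<open>\<surd>n\<close>
  (\<open>scale_ge_sqrt\<close>), which also controls the number of steps in \<open>\<Omega>\<close>. Since \<open>r\<^sub>n\<close> is of larger order than
  the scale, the fluctuations do not matter.\<close>

unbundle no vec_syntax
unbundle fps_syntax

section \<open>Slowly varying functions\<close>

text \<open>The uniform convergence theorem in additive form. Any increment from \<open>x\<close> to \<open>x + u\<close> can be compared
  with the increments from \<open>x\<close> and from \<open>x + u\<close> to a common target. For a counterexample sequence the
  sets of bad targets would have measure at least one in total, but their measures tend to zero by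
  dominated convergence.\<close>

lemma uniform_increments:
  fixes k :: "real \<Rightarrow> real"
  assumes k[measurable]: "k \<in> borel_measurable borel"
    and lim: "\<And>u. ((\<lambda>x. k (x + u) - k x) \<longlongrightarrow> 0) at_top" and e: "e > 0"
  shows "\<forall>\<^sub>F x in at_top. \<forall>u\<in>{0..A}. \<bar>k (x + u) - k x\<bar> \<le> e"
proof (rule ccontr)
  assume "\<not> ?thesis"
  then have "\<exists>x u. x \<ge> real n \<and> u \<in> {0..A} \<and> \<bar>k (x + u) - k x\<bar> > e" for n
    unfolding eventually_at_top_linorder by (meson not_le)
  then obtain x u where x: "\<And>n. x n \<ge> real n" and u: "\<And>n. u n \<in> {0..A}"
    and bad: "\<And>n. \<bar>k (x n + u n) - k (x n)\<bar> > e"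
    by metis
  have xlim: "filterlim x at_top sequentially"
    by (rule filterlim_at_top_mono[OF filterlim_real_sequentially]) (use x in auto)
  have ylim: "filterlim (\<lambda>n. x n + u n) at_top sequentially"
    by (rule filterlim_at_top_mono[OF xlim]) (use u in auto)
  define F where "F z n t = (indicator {t. \<bar>k (z n + t) - k (z n)\<bar> \<ge> e / 2} t :: ennreal)"
    for z :: "nat \<Rightarrow> real" and n t
  have [measurable]: "F z n \<in> borel_measurable borel" for z n
    unfolding F_def by measurable
  have small: "(\<lambda>n. \<integral>\<^sup>+t. F z n t * indicator {0..B} t \<partial>lborel) \<longlonglongrightarrow> 0"
    if z: "filterlim z at_top sequentially" for z B
  proof -
    have "(\<lambda>n. \<integral>\<^sup>+t. F z n t * indicator {0..B} t \<partial>lborel)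
        \<longlonglongrightarrow> (\<integral>\<^sup>+t. 0 \<partial>(lborel :: real measure))"
    proof (rule nn_integral_dominated_convergence[where w = "indicator {0..B}"])
      have "(\<integral>\<^sup>+t. indicator {0..B} t \<partial>lborel) = ennreal (max 0 B)"
        by (cases "B \<ge> 0") auto
      then show "(\<integral>\<^sup>+t. indicator {0..B} t \<partial>lborel) < \<infinity>"
        by simp
      show "AE t in lborel. (\<lambda>n. F z n t * indicator {0..B} t) \<longlonglongrightarrow> 0"
      proof (rule AE_I2, rule tendsto_eventually)
        fix t :: real
        have "(\<lambda>n. k (z n + t) - k (z n)) \<longlonglongrightarrow> 0"
          by (rule filterlim_compose[OF lim z])
        then have "\<forall>\<^sub>F n in sequentially. \<bar>k (z n + t) - k (z n)\<bar> < e / 2"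
          using e by (auto dest!: tendstoD[where e = "e/2"] simp: dist_real_def)
        then show "\<forall>\<^sub>F n in sequentially. F z n t * indicator {0..B} t = 0"
          by eventually_elim (auto simp: F_def)
      qed
    qed (auto simp: F_def indicator_def)
    then show ?thesis by simp
  qed
  have "1 \<le> (\<integral>\<^sup>+t. F x n t * indicator {0..A + 1} t \<partial>lborel)
      + (\<integral>\<^sup>+t. F (\<lambda>n. x n + u n) n t * indicator {0..1} t \<partial>lborel)" for n
  proof -
    \<comment> \<open>An increment larger than \<open>e\<close> from \<open>x\<close> to \<open>x + u\<close> splits at every intermediate
      target \<open>x + u + t\<close> into two increments, one of which is at least \<open>e / 2\<close>.\<close>
    have split: "indicator {0..1} t \<le> F x n (u n + t) * indicator {0..A + 1} (u n + t)
        + F (\<lambda>n. x n + u n) n t * indicator {0..1} t" for t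
    proof (cases "t \<in> {0..1}")
      case True
      have "\<bar>k (x n + (u n + t)) - k (x n)\<bar> \<ge> e / 2
          \<or> \<bar>k (x n + u n + t) - k (x n + u n)\<bar> \<ge> e / 2"
        using bad[of n] unfolding add.assoc by linarith
      then show ?thesis
        using True u[of n] by (auto simp: F_def indicator_def add.assoc)
    qed auto
    have "1 = (\<integral>\<^sup>+t. indicator {0..1} (t::real) \<partial>lborel)"
      by simp
    also have "\<dots> \<le> (\<integral>\<^sup>+t. F x n (u n + t) * indicator {0..A + 1} (u n + t)
        + F (\<lambda>n. x n + u n) n t * indicator {0..1} t \<partial>lborel)"
      by (rule nn_integral_mono) (rule split)
    also have "\<dots> = (\<integral>\<^sup>+t. F x n (u n + t) * indicator {0..A + 1} (u n + t) \<partial>lborel)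
        + (\<integral>\<^sup>+t. F (\<lambda>n. x n + u n) n t * indicator {0..1} t \<partial>lborel)"
      by (rule nn_integral_add) auto
    also have "(\<integral>\<^sup>+t. F x n (u n + t) * indicator {0..A + 1} (u n + t) \<partial>lborel)
        = (\<integral>\<^sup>+t. F x n t * indicator {0..A + 1} t \<partial>lborel)"
      using nn_integral_real_affine[where f = "\<lambda>t. F x n t * indicator {0..A + 1} t"
          and c = 1 and t = "u n"] by simp
    finally show ?thesis .
  qed
  moreover have "(\<lambda>n. (\<integral>\<^sup>+t. F x n t * indicator {0..A + 1} t \<partial>lborel)
      + (\<integral>\<^sup>+t. F (\<lambda>n. x n + u n) n t * indicator {0..1} t \<partial>lborel)) \<longlonglongrightarrow> 0 + 0"
    by (intro tendsto_add small xlim ylim)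
  ultimately have "(1::ennreal) \<le> 0"
    by (intro LIMSEQ_le_const) auto
  then show False by simp
qed

lemma slowly_varying_pos: "slowly_varying f \<Longrightarrow> \<forall>\<^sub>F x in at_top. f x > 0"
  unfolding slowly_varying_def eventually_at_top_linorder by auto

lemma slowly_varying_uniform:
  assumes f: "slowly_varying f" and e: "e > 0"
  shows "\<forall>\<^sub>F x in at_top. \<forall>u\<in>{1..b}. \<bar>ln (f (u * x)) - ln (f x)\<bar> \<le> e"
proof -
  obtain a where meas: "set_borel_measurable borel {a..} f" and pos: "\<And>x. x \<ge> a \<Longrightarrow> f x > 0"
    using f unfolding slowly_varying_def by blast
  define k where "k = (\<lambda>x. ln (indicator {a..} (exp x) * f (exp x)))"
  have [measurable]: "(\<lambda>x. indicator {a..} x * f x) \<in> borel_measurable borel"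
    using meas by (simp add: set_borel_measurable_def)
  have k: "k \<in> borel_measurable borel"
    unfolding k_def by (rule borel_measurable_ln, rule measurable_compose[of exp borel borel]) auto
  have k_eq: "k x = ln (f (exp x))" if "exp x \<ge> a" for x
    using that by (simp add: k_def)
  have big: "\<forall>\<^sub>F x in at_top. exp x \<ge> a" for a :: real
    using exp_at_top by (auto simp: filterlim_at_top)
  have lim: "((\<lambda>x. k (x + u) - k x) \<longlongrightarrow> 0) at_top" for u
  proof -
    have "((\<lambda>x. f (exp u * x) / f x) \<longlongrightarrow> 1) at_top"
      using f by (simp add: slowly_varying_def)
    then have "((\<lambda>x. ln (f (exp u * exp x) / f (exp x))) \<longlongrightarrow> ln 1) at_top"
      by (intro tendsto_ln filterlim_compose[OF _ exp_at_top]) auto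
    moreover have "\<forall>\<^sub>F x in at_top. ln (f (exp u * exp x) / f (exp x)) = k (x + u) - k x"
      using big[of a] big[of "a / exp u"]
    proof eventually_elim
      case (elim x)
      then have "exp (x + u) \<ge> a"
        by (simp add: exp_add field_simps)
      moreover from this have "f (exp x) > 0" "f (exp (x + u)) > 0"
        using pos elim(1) by auto
      ultimately show ?case
        using elim(1) by (simp add: k_eq ln_div exp_add mult.commute)
    qed
    ultimately show ?thesis
      by (simp add: filterlim_cong)
  qed
  have "\<forall>\<^sub>F x in at_top. \<forall>u\<in>{0..ln b}. \<bar>k (x + u) - k x\<bar> \<le> e"
    by (rule uniform_increments[OF k lim e])
  then have "\<forall>\<^sub>F x in at_top. \<forall>u\<in>{0..ln b}. \<bar>k (ln x + u) - k (ln x)\<bar> \<le> e"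
    by (rule eventually_compose_filterlim[OF _ ln_at_top])
  then show ?thesis
    using eventually_gt_at_top[of 0] eventually_ge_at_top[of a]
  proof eventually_elim
    case (elim x)
    show ?case
    proof
      fix u assume u: "u \<in> {1..b}"
      then have "x * 1 \<le> x * u"
        using elim by (intro mult_left_mono) auto
      then have "a \<le> u * x"
        using elim by (metis mult.commute mult.right_neutral order_trans)
      moreover have "\<bar>k (ln x + ln u) - k (ln x)\<bar> \<le> e"
        using u elim by auto
      ultimately show "\<bar>ln (f (u * x)) - ln (f x)\<bar> \<le> e"
        using u elim by (simp add: k_eq exp_add mult.commute[of x u])
    qed
  qed
qed

text \<open>Potter's bound: \<open>x\<close> and \<open>y\<close> are connected by about \<open>ln (y / x)\<close> steps of ratio at most \<open>e\<close>, and each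
  step changes \<open>ln f\<close> by at most \<open>e\<close> by uniform convergence.\<close>

lemma slowly_varying_Potter:
  assumes f: "slowly_varying f" and e: "e > 0"
  shows "\<forall>\<^sub>F x in at_top. \<forall>y\<ge>x. \<bar>ln (f y) - ln (f x)\<bar> \<le> e * (ln (y / x) + 1)"
proof -
  obtain X where X: "\<And>x u. x \<ge> X \<Longrightarrow> u \<in> {1..exp 1} \<Longrightarrow> \<bar>ln (f (u * x)) - ln (f x)\<bar> \<le> e"
    using slowly_varying_uniform[OF f e, of "exp 1"] unfolding eventually_at_top_linorder by blast
  have step: "\<bar>ln (f (exp (real j) * u * x)) - ln (f x)\<bar> \<le> e * (real j + 1)"
    if "x \<ge> X" "x > 0" "u \<in> {1..exp 1}" for j u x
  proof (induction j)
    case (Suc j)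
    have "1 * 1 \<le> exp (real j) * u"
      using that by (intro mult_mono) auto
    then have "x \<le> exp (real j) * u * x"
      using that(2) by simp
    then have "\<bar>ln (f (exp 1 * (exp (real j) * u * x))) - ln (f (exp (real j) * u * x))\<bar> \<le> e"
      using that(1) by (intro X) auto
    moreover have "exp 1 * (exp (real j) * u * x) = exp (real (Suc j)) * u * x"
      by (simp add: exp_add algebra_simps)
    ultimately show ?case
      using Suc by (auto simp: algebra_simps)
  qed (use that in \<open>auto intro: X\<close>)
  show ?thesis
    using eventually_ge_at_top[of X] eventually_gt_at_top[of 0]
  proof eventually_elim
    case (elim x)
    show ?case
    proof (intro allI impI)
      fix y assume y: "y \<ge> x"
      define l j where "l = ln (y / x)" and "j = nat \<lfloor>l\<rfloor>"
      have l: "l \<ge> 0" "y = exp l * x"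
        using elim y by (auto simp: l_def)
      have j: "real j \<le> l" "l \<le> real j + 1"
        using l(1) by (auto simp: j_def)
      have "\<bar>ln (f (exp (real j) * exp (l - real j) * x)) - ln (f x)\<bar> \<le> e * (real j + 1)"
        using j elim by (intro step) auto
      also have "exp (real j) * exp (l - real j) * x = y"
        using l(2) by (simp add: exp_add[symmetric])
      also have "e * (real j + 1) \<le> e * (l + 1)"
        using e j by (intro mult_left_mono) auto
      finally show "\<bar>ln (f y) - ln (f x)\<bar> \<le> e * (ln (y / x) + 1)"
        by (simp add: l_def)
    qed
  qed
qed

lemma slowly_varying_powr_bounds:
  assumes f: "slowly_varying f" and e: "e > 0"
  shows "\<forall>\<^sub>F x in at_top. x powr (- e) \<le> f x \<and> f x \<le> x powr e"
proof -
  obtain X where X: "X > 1" "f X > 0" "\<And>y. y \<ge> X \<Longrightarrow> f y > 0"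
    "\<And>y. y \<ge> X \<Longrightarrow> \<bar>ln (f y) - ln (f X)\<bar> \<le> e / 2 * (ln (y / X) + 1)"
  proof -
    have "\<forall>\<^sub>F x in at_top. x > 1 \<and> (\<forall>y\<ge>x. f y > 0)
        \<and> (\<forall>y\<ge>x. \<bar>ln (f y) - ln (f x)\<bar> \<le> e / 2 * (ln (y / x) + 1))"
      using slowly_varying_Potter[OF f, of "e / 2"] e
        eventually_all_ge_at_top[OF slowly_varying_pos[OF f]]
      by (intro eventually_conj eventually_gt_at_top) auto
    then show ?thesis
      unfolding eventually_at_top_linorder using that by blast
  qed
  have "\<forall>\<^sub>F y in at_top. e / 2 * (ln y + 1) + \<bar>ln (f X)\<bar> \<le> e * ln y"
    using e by real_asymp
  then show ?thesis
    using eventually_ge_at_top[of X]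
  proof eventually_elim
    case (elim y)
    have "ln (y / X) \<le> ln y"
      using X(1) elim by (simp add: ln_div)
    then have "e / 2 * (ln (y / X) + 1) \<le> e / 2 * (ln y + 1)"
      using e by simp
    then have "\<bar>ln (f y)\<bar> \<le> e * ln y"
      using X(4)[of y] elim by linarith
    then have "exp (- e * ln y) \<le> exp (ln (f y))" "exp (ln (f y)) \<le> exp (e * ln y)"
      by auto
    then show ?case
      using X(1) X(3)[of y] elim by (simp add: powr_def)
  qed
qed

lemma slowly_varying_uniform_compact:
  assumes f: "slowly_varying f" and e: "e > 0" and b: "0 < b"
  shows "\<forall>\<^sub>F x in at_top. \<forall>u\<in>{b..B}. \<bar>ln (f (u * x)) - ln (f x)\<bar> \<le> e"
proof -
  define b' where "b' = min b 1"
  have b': "0 < b'" "b' \<le> b" "b' \<le> 1" using b by (auto simp: b'_def)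
  have "\<forall>\<^sub>F x in at_top. \<forall>u\<in>{1..max B 1 / b'}. \<bar>ln (f (u * x)) - ln (f x)\<bar> \<le> e / 2"
    using e by (intro slowly_varying_uniform[OF f]) simp
  moreover have "filterlim (\<lambda>x. b' * x) at_top at_top"
    using b' by real_asymp
  ultimately have "\<forall>\<^sub>F x in at_top. \<forall>u\<in>{1..max B 1 / b'}. \<bar>ln (f (u * (b' * x))) - ln (f (b' * x))\<bar> \<le> e / 2"
    by (rule eventually_compose_filterlim)
  then show ?thesis
  proof eventually_elim
    case (elim x)
    show ?case
    proof
      fix u assume u: "u \<in> {b..B}"
      have "\<bar>ln (f (u / b' * (b' * x))) - ln (f (b' * x))\<bar> \<le> e / 2"
        using u b' by (intro bspec[OF elim]) (auto simp: field_simps)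
      moreover have "\<bar>ln (f (1 / b' * (b' * x))) - ln (f (b' * x))\<bar> \<le> e / 2"
        using b' by (intro bspec[OF elim]) (auto simp: field_simps)
      moreover have "u / b' * (b' * x) = u * x" "1 / b' * (b' * x) = x"
        using b' by auto
      ultimately show "\<bar>ln (f (u * x)) - ln (f x)\<bar> \<le> e"
        by (simp only: abs_le_iff) linarith
    qed
  qed
qed

lemma scale_top:
  assumes g: "slowly_varying g" and \<theta>: "\<theta> > 0"
  shows "filterlim (\<lambda>n. g (real n) * real n powr (1 / \<theta>)) at_top sequentially"
proof (rule filterlim_at_top_mono)
  define e where "e = 1 / (2 * \<theta>)"
  have e: "e > 0" "- e + 1 / \<theta> = e" using \<theta> by (auto simp: e_def field_simps)
  show "filterlim (\<lambda>n. real n powr e) at_top sequentially"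
    using e(1) by real_asymp
  have "\<forall>\<^sub>F n in sequentially. real n powr (- e) \<le> g (real n) \<and> g (real n) \<le> real n powr e"
    by (rule eventually_compose_filterlim[OF slowly_varying_powr_bounds[OF g e(1)] filterlim_real_sequentially])
  then show "\<forall>\<^sub>F n in sequentially. real n powr e \<le> g (real n) * real n powr (1 / \<theta>)"
  proof eventually_elim
    case (elim n)
    have "real n powr e = real n powr (- e) * real n powr (1 / \<theta>)"
      using e(2) by (simp only: powr_add[symmetric])
    also have "\<dots> \<le> g (real n) * real n powr (1 / \<theta>)"
      using elim by (intro mult_right_mono) auto
    finally show ?case .
  qed
qed

text \<open>At comparable times the normalising sequence of the local limit theorem has comparable values, so
  the fluctuations of a walk of length proportional to \<open>n\<close> are still controlled by the value at \<open>n\<close>.\<close>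

lemma scale_comparable:
  assumes g: "slowly_varying g" and \<theta>: "\<theta> > 0" and b: "0 < b"
  shows "\<exists>B>0. \<forall>\<^sub>F n in sequentially. \<forall>M. b * real n \<le> real M \<and> real M \<le> b' * real n \<longrightarrow>
    g (real M) * real M powr (1 / \<theta>) \<le> B * (g (real n) * real n powr (1 / \<theta>))"
proof -
  define B where "B = max b' 1"
  have B: "B \<ge> b'" "B > 0" by (auto simp: B_def)
  have "\<forall>\<^sub>F n in sequentially. \<forall>u\<in>{b..B}. \<bar>ln (g (u * real n)) - ln (g (real n))\<bar> \<le> 1"
    by (rule eventually_compose_filterlim[OF slowly_varying_uniform_compact[OF g _ b] filterlim_real_sequentially]) simp
  moreover have "\<forall>\<^sub>F n in sequentially. \<forall>y\<ge>min b 1 * real n. g y > 0"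
  proof -
    have "filterlim (\<lambda>n. min b 1 * real n) at_top sequentially"
      using b by real_asymp
    then show ?thesis
      by (rule eventually_compose_filterlim[OF eventually_all_ge_at_top[OF slowly_varying_pos[OF g]]])
  qed
  ultimately have "\<forall>\<^sub>F n in sequentially. \<forall>M. b * real n \<le> real M \<and> real M \<le> b' * real n \<longrightarrow>
    g (real M) * real M powr (1 / \<theta>) \<le> (exp 1 * B powr (1 / \<theta>)) * (g (real n) * real n powr (1 / \<theta>))"
    using eventually_gt_at_top[of 0]
  proof eventually_elim
    case (elim n)
    have n: "0 < real n" using elim by simp
    show ?case
    proof (intro allI impI)
      fix M assume M: "b * real n \<le> real M \<and> real M \<le> b' * real n"
      have "min b 1 * real n \<le> b * real n" "min b 1 * real n \<le> 1 * real n" "b' * real n \<le> B * real n"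
        using B n by (auto intro!: mult_right_mono)
      then have pos: "0 < g (real M)" "0 < g (real n)" and M': "real M \<le> B * real n"
        using elim(2) M by auto
      have "\<bar>ln (g (real M / real n * real n)) - ln (g (real n))\<bar> \<le> 1"
        using M M' n by (intro bspec[OF elim(1)]) (auto simp: field_simps)
      then have "ln (g (real M)) \<le> 1 + ln (g (real n))"
        using n by (simp add: abs_le_iff)
      then have "exp (ln (g (real M))) \<le> exp (1 + ln (g (real n)))"
        by (simp only: exp_le_cancel_iff)
      then have "g (real M) \<le> exp 1 * g (real n)"
        using pos by (simp add: exp_add)
      moreover have "real M powr (1 / \<theta>) \<le> (B * real n) powr (1 / \<theta>)"
        using M' \<theta> by (intro powr_mono2) auto
      ultimately have "g (real M) * real M powr (1 / \<theta>) \<le> (exp 1 * g (real n)) * (B * real n) powr (1 / \<theta>)"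
        using pos by (intro mult_mono) auto
      then show "g (real M) * real M powr (1 / \<theta>) \<le> (exp 1 * B powr (1 / \<theta>)) * (g (real n) * real n powr (1 / \<theta>))"
        using B n by (simp add: powr_mult mult_ac)
    qed
  qed
  then show ?thesis
    using B by (intro exI[of _ "exp 1 * B powr (1 / \<theta>)"]) auto
qed

section \<open>The renewal theorem for integer-valued steps\<close>

text \<open>The argument \<open>q\<close> is the law of a step with values in the natural numbers, where the step zero is
  allowed. Convolution powers are handled as powers of the generating function \<open>Q\<close>; the coefficient
  \<open>U $ m\<close> is the expected number of visits to \<open>m\<close>. As \<open>U\<close> is the inverse of \<open>1 - Q\<close>, the renewal
  identities below are identities between formal power series and involve finite sums only.\<close>

locale renewal =
  fixes q :: "nat \<Rightarrow> real"
  assumes q_nonneg: "q j \<ge> 0" and q_sums: "q sums 1" and q0: "q 0 < 1"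
begin

definition Q :: "real fps" where "Q = Abs_fps q"
definition U :: "real fps" where "U = inverse (1 - Q)"

lemma Q_nth [simp]: "Q $ j = q j"
  by (simp add: Q_def)

lemma sum_q_le: "finite A \<Longrightarrow> sum q A \<le> 1"
  using sum_le_suminf[of q A] q_nonneg q_sums by (auto simp: sums_iff)

lemma U_Q: "U * (1 - Q) = 1"
  unfolding U_def using q0 by (intro inverse_mult_eq_1) auto

lemma power_nth_nonneg: "(\<And>j. P $ j \<ge> 0) \<Longrightarrow> (P ^ k) $ m \<ge> (0::real)"
  by (induction k arbitrary: m) (auto simp: fps_mult_nth intro!: sum_nonneg)

text \<open>This is the finite geometric series for \<open>Q\<close>. Its last term counts the visits to \<open>m\<close> from time \<open>K\<close> on,
  decomposed by the position at time \<open>K\<close>.\<close>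

lemma U_tail: "U $ m = (\<Sum>k<K. (Q ^ k) $ m) + (\<Sum>j\<le>m. (Q ^ K) $ j * U $ (m - j))"
proof -
  have "(1 - Q) * (\<Sum>k<K. Q ^ k) = 1 - Q ^ K"
    by (simp add: one_diff_power_eq)
  then have "U * (1 - Q) * (\<Sum>k<K. Q ^ k) = U * (1 - Q ^ K)"
    by (simp only: mult.assoc)
  then have "U * (1 - Q) * (\<Sum>k<K. Q ^ k) = U - Q ^ K * U"
    by (simp only: right_diff_distrib mult_1_right mult.commute[of U "Q ^ K"])
  then have "U = (\<Sum>k<K. Q ^ k) + Q ^ K * U"
    by (simp only: U_Q mult_1_left diff_add_cancel)
  then have "U $ m = ((\<Sum>k<K. Q ^ k) + Q ^ K * U) $ m"
    by simp
  then show ?thesis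
    by (simp add: fps_sum_nth fps_mult_nth atLeast0AtMost)
qed

lemma U_rec: "U $ m = (if m = 0 then 1 else 0) + (\<Sum>j\<le>m. q j * U $ (m - j))"
  using U_tail[of m 1] by simp

lemma U_bounds: "0 \<le> U $ m \<and> U $ m \<le> 1 / (1 - q 0)"
proof (induction m rule: less_induct)
  case (less m)
  have "(\<Sum>j\<le>m. q j * U $ (m - j)) = q 0 * U $ m + (\<Sum>j\<in>{1..m}. q j * U $ (m - j))"
    by (subst sum.remove[of _ 0]) (auto intro!: sum.cong)
  then have eq: "(1 - q 0) * U $ m = (if m = 0 then 1 else 0) + (\<Sum>j\<in>{1..m}. q j * U $ (m - j))"
    using U_rec[of m] by (simp add: algebra_simps)
  have IH: "0 \<le> U $ (m - j)" "U $ (m - j) \<le> 1 / (1 - q 0)" if "j \<in> {1..m}" for j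
    using less[of "m - j"] that by auto
  have "(1 - q 0) * U $ m \<ge> 0"
    unfolding eq using IH q_nonneg by (auto intro!: add_nonneg_nonneg sum_nonneg)
  moreover have "(1 - q 0) * U $ m \<le> 1"
  proof (cases "m = 0")
    case False
    have "(\<Sum>j\<in>{1..m}. q j * U $ (m - j)) \<le> (\<Sum>j\<in>{1..m}. q j * (1 / (1 - q 0)))"
      using IH q_nonneg by (intro sum_mono mult_left_mono) auto
    also have "\<dots> = (\<Sum>j\<in>{1..m}. q j) / (1 - q 0)"
      by (simp add: sum_divide_distrib)
    also have "(\<Sum>j\<in>{1..m}. q j) = sum q (insert 0 {1..m}) - q 0"
      by simp
    also have "\<dots> \<le> 1 - q 0"
      using sum_q_le[of "insert 0 {1..m}"] by simp
    finally show ?thesis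
      using False eq q0 by (simp add: divide_right_mono)
  qed (use eq in simp)
  ultimately show ?case
    using q0 by (simp add: zero_le_mult_iff pos_le_divide_eq mult.commute)
qed

lemma U_nonneg: "0 \<le> U $ m" and U_le: "U $ m \<le> 1 / (1 - q 0)"
  using U_bounds by auto

lemma sum_power_tail_le:
  "(\<Sum>j\<le>m. (Q ^ K) $ j * U $ (m - j)) \<le> (\<Sum>j\<le>m. (Q ^ K) $ j) / (1 - q 0)"
proof -
  have "(\<Sum>j\<le>m. (Q ^ K) $ j * U $ (m - j)) \<le> (\<Sum>j\<le>m. (Q ^ K) $ j * (1 / (1 - q 0)))"
    by (intro sum_mono mult_left_mono U_le power_nth_nonneg) (simp add: q_nonneg)
  then show ?thesis by (simp add: sum_divide_distrib)
qed

lemma sum_power_le_U: "(\<Sum>k<K. (Q ^ k) $ m) \<le> U $ m"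
  unfolding U_tail[of m K]
  by (auto intro!: sum_nonneg mult_nonneg_nonneg U_nonneg power_nth_nonneg simp: q_nonneg)

text \<open>The cost of discarding some steps: replacing \<open>Q\<close> by a smaller \<open>P\<close> in one of \<open>K\<close> steps loses at most
  the mass \<open>s\<close> of the discarded steps times the maximal expected number of visits.\<close>

lemma sum_power_diff_le:
  assumes P: "\<And>j. 0 \<le> P $ j" "\<And>j. P $ j \<le> q j" and s: "\<And>m. (\<Sum>j\<le>m. q j - P $ j) \<le> s"
  shows "(\<Sum>k<K. (Q ^ k) $ m - (P ^ k) $ m) \<le> real K * s / (1 - q 0)"
proof (induction K arbitrary: m)
  case (Suc K)
  define V where "V K = (\<Sum>k<K. Q ^ k - P ^ k)" for K
  have V_nth: "V K $ m = (\<Sum>k<K. (Q ^ k) $ m - (P ^ k) $ m)" for K m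
    by (simp add: V_def fps_sum_nth)
  have V_rec: "V (Suc K) = Q * V K + (Q - P) * (\<Sum>k<K. P ^ k)"
    unfolding V_def by (subst sum.lessThan_Suc_shift)
      (simp add: sum_distrib_left algebra_simps sum.distrib sum_subtractf)
  have s0: "0 \<le> s"
    using s[of 0] P(2)[of 0] by simp
  have PQ: "(P ^ k) $ j \<le> (Q ^ k) $ j" for k j
    by (induction k arbitrary: j)
      (auto simp: fps_mult_nth intro!: sum_mono mult_mono power_nth_nonneg P q_nonneg)
  have "(Q * V K) $ m \<le> (\<Sum>j=0..m. q j * (real K * s / (1 - q 0)))"
    unfolding fps_mult_nth Q_nth V_nth by (intro sum_mono mult_left_mono Suc q_nonneg)
  also have "\<dots> = (\<Sum>j=0..m. q j) * (real K * s / (1 - q 0))"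
    by (rule sum_distrib_right[symmetric])
  also have "\<dots> \<le> 1 * (real K * s / (1 - q 0))"
    using q0 s0 by (intro mult_right_mono sum_q_le) auto
  finally have 1: "(Q * V K) $ m \<le> real K * s / (1 - q 0)" by simp
  have "((Q - P) * (\<Sum>k<K. P ^ k)) $ m \<le> (\<Sum>j=0..m. (q j - P $ j) * (1 / (1 - q 0)))"
    unfolding fps_mult_nth
  proof (intro sum_mono mult_mono)
    fix j
    have "(\<Sum>k<K. P ^ k) $ (m - j) \<le> (\<Sum>k<K. (Q ^ k) $ (m - j))"
      unfolding fps_sum_nth by (intro sum_mono PQ)
    also have "\<dots> \<le> 1 / (1 - q 0)"
      using sum_power_le_U U_le by (rule order_trans)
    finally show "(\<Sum>k<K. P ^ k) $ (m - j) \<le> 1 / (1 - q 0)" .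
  qed (auto simp: fps_sum_nth P intro!: sum_nonneg power_nth_nonneg)
  also have "\<dots> = (\<Sum>j\<le>m. q j - P $ j) * (1 / (1 - q 0))"
    by (simp add: sum_divide_distrib atLeast0AtMost)
  also have "\<dots> \<le> s * (1 / (1 - q 0))"
    using q0 by (intro mult_right_mono s) auto
  finally have 2: "((Q - P) * (\<Sum>k<K. P ^ k)) $ m \<le> s / (1 - q 0)" by simp
  have "V (Suc K) $ m \<le> real K * s / (1 - q 0) + s / (1 - q 0)"
    unfolding V_rec using 1 2 by simp
  then show ?case
    unfolding V_nth by (simp add: add_divide_distrib algebra_simps)
qed auto

definition surv :: "nat \<Rightarrow> real" where "surv j = 1 - (\<Sum>i\<le>j. q i)"

lemma surv_nonneg: "surv j \<ge> 0"
  using sum_q_le[of "{..j}"] by (simp add: surv_def)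

text \<open>The last position of the walk that is at most \<open>n\<close> exists, and the walk leaves it by a jump beyond
  \<open>n\<close>.\<close>

lemma surv_U: "(\<Sum>i\<le>n. surv i * U $ (n - i)) = 1"
proof -
  define R where "R = Abs_fps surv"
  have "(1 - fps_X) * R = 1 - Q"
  proof (rule fps_ext)
    fix n show "((1 - fps_X) * R) $ n = (1 - Q) $ n"
      by (cases n) (auto simp: R_def surv_def left_diff_distrib)
  qed
  then have one: "(1 - fps_X) * (R * U) = 1"
    using U_Q by (simp only: mult.assoc[symmetric] mult.commute[of "1 - Q" U])
  have "(1 - fps_X) * Abs_fps (\<lambda>_. 1::real) = 1"
  proof (rule fps_ext)
    fix n show "((1 - fps_X) * Abs_fps (\<lambda>_. 1::real)) $ n = 1 $ n"
      by (cases n) (auto simp: left_diff_distrib)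
  qed
  then have "R * U = ((1 - fps_X) * Abs_fps (\<lambda>_. 1)) * (R * U)"
    by simp
  also have "\<dots> = Abs_fps (\<lambda>_. 1) * ((1 - fps_X) * (R * U))"
    by (simp only: mult_ac)
  also have "\<dots> = Abs_fps (\<lambda>_. 1)"
    using one by simp
  finally have "R * U = Abs_fps (\<lambda>_. 1)" .
  then have "(R * U) $ n = 1" by simp
  then show ?thesis
    by (simp add: fps_mult_nth R_def atLeast0AtMost)
qed

text \<open>The maximum principle behind the renewal theorem: \<open>v (r k)\<close> is an average of the values
  \<open>v (r k - i)\<close>, none of which can exceed the limit superior \<open>l\<close> by much. If the average is close
  to \<open>l\<close>, then so is every value that has positive weight.\<close>

lemma limsup_shift:
  fixes v :: "nat \<Rightarrow> real"
  assumes rec: "\<And>n. n > 0 \<Longrightarrow> v n = (\<Sum>i\<le>n. q i * v (n - i))" and B: "\<And>n. \<bar>v n\<bar> \<le> B"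
    and sup: "\<And>e. e > 0 \<Longrightarrow> \<forall>\<^sub>F n in sequentially. v n \<le> l + e"
    and r: "filterlim r at_top sequentially" "(\<lambda>k. v (r k)) \<longlonglongrightarrow> l" and j: "q j > 0"
  shows "(\<lambda>k. v (r k - j)) \<longlonglongrightarrow> l"
proof -
  define y where "y k i = (if i \<le> r k then max (v (r k - i) - l) 0 else 0)" for k i
  have r_shift: "filterlim (\<lambda>k. r k - i) at_top sequentially" for i
    using filterlim_compose[OF filterlim_minus_const_nat_at_top r(1)] .
  have r_ge: "\<forall>\<^sub>F k in sequentially. r k \<ge> i" for i
    using r(1) by (auto simp: filterlim_at_top)
  have y_lim: "(\<lambda>k. y k i) \<longlonglongrightarrow> 0" for i
  proof (rule tendstoI)
    fix e :: real assume "e > 0"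
    then have "\<forall>\<^sub>F k in sequentially. v (r k - i) \<le> l + e / 2"
      by (intro eventually_compose_filterlim[OF sup r_shift]) auto
    then show "\<forall>\<^sub>F k in sequentially. dist (y k i) 0 < e"
      by eventually_elim (use \<open>e > 0\<close> in \<open>auto simp: y_def\<close>)
  qed
  have y_bound: "\<bar>y k i\<bar> \<le> B + \<bar>l\<bar>" for k i
    using B[of "r k - i"] by (auto simp: y_def)
  have sum_y: "(\<lambda>k. \<Sum>i. q i * y k i) \<longlonglongrightarrow> 0"
  proof -
    have "(\<lambda>k. \<Sum>i. q i * y k i) \<longlonglongrightarrow> (\<Sum>i::nat. 0)"
    proof (rule tannerys_theorem[THEN conjunct2, THEN conjunct2])
      show "(\<lambda>k. q i * y k i) \<longlonglongrightarrow> 0" for i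
        by (intro tendsto_mult_right_zero y_lim)
      show "\<forall>\<^sub>F (i, k) in sequentially \<times>\<^sub>F sequentially. norm (q i * y k i) \<le> q i * (B + \<bar>l\<bar>)"
        using y_bound q_nonneg by (auto simp: abs_mult intro!: always_eventually mult_left_mono)
      show "summable (\<lambda>i. q i * (B + \<bar>l\<bar>))"
        using q_sums by (intro summable_mult2) (auto simp: sums_iff)
    qed simp
    then show ?thesis by simp
  qed
  have sum_y_fin: "(\<Sum>i\<le>r k. q i * y k i) = (\<Sum>i. q i * y k i)" for k
    by (rule suminf_finite[symmetric]) (auto simp: y_def)
  have sum_q: "(\<lambda>k. \<Sum>i\<le>r k. q i) \<longlonglongrightarrow> 1"
    by (rule filterlim_compose[OF _ r(1)]) (use q_sums in \<open>simp add: sums_def_le\<close>)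
  define z where "z k = l * (\<Sum>i\<le>r k. q i) - v (r k)" for k
  have "z \<longlonglongrightarrow> l * 1 - l"
    unfolding z_def by (intro tendsto_intros sum_q r)
  then have zy: "(\<lambda>k. z k + (\<Sum>i. q i * y k i)) \<longlonglongrightarrow> 0"
    using tendsto_add[OF _ sum_y, of z 0] by simp
  have "(\<lambda>k. q j * (l - v (r k - j))) \<longlonglongrightarrow> 0"
  proof (rule tendsto_sandwich)
    show "(\<lambda>k. - (q j * y k j)) \<longlonglongrightarrow> 0"
      using tendsto_minus[OF tendsto_mult_right_zero[OF y_lim, of "q j" j]] by simp
    show "\<forall>\<^sub>F k in sequentially. - (q j * y k j) \<le> q j * (l - v (r k - j))"
      using r_ge[of j]
    proof eventually_elim
      case (elim k)
      then have "q j * (v (r k - j) - l) \<le> q j * y k j"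
        by (intro mult_left_mono q_nonneg) (auto simp: y_def)
      then show ?case by (simp add: algebra_simps)
    qed
    show "\<forall>\<^sub>F k in sequentially. q j * (l - v (r k - j)) \<le> z k + (\<Sum>i. q i * y k i)"
      using r_ge[of "max 1 j"]
    proof eventually_elim
      case (elim k)
      define x where "x i = max (l - v (r k - i)) 0" for i
      have "q j * (l - v (r k - j)) \<le> q j * x j"
        by (intro mult_left_mono q_nonneg) (auto simp: x_def)
      also have "\<dots> \<le> (\<Sum>i\<le>r k. q i * x i)"
        using elim by (intro member_le_sum) (auto simp: x_def q_nonneg)
      also have "\<dots> = (\<Sum>i\<le>r k. q i * l - q i * v (r k - i) + q i * y k i)"
        by (intro sum.cong) (auto simp: x_def y_def algebra_simps max_def)
      also have "\<dots> = z k + (\<Sum>i\<le>r k. q i * y k i)"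
        using rec[of "r k"] elim
        by (simp add: z_def sum.distrib sum_subtractf sum_distrib_left mult.commute)
      finally show ?case by (simp add: sum_y_fin)
    qed
  qed (rule zy)
  then have "(\<lambda>k. l - q j * (l - v (r k - j)) / q j) \<longlonglongrightarrow> l - 0 / q j"
    using j by (intro tendsto_intros) auto
  then show ?thesis
    using j by simp
qed

text \<open>Along a subsequence that attains the limit superior \<open>l\<close>, all shifts of \<open>v\<close> by sums of possible steps
  tend to \<open>l\<close> as well. Two consecutive possible steps generate all large numbers, so that, after one
  fixed shift, all values tend to \<open>l\<close>, and the conserved sum \<open>s\<close> determines \<open>l\<close>. Stated for a general
  \<open>v\<close> because it is used both for \<open>U\<close> and for \<open>- U\<close>.\<close>

lemma limsup_le:
  fixes v :: "nat \<Rightarrow> real"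
  assumes aper: "q j > 0" "q (Suc j) > 0" and surv: "summable surv"
    and rec: "\<And>n. n > 0 \<Longrightarrow> v n = (\<Sum>i\<le>n. q i * v (n - i))" and B: "\<And>n. \<bar>v n\<bar> \<le> B"
    and s: "\<And>n. (\<Sum>i\<le>n. surv i * v (n - i)) = s" and e: "e > 0"
  shows "\<forall>\<^sub>F n in sequentially. v n \<le> s / suminf surv + e"
proof -
  obtain r l where r: "strict_mono r" "(\<lambda>k. v (r k)) \<longlonglongrightarrow> l"
    and sup: "\<And>e. e > 0 \<Longrightarrow> \<forall>\<^sub>F n in sequentially. v n \<le> l + e"
  proof -
    obtain r :: "nat \<Rightarrow> nat" where r: "strict_mono r"
      and lim: "((\<lambda>n. ereal (v n)) \<circ> r) \<longlonglongrightarrow> limsup (\<lambda>n. ereal (v n))"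
      using limsup_subseq_lim by blast
    have "limsup (\<lambda>n. ereal (v n)) \<le> ereal B"
      using B by (intro Limsup_bounded always_eventually) (auto simp: abs_le_iff)
    moreover have "ereal (- B) \<le> limsup (\<lambda>n. ereal (v n))"
      using B by (intro le_Limsup always_eventually) (auto simp: abs_le_iff minus_le_iff)
    ultimately obtain l where l: "limsup (\<lambda>n. ereal (v n)) = ereal l"
      by (cases "limsup (\<lambda>n. ereal (v n))") auto
    show ?thesis
    proof
      show "strict_mono r" by (rule r)
      show "(\<lambda>k. v (r k)) \<longlonglongrightarrow> l"
        using lim unfolding l by (simp add: o_def)
      fix e :: real assume "e > 0"
      then have "limsup (\<lambda>n. ereal (v n)) < ereal (l + e)"
        unfolding l by simp
      from Limsup_lessD[OF this] show "\<forall>\<^sub>F n in sequentially. v n \<le> l + e"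
        by eventually_elim simp
    qed
  qed
  have r_top: "filterlim (\<lambda>k. r k - i) at_top sequentially" for i
    using filterlim_compose[OF filterlim_minus_const_nat_at_top filterlim_subseq[OF r(1)]] .
  define J where "J = {i. (\<lambda>k. v (r k - i)) \<longlonglongrightarrow> l}"
  have J_add: "i + i' \<in> J" if "i \<in> J" "q i' > 0" for i i'
    using limsup_shift[OF rec B sup r_top _ that(2), of i] that(1) by (simp add: J_def)
  have J_comb: "a * j + b * Suc j \<in> J" for a b
  proof (induction b)
    case 0
    show ?case
    proof (induction a)
      case 0
      then show ?case using r by (simp add: J_def)
    next
      case (Suc a)
      then show ?case using J_add[OF _ aper(1), of "a * j"] by (simp add: add.commute)
    qed
  next
    case (Suc b)
    then show ?case
      using J_add[OF Suc aper(2)] by (simp add: algebra_simps)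
  qed
  \<comment> \<open>Two consecutive steps \<open>j\<close> and \<open>j + 1\<close> generate every number from \<open>j\<^sup>2\<close> on.\<close>
  have J_large: "i \<in> J" if "i \<ge> j * j" for i
  proof (cases "j = 0")
    case True
    then show ?thesis using J_comb[of 0 i] by simp
  next
    case False
    define a b where "a = i div j" and "b = i mod j"
    have "b < j" "i = a * j + b"
      using False by (auto simp: a_def b_def)
    moreover have "j \<le> a"
      using that False by (simp add: a_def less_eq_div_iff_mult_less_eq)
    ultimately have "i = (a - b) * j + b * Suc j"
      by (simp add: diff_mult_distrib)
    then show ?thesis using J_comb by metis
  qed
  define t where "t k = r k - j * j" for k
  have t_lim: "(\<lambda>k. v (t k - i)) \<longlonglongrightarrow> l" for i
    using J_large[of "j * j + i"] by (simp add: J_def t_def)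
  have t_top: "filterlim t at_top sequentially"
    unfolding t_def by (rule r_top)
  have "(\<lambda>k. \<Sum>i. if i \<le> t k then surv i * v (t k - i) else 0) \<longlonglongrightarrow> (\<Sum>i. surv i * l)"
  proof (rule tannerys_theorem[THEN conjunct2, THEN conjunct2])
    show "(\<lambda>k. if i \<le> t k then surv i * v (t k - i) else 0) \<longlonglongrightarrow> surv i * l" for i
    proof (rule Lim_transform_eventually)
      show "(\<lambda>k. surv i * v (t k - i)) \<longlonglongrightarrow> surv i * l"
        by (intro tendsto_intros t_lim)
      show "\<forall>\<^sub>F k in sequentially. surv i * v (t k - i)
          = (if i \<le> t k then surv i * v (t k - i) else 0)"
        using t_top[unfolded filterlim_at_top, rule_format, of i] by eventually_elim simp
    qed
    have "0 \<le> B"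
      using B[of 0] by simp
    then show "\<forall>\<^sub>F (i, k) in sequentially \<times>\<^sub>F sequentially.
        norm (if i \<le> t k then surv i * v (t k - i) else 0) \<le> surv i * B"
      using B surv_nonneg by (auto simp: abs_mult intro!: always_eventually mult_left_mono)
    show "summable (\<lambda>i. surv i * B)"
      using surv by (rule summable_mult2)
  qed simp
  also have "(\<lambda>k. \<Sum>i. if i \<le> t k then surv i * v (t k - i) else 0) = (\<lambda>k. s)"
  proof
    fix k
    have "(\<Sum>i. if i \<le> t k then surv i * v (t k - i) else 0) = (\<Sum>i\<le>t k. surv i * v (t k - i))"
      by (subst suminf_finite[where N = "{..t k}"]) auto
    then show "(\<Sum>i. if i \<le> t k then surv i * v (t k - i) else 0) = s"
      by (simp add: s)
  qed
  also have "(\<Sum>i. surv i * l) = suminf surv * l"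
    using surv by (rule suminf_mult2[symmetric])
  finally have "s = suminf surv * l"
    by (simp add: LIMSEQ_const_iff)
  moreover have "suminf surv > 0"
  proof -
    have "surv 0 > 0" using q0 by (simp add: surv_def)
    then show ?thesis using surv surv_nonneg by (intro suminf_pos2[of _ 0]) auto
  qed
  ultimately have "s / suminf surv = l" by simp
  then show ?thesis using sup[OF e] by simp
qed

theorem renewal_theorem:
  assumes "q j > 0" "q (Suc j) > 0" "summable surv"
  shows "(\<lambda>n. U $ n) \<longlonglongrightarrow> 1 / suminf surv"
proof (rule tendstoI)
  fix e :: real assume e: "e > 0"
  have "\<forall>\<^sub>F n in sequentially. U $ n \<le> 1 / suminf surv + e / 2"
  proof (rule limsup_le[OF assms])
    show "\<bar>U $ n\<bar> \<le> 1 / (1 - q 0)" for n using U_bounds[of n] by simp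
    show "U $ n = (\<Sum>i\<le>n. q i * U $ (n - i))" if "n > 0" for n using U_rec[of n] that by simp
  qed (use e surv_U in auto)
  moreover have "\<forall>\<^sub>F n in sequentially. - U $ n \<le> (- 1) / suminf surv + e / 2"
  proof (rule limsup_le[OF assms])
    show "\<bar>- U $ n\<bar> \<le> 1 / (1 - q 0)" for n using U_bounds[of n] by simp
    show "- U $ n = (\<Sum>i\<le>n. q i * - U $ (n - i))" if "n > 0" for n
      using U_rec[of n] that by (simp add: sum_negf)
    show "(\<Sum>i\<le>n. surv i * - U $ (n - i)) = - 1" for n
      using surv_U[of n] by (simp add: sum_negf)
  qed (use e in auto)
  ultimately show "\<forall>\<^sub>F n in sequentially. dist (U $ n) (1 / suminf surv) < e"
    by eventually_elim (use e in \<open>auto simp: dist_real_def abs_less_iff\<close>)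
qed

end

section \<open>Sums of independent samples\<close>

lemma nn_integral_replicate_pmf_prod:
  "(\<integral>\<^sup>+xs. prod_list (map f xs) \<partial>replicate_pmf k p) = (\<integral>\<^sup>+x. f x \<partial>p) ^ k"
  by (induction k) (auto simp: nn_integral_cmult nn_integral_multc)

lemma nn_integral_replicate_pmf_sum:
  "(\<integral>\<^sup>+xs. sum_list (map f xs) \<partial>replicate_pmf k p) = of_nat k * (\<integral>\<^sup>+x. f x \<partial>p)"
  by (induction k) (auto simp: nn_integral_add algebra_simps)

lemma replicate_pmf_Chernoff:
  fixes X :: "'a \<Rightarrow> real"
  shows "emeasure (replicate_pmf k p) {xs. b \<le> sum_list (map X xs)}
    \<le> ennreal (exp (- b)) * (\<integral>\<^sup>+x. ennreal (exp (X x)) \<partial>p) ^ k"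
proof -
  have exp_sum: "ennreal (exp (sum_list (map X xs))) = prod_list (map (\<lambda>x. ennreal (exp (X x))) xs)"
    for xs
    by (induction xs) (auto simp: exp_add ennreal_mult)
  have "emeasure (replicate_pmf k p) {xs. b \<le> sum_list (map X xs)}
      = (\<integral>\<^sup>+xs. indicator {xs. b \<le> sum_list (map X xs)} xs \<partial>replicate_pmf k p)"
    by simp
  also have "\<dots> \<le> (\<integral>\<^sup>+xs. ennreal (exp (- b)) * ennreal (exp (sum_list (map X xs)))
      \<partial>replicate_pmf k p)"
    by (intro nn_integral_mono)
      (auto simp: indicator_def ennreal_mult[symmetric] exp_add[symmetric] ennreal_ge_1)
  also have "\<dots> = ennreal (exp (- b)) * (\<integral>\<^sup>+x. ennreal (exp (X x)) \<partial>p) ^ k"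
    by (simp add: nn_integral_cmult exp_sum nn_integral_replicate_pmf_prod)
  finally show ?thesis .
qed

text \<open>At \<open>s = 0\<close> the Laplace transform has derivative minus the mean.\<close>

lemma exp_minus_nonneg_mean:
  fixes X :: "'a \<Rightarrow> real"
  assumes X: "\<And>x. X x \<ge> 0" "integrable (measure_pmf p) X" and e: "e > 0"
  shows "\<exists>s>0. (\<integral>\<^sup>+x. ennreal (exp (- s * X x)) \<partial>p)
    \<le> ennreal (exp (- s * (measure_pmf.expectation p X - e)))"
proof -
  define m where "m = measure_pmf.expectation p X"
  define s where "s n = 1 / real (Suc n)" for n
  have s: "s n > 0" for n by (simp add: s_def)
  have int: "integrable (measure_pmf p) (\<lambda>x. exp (- s n * X x))" for n
    using X(1) s[of n] by (intro measure_pmf.integrable_const_bound[where B = 1]) auto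
  have "(\<lambda>n. measure_pmf.expectation p (\<lambda>x. (1 - exp (- s n * X x)) / s n)) \<longlonglongrightarrow> m"
    unfolding m_def
  proof (rule integral_dominated_convergence[where w = X])
    show "AE x in measure_pmf p. (\<lambda>n. (1 - exp (- s n * X x)) / s n) \<longlonglongrightarrow> X x"
    proof (rule AE_I2)
      fix x
      have "((\<lambda>t. (1 - exp (- t * X x)) / t) \<longlongrightarrow> X x) (at_right 0)"
        using X(1)[of x] by real_asymp
      moreover have "filterlim s (at_right 0) sequentially"
        unfolding s_def by real_asymp
      ultimately show "(\<lambda>n. (1 - exp (- s n * X x)) / s n) \<longlonglongrightarrow> X x"
        by (rule filterlim_compose)
    qed
    fix n
    show "AE x in measure_pmf p. norm ((1 - exp (- s n * X x)) / s n) \<le> X x"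
    proof (rule AE_I2)
      fix x
      have "1 - s n * X x \<le> exp (- s n * X x)"
        using exp_ge_add_one_self[of "- s n * X x"] by simp
      moreover have "exp (- s n * X x) \<le> 1"
        using X(1) s[of n] by simp
      ultimately show "norm ((1 - exp (- s n * X x)) / s n) \<le> X x"
        using s[of n] by (simp add: divide_le_eq mult.commute)
    qed
  qed (use X in auto)
  then have "\<forall>\<^sub>F n in sequentially. measure_pmf.expectation p (\<lambda>x. (1 - exp (- s n * X x)) / s n) > m - e"
    by (rule order_tendstoD) (use e in simp)
  then obtain n where n: "measure_pmf.expectation p (\<lambda>x. (1 - exp (- s n * X x)) / s n) > m - e"
    by (auto simp: eventually_sequentially)
  have "(1 - measure_pmf.expectation p (\<lambda>x. exp (- s n * X x))) / s n
      = measure_pmf.expectation p (\<lambda>x. (1 - exp (- s n * X x)) / s n)"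
    using int by (simp add: Bochner_Integration.integral_diff)
  then have "measure_pmf.expectation p (\<lambda>x. exp (- s n * X x)) \<le> 1 + (- s n * (m - e))"
    using n s[of n] by (simp add: field_simps)
  also have "\<dots> \<le> exp (- s n * (m - e))"
    by (rule exp_ge_add_one_self)
  finally have "ennreal (measure_pmf.expectation p (\<lambda>x. exp (- s n * X x)))
      \<le> ennreal (exp (- s n * (m - e)))"
    by (rule ennreal_leI)
  also have "ennreal (measure_pmf.expectation p (\<lambda>x. exp (- s n * X x)))
      = (\<integral>\<^sup>+x. ennreal (exp (- s n * X x)) \<partial>p)"
    using int by (intro nn_integral_eq_integral[symmetric]) auto
  finally show ?thesis
    using s[of n] unfolding m_def by blast
qed

text \<open>Chernoff's bound, with the Laplace transform, which is finite for a nonnegative variable.\<close>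

lemma weak_law_lower:
  fixes X :: "'a \<Rightarrow> real"
  assumes X: "\<And>x. X x \<ge> 0" "integrable (measure_pmf p) X" and e: "e > 0"
  shows "(\<lambda>k. measure_pmf.prob (replicate_pmf k p)
    {xs. sum_list (map X xs) \<le> (measure_pmf.expectation p X - e) * real k}) \<longlonglongrightarrow> 0"
proof -
  define m where "m = measure_pmf.expectation p X"
  obtain s where s: "s > 0"
    "(\<integral>\<^sup>+x. ennreal (exp (- s * X x)) \<partial>p) \<le> ennreal (exp (- s * (m - e / 2)))"
    using exp_minus_nonneg_mean[OF X, of "e / 2"] e by (auto simp: m_def)
  have neg: "(\<Sum>x\<leftarrow>xs. - s * X x) = - s * sum_list (map X xs)" for xs
    by (induction xs) (auto simp: algebra_simps)
  have bound: "measure_pmf.prob (replicate_pmf k p) {xs. sum_list (map X xs) \<le> (m - e) * real k}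
      \<le> exp (- s * e / 2) ^ k" for k
  proof -
    have "{xs. sum_list (map X xs) \<le> (m - e) * real k}
        = {xs. - s * ((m - e) * real k) \<le> sum_list (map (\<lambda>x. - s * X x) xs)}"
      using s(1) unfolding neg by auto
    then have "emeasure (replicate_pmf k p) {xs. sum_list (map X xs) \<le> (m - e) * real k}
        \<le> ennreal (exp (- (- s * ((m - e) * real k))))
          * (\<integral>\<^sup>+x. ennreal (exp (- s * X x)) \<partial>p) ^ k"
      using replicate_pmf_Chernoff[where X = "\<lambda>x. - s * X x"] by metis
    also have "\<dots> \<le> ennreal (exp (- (- s * ((m - e) * real k)))) * ennreal (exp (- s * (m - e / 2))) ^ k"
      by (intro mult_left_mono power_mono s) auto
    also have "\<dots> = ennreal (exp (- (- s * ((m - e) * real k))) * exp (- s * (m - e / 2)) ^ k)"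
      by (simp add: ennreal_mult ennreal_power)
    also have "exp (- (- s * ((m - e) * real k))) * exp (- s * (m - e / 2)) ^ k = exp (- s * e / 2) ^ k"
      by (simp add: exp_of_nat_mult[symmetric] exp_add[symmetric] algebra_simps)
    finally show ?thesis
      by (simp add: measure_pmf.emeasure_eq_measure)
  qed
  have lim: "(\<lambda>k. exp (- s * e / 2) ^ k) \<longlonglongrightarrow> 0"
    using s(1) e by (intro LIMSEQ_power_zero) auto
  show ?thesis
    unfolding m_def[symmetric]
    by (rule tendsto_sandwich[OF _ _ tendsto_const lim]) (use bound in auto)
qed

text \<open>Truncate at a level \<open>C\<close>. The truncated part is \<open>C\<close> minus a nonnegative variable, to which the
  lower bound applies, and the remainder has a small mean, so that Markov's inequality suffices.\<close>

lemma weak_law_upper: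
  fixes X :: "'a \<Rightarrow> real"
  assumes X: "\<And>x. X x \<ge> 0" "integrable (measure_pmf p) X" and e: "e > 0"
  shows "(\<lambda>k. measure_pmf.prob (replicate_pmf k p)
    {xs. (measure_pmf.expectation p X + e) * real k \<le> sum_list (map X xs)}) \<longlonglongrightarrow> 0"
proof (rule LIMSEQ_I)
  fix d :: real assume d: "d > 0"
  define m where "m = measure_pmf.expectation p X"
  define Y where "Y C x = min (X x) (real C)" for C x
  have Y_int: "integrable (measure_pmf p) (Y C)" for C
    using X(1) by (intro measure_pmf.integrable_const_bound[where B = "real C"]) (auto simp: Y_def)
  have "(\<lambda>C. measure_pmf.expectation p (Y C)) \<longlonglongrightarrow> m"
    unfolding m_def
  proof (rule integral_dominated_convergence[where w = X])
    show "AE x in measure_pmf p. (\<lambda>C. Y C x) \<longlonglongrightarrow> X x"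
    proof (rule AE_I2, rule tendsto_eventually)
      fix x
      show "\<forall>\<^sub>F C in sequentially. Y C x = X x"
        using eventually_ge_at_top[of "nat \<lceil>X x\<rceil>"] by eventually_elim (auto simp: Y_def)
    qed
  qed (use X in \<open>auto simp: Y_def\<close>)
  then have "\<forall>\<^sub>F C in sequentially. measure_pmf.expectation p (Y C) > m - e * d / 4"
    by (rule order_tendstoD) (use e d in simp)
  then obtain C where C: "measure_pmf.expectation p (Y C) > m - e * d / 4"
    by (auto simp: eventually_sequentially)
  define Z where "Z x = real C - Y C x" for x
  define W where "W x = X x - Y C x" for x
  have Z: "Z x \<ge> 0" "integrable (measure_pmf p) Z" for x
    using Y_int[of C] by (simp_all add: Z_def[abs_def]) (simp add: Y_def)
  have W: "W x \<ge> 0" "integrable (measure_pmf p) W" for x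
    using Y_int[of C] X by (simp_all add: W_def[abs_def]) (simp add: Y_def)
  have EZ: "measure_pmf.expectation p Z = real C - measure_pmf.expectation p (Y C)"
    using Y_int by (simp add: Z_def[abs_def])
  have EW: "measure_pmf.expectation p W < e * d / 4"
    using Y_int X(2) C by (simp add: W_def[abs_def] m_def)
  have EW_nonneg: "0 \<le> measure_pmf.expectation p W"
    using W by (intro integral_nonneg_AE) auto
  define P where "P k = measure_pmf.prob (replicate_pmf k p)" for k
  have "(\<lambda>k. P k {xs. sum_list (map Z xs) \<le> (measure_pmf.expectation p Z - e / 2) * real k}) \<longlonglongrightarrow> 0"
    unfolding P_def using e by (intro weak_law_lower Z) auto
  then have "\<forall>\<^sub>F k in sequentially.
      P k {xs. sum_list (map Z xs) \<le> (measure_pmf.expectation p Z - e / 2) * real k} < d / 2"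
    by (rule order_tendstoD) (use d in simp)
  then have "\<forall>\<^sub>F k in sequentially. P k {xs. (m + e) * real k \<le> sum_list (map X xs)} < d"
    using eventually_gt_at_top[of 0]
  proof eventually_elim
    case (elim k)
    have markov: "P k {xs. e / 2 * real k \<le> sum_list (map W xs)} \<le> d / 2"
    proof -
      have W_nonneg: "0 \<le> sum_list (map W xs)" for xs
        using W(1) by (auto intro!: sum_list_nonneg)
      have key: "1 \<le> ennreal (2 / (e * real k)) * ennreal y \<longleftrightarrow> e / 2 * real k \<le> y"
        if "0 \<le> y" for y
      proof -
        have "ennreal (2 / (e * real k)) * ennreal y = ennreal (2 / (e * real k) * y)"
          using e that by (intro ennreal_mult[symmetric]) auto
        then show ?thesis
          using e elim(2) by (simp add: ennreal_ge_1 field_simps)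
      qed
      have W_sum: "ennreal (sum_list (map W xs)) = sum_list (map (\<lambda>x. ennreal (W x)) xs)" for xs
      proof (induction xs)
        case (Cons a xs)
        then show ?case
          using W(1) W_nonneg by (simp add: ennreal_plus)
      qed simp
      have "emeasure (replicate_pmf k p) {xs. e / 2 * real k \<le> sum_list (map W xs)}
          = emeasure (replicate_pmf k p)
              {xs\<in>UNIV. 1 \<le> ennreal (2 / (e * real k)) * ennreal (sum_list (map W xs))}"
        by (simp only: key[OF W_nonneg] mem_Collect_eq UNIV_I simp_thms)
      also have "\<dots> \<le> ennreal (2 / (e * real k))
          * (\<integral>\<^sup>+xs. ennreal (sum_list (map W xs)) * indicator UNIV xs \<partial>replicate_pmf k p)"
        by (rule nn_integral_Markov_inequality) auto
      also have "(\<integral>\<^sup>+xs. ennreal (sum_list (map W xs)) * indicator UNIV xs \<partial>replicate_pmf k p)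
          = of_nat k * (\<integral>\<^sup>+x. ennreal (W x) \<partial>p)"
        by (simp add: W_sum nn_integral_replicate_pmf_sum)
      also have "(\<integral>\<^sup>+x. ennreal (W x) \<partial>p) = ennreal (measure_pmf.expectation p W)"
        using W by (intro nn_integral_eq_integral) auto
      also have "ennreal (2 / (e * real k)) * (of_nat k * ennreal (measure_pmf.expectation p W))
          = ennreal (2 / (e * real k) * (real k * measure_pmf.expectation p W))"
        unfolding ennreal_of_nat_eq_real_of_nat
        using ennreal_mult[of "2 / (e * real k)" "real k * measure_pmf.expectation p W"]
          ennreal_mult[of "real k" "measure_pmf.expectation p W"] e EW_nonneg by simp
      also have "\<dots> \<le> ennreal (d / 2)"
        using EW e elim(2) by (intro ennreal_leI) (simp add: field_simps)
      finally show ?thesis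
        using d by (simp add: P_def measure_pmf.emeasure_eq_measure)
    qed
    have dec: "sum_list (map X xs) = sum_list (map W xs) + (real C * real (length xs) - sum_list (map Z xs))"
      for xs
      by (induction xs) (auto simp: W_def Z_def algebra_simps)
    have "P k {xs. (m + e) * real k \<le> sum_list (map X xs)}
        \<le> P k ({xs. e / 2 * real k \<le> sum_list (map W xs)}
          \<union> {xs. sum_list (map Z xs) \<le> (measure_pmf.expectation p Z - e / 2) * real k})"
      unfolding P_def
    proof (rule measure_pmf.finite_measure_mono_AE)
      show "AE xs in replicate_pmf k p. xs \<in> {xs. (m + e) * real k \<le> sum_list (map X xs)} \<longrightarrow>
          xs \<in> {xs. e / 2 * real k \<le> sum_list (map W xs)}
          \<union> {xs. sum_list (map Z xs) \<le> (measure_pmf.expectation p Z - e / 2) * real k}"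
      proof (rule AE_pmfI, safe)
        fix xs assume xs: "xs \<in> set_pmf (replicate_pmf k p)"
          and a: "(m + e) * real k \<le> sum_list (map X xs)"
          and b: "\<not> sum_list (map Z xs) \<le> (measure_pmf.expectation p Z - e / 2) * real k"
        have "measure_pmf.expectation p (Y C) \<le> m"
          unfolding m_def by (intro integral_mono Y_int X) (auto simp: Y_def)
        then have "real C * real k - m * real k \<le> measure_pmf.expectation p Z * real k"
          unfolding EZ left_diff_distrib by (intro diff_left_mono mult_right_mono) auto
        moreover have "length xs = k"
          using xs by (simp add: set_replicate_pmf)
        ultimately show "e / 2 * real k \<le> sum_list (map W xs)"
          using a b dec[of xs] by (simp add: algebra_simps)
      qed
    qed auto
    also have "\<dots> \<le> P k {xs. e / 2 * real k \<le> sum_list (map W xs)}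
        + P k {xs. sum_list (map Z xs) \<le> (measure_pmf.expectation p Z - e / 2) * real k}"
      unfolding P_def by (rule measure_Un_le) auto
    finally show ?case using markov elim(1) by linarith
  qed
  then show "\<exists>k0. \<forall>k\<ge>k0. norm (measure_pmf.prob (replicate_pmf k p)
      {xs. (measure_pmf.expectation p X + e) * real k \<le> sum_list (map X xs)} - 0) < d"
    by (simp add: P_def m_def eventually_sequentially)
qed

text \<open>A Gaussian bound for a binomial count, stated with an explicit deviation \<open>t\<close> because it is used for
  deviations that grow only slightly faster than the square root of the number of samples.\<close>

lemma replicate_pmf_count_upper:
  assumes t: "0 \<le> t" "t \<le> 2 * real k"
  shows "measure_pmf.prob (replicate_pmf k p)
      {xs. measure_pmf.prob p A * real k + t \<le> (\<Sum>x\<leftarrow>xs. indicator A x)} \<le> exp (- t\<^sup>2 / (4 * real k))"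
proof (cases "k = 0")
  case False
  define s where "s = t / (2 * real k)"
  define P where "P = measure_pmf.prob p A"
  have P: "0 \<le> P" "P \<le> 1" by (auto simp: P_def)
  have s: "0 \<le> s" "s \<le> 1" using t False by (auto simp: s_def)
  have "exp s \<le> 1 + s + s\<^sup>2"
    using exp_bound[OF s] .
  then have "P * (exp s - 1) \<le> P * (s + s\<^sup>2)"
    using P by (intro mult_left_mono) auto
  also have "\<dots> \<le> P * s + s\<^sup>2"
    using P mult_right_mono[of P 1 "s\<^sup>2"] by (simp add: algebra_simps)
  finally have le: "1 + P * (exp s - 1) \<le> exp (P * s + s\<^sup>2)"
    using exp_ge_add_one_self[of "P * s + s\<^sup>2"] by linarith
  have "(\<integral>\<^sup>+x. ennreal (exp (s * indicator A x)) \<partial>p)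
      = (\<integral>\<^sup>+x. 1 + ennreal (exp s - 1) * indicator A x \<partial>p)"
    using s ennreal_plus[of 1 "exp s - 1"] by (intro nn_integral_cong) (auto simp: indicator_def)
  also have "\<dots> = ennreal (1 + P * (exp s - 1))"
    using s P by (simp add: nn_integral_add nn_integral_cmult measure_pmf.emeasure_eq_measure
        P_def[symmetric] ennreal_mult[symmetric] mult.commute[of P] ennreal_plus)
  also have "\<dots> \<le> ennreal (exp (P * s + s\<^sup>2))"
    by (rule ennreal_leI) (rule le)
  finally have mgf: "(\<integral>\<^sup>+x. ennreal (exp (s * indicator A x)) \<partial>p) \<le> ennreal (exp (P * s + s\<^sup>2))" .
  have mult: "(\<Sum>x\<leftarrow>xs. s * indicator A x) = s * (\<Sum>x\<leftarrow>xs. indicator A x)" for xs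
    by (induction xs) (auto simp: algebra_simps)
  have "emeasure (replicate_pmf k p) {xs. P * real k + t \<le> (\<Sum>x\<leftarrow>xs. indicator A x)}
      \<le> emeasure (replicate_pmf k p)
          {xs. s * (P * real k + t) \<le> sum_list (map (\<lambda>x. s * indicator A x) xs)}"
    using s unfolding mult by (intro emeasure_mono) (auto intro: mult_left_mono)
  also have "\<dots> \<le> ennreal (exp (- (s * (P * real k + t))))
      * (\<integral>\<^sup>+x. ennreal (exp (s * indicator A x)) \<partial>p) ^ k"
    by (rule replicate_pmf_Chernoff)
  also have "\<dots> \<le> ennreal (exp (- (s * (P * real k + t)))) * ennreal (exp (P * s + s\<^sup>2)) ^ k"
    by (intro mult_left_mono power_mono mgf) auto
  also have "\<dots> = ennreal (exp (- (s * (P * real k + t))) * exp (P * s + s\<^sup>2) ^ k)"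
    by (simp add: ennreal_mult ennreal_power)
  also have "exp (- (s * (P * real k + t))) * exp (P * s + s\<^sup>2) ^ k = exp (s\<^sup>2 * real k - s * t)"
    by (simp add: exp_of_nat_mult[symmetric] exp_add[symmetric] algebra_simps)
  also have "s\<^sup>2 * real k - s * t = - t\<^sup>2 / (4 * real k)"
    using False by (simp add: s_def field_simps power2_eq_square)
  finally show ?thesis
    by (simp add: P_def measure_pmf.emeasure_eq_measure)
qed auto

lemma integral_bind_pmf_bounded:
  fixes f :: "'b \<Rightarrow> real"
  assumes "\<And>x. \<bar>f x\<bar> \<le> B"
  shows "(\<integral>x. f x \<partial>bind_pmf M N) = (\<integral>x. \<integral>y. f y \<partial>N x \<partial>M)"
  unfolding measure_pmf_bind using assms
  by (intro integral_bind[where K = "count_space UNIV" and B' = 1 and B = B])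
    (auto simp: measure_pmf.finite_measure_axioms measurable_measure_pmf measure_pmf.emeasure_space_1
       measure_pmf_in_subprob_algebra)

text \<open>A bound of the modulus of the characteristic function away from one: the phase \<open>u\<close> is arbitrary, and
  the two neighbouring points \<open>j\<close> and \<open>Suc j\<close> cannot both be aligned with it.\<close>

lemma expectation_cos_bound:
  assumes t: "\<bar>t\<bar> \<le> pi" and m: "m \<le> pmf p j" "m \<le> pmf p (Suc j)" "0 \<le> m"
  shows "(\<integral>x. cos (t * real x - u) \<partial>measure_pmf p) \<le> 1 - 2 * m * (1 - cos (t / 2))"
proof -
  define a where "a = t * real j - u"
  have int: "integrable (measure_pmf p) (\<lambda>x. f x)" if "\<And>x. \<bar>f x\<bar> \<le> 2" for f :: "nat \<Rightarrow> real"
    using that by (intro measure_pmf.integrable_const_bound[where B = 2]) auto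
  have "cos a + cos (a + t) = 2 * cos (a + t / 2) * cos (t / 2)"
    using cos_plus_cos[of "a + t" a] by (simp add: add_divide_distrib add.commute)
  also have "\<dots> \<le> 2 * (1 * cos (t / 2))"
    using t unfolding mult.assoc
    by (intro mult_left_mono mult_right_mono cos_ge_zero) auto
  finally have "m * (2 * (1 - cos (t / 2))) \<le> m * ((1 - cos a) + (1 - cos (a + t)))"
    using m by (intro mult_left_mono) auto
  also have "\<dots> \<le> pmf p j * (1 - cos a) + pmf p (Suc j) * (1 - cos (a + t))"
    unfolding distrib_left using m by (intro add_mono mult_right_mono) auto
  also have "\<dots> = (\<Sum>x\<in>{j, Suc j}. (1 - cos (t * real x - u)) * pmf p x)"
    by (simp add: a_def algebra_simps)
  also have "\<dots> = (\<integral>x. (1 - cos (t * real x - u)) * indicator {j, Suc j} x \<partial>measure_pmf p)"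
    by (subst integral_measure_pmf_real[where A = "{j, Suc j}"]) (auto simp: indicator_def)
  also have "\<dots> \<le> (\<integral>x. 1 - cos (t * real x - u) \<partial>measure_pmf p)"
    by (intro integral_mono int) (auto simp: indicator_def abs_le_iff intro: order_trans[OF cos_ge_minus_one])
  also have "\<dots> = 1 - (\<integral>x. cos (t * real x - u) \<partial>measure_pmf p)"
    by (subst Bochner_Integration.integral_diff) (auto intro!: int order_trans[OF abs_cos_le_one])
  finally show ?thesis by (simp add: algebra_simps)
qed

text \<open>The characteristic function of a sum is a product. Quantifying over the phase \<open>u\<close> keeps the argument
  within real integrals.\<close>

lemma cos_replicate_bound:
  assumes t: "\<bar>t\<bar> \<le> pi" and m: "m \<le> pmf p j" "m \<le> pmf p (Suc j)" "0 \<le> m" "2 * m \<le> 1"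
  shows "(\<integral>xs. cos (t * real (sum_list xs) - u) \<partial>replicate_pmf k p)
    \<le> (1 - 2 * m * (1 - cos (t / 2))) ^ k"
proof (induction k arbitrary: u)
  case (Suc k)
  define S where "S xs = t * real (sum_list xs)" for xs :: "nat list"
  define A B where "A = (\<integral>xs. cos (S xs) \<partial>replicate_pmf k p)"
    and "B = (\<integral>xs. sin (S xs) \<partial>replicate_pmf k p)"
  obtain R v where R: "A = R * cos v" "B = R * sin v" "R \<ge> 0"
  proof
    have "Complex A B = rcis (cmod (Complex A B)) (Arg (Complex A B))"
      by (simp add: rcis_cmod_Arg)
    then show "A = cmod (Complex A B) * cos (Arg (Complex A B))"
      "B = cmod (Complex A B) * sin (Arg (Complex A B))"
      by (metis Re_rcis complex.sel(1)) (metis Im_rcis \<open>Complex A B = _\<close> complex.sel(2))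
  qed simp
  have int: "integrable (measure_pmf (replicate_pmf k p)) (\<lambda>x. cos (S x))"
    "integrable (measure_pmf (replicate_pmf k p)) (\<lambda>x. sin (S x))"
    by (auto intro!: measure_pmf.integrable_const_bound[where B = 1])
  have shift: "(\<integral>xs. cos (S xs - w) \<partial>replicate_pmf k p) = R * cos (v - w)" for w
  proof -
    have "(\<integral>xs. cos (S xs - w) \<partial>replicate_pmf k p) = A * cos w + B * sin w"
      using int by (simp add: cos_diff A_def B_def)
    then show ?thesis
      by (simp add: R cos_diff algebra_simps)
  qed
  have R_le: "R \<le> (1 - 2 * m * (1 - cos (t / 2))) ^ k"
    using Suc[of v] shift[of v] by (simp add: S_def)
  have "(\<integral>xs. cos (S xs - u) \<partial>replicate_pmf (Suc k) p)
      = (\<integral>x. \<integral>xs. cos (S (x # xs) - u) \<partial>replicate_pmf k p \<partial>p)"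
    by (simp add: integral_bind_pmf_bounded[where B = 1] abs_le_iff)
  also have "\<dots> = (\<integral>x. R * cos (t * real x - (u - v)) \<partial>p)"
  proof (intro Bochner_Integration.integral_cong refl)
    fix x
    have "(\<integral>xs. cos (S (x # xs) - u) \<partial>replicate_pmf k p) = R * cos (v - (u - t * real x))"
      unfolding shift[symmetric] by (simp add: S_def algebra_simps)
    then show "(\<integral>xs. cos (S (x # xs) - u) \<partial>replicate_pmf k p) = R * cos (t * real x - (u - v))"
      by (simp add: algebra_simps)
  qed
  also have "\<dots> \<le> R * (1 - 2 * m * (1 - cos (t / 2)))"
    using expectation_cos_bound[OF t m(1-3), of "u - v"] R(3) by (simp add: mult_left_mono)
  also have "\<dots> \<le> (1 - 2 * m * (1 - cos (t / 2))) ^ k * (1 - 2 * m * (1 - cos (t / 2)))"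
  proof (intro mult_right_mono R_le)
    have "2 * m * (1 - cos (t / 2)) \<le> 1 * 1"
      using m t by (intro mult_mono) (auto intro!: cos_ge_zero)
    then show "0 \<le> 1 - 2 * m * (1 - cos (t / 2))" by simp
  qed
  finally show ?case by (simp add: S_def mult.commute)
qed auto

section \<open>The scale of a local limit theorem\<close>

text \<open>A local limit theorem with a probability density as its limit implies tightness. The step functions
  \<open>H n\<close> converge pointwise to \<open>h\<close>, so Fatou's lemma bounds the probability of a window from below by an
  integral of \<open>h\<close>.\<close>

lemma tight_of_local_limit:
  fixes q :: "nat \<Rightarrow> int pmf" and a b :: "nat \<Rightarrow> real" and h :: "real \<Rightarrow> real"
  assumes h: "\<And>x. h x \<ge> 0" "continuous_on UNIV h" "(\<integral>\<^sup>+x. ennreal (h x) \<partial>lborel) = 1"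
    and a: "filterlim a at_top sequentially"
    and llt: "\<And>e. e > 0 \<Longrightarrow> \<forall>\<^sub>F n in sequentially. \<forall>l. \<bar>a n * pmf (q n) l - h ((real_of_int l - b n) / a n)\<bar> \<le> e"
    and e: "e > 0"
  shows "\<exists>K>0. \<forall>\<^sub>F n in sequentially. measure_pmf.prob (q n) {l. \<bar>real_of_int l - b n\<bar> \<le> K * a n} > 1 - e"
proof -
  have hm[measurable]: "h \<in> borel_measurable borel"
    using h(2) by (rule borel_measurable_continuous_onI)
  obtain K :: nat where K: "(\<integral>\<^sup>+x. ennreal (h x) * indicator {-real K..real K} x \<partial>lborel) > ennreal (1 - e)"
  proof -
    have "(\<lambda>K. \<integral>\<^sup>+x. ennreal (h x) * indicator {-real K..real K} x \<partial>lborel)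
        \<longlonglongrightarrow> (\<integral>\<^sup>+x. ennreal (h x) \<partial>lborel)"
    proof (rule nn_integral_dominated_convergence[where w = "\<lambda>x. ennreal (h x)"])
      show "AE x in lborel. (\<lambda>K. ennreal (h x) * indicator {-real K..real K} x) \<longlonglongrightarrow> ennreal (h x)"
      proof (rule AE_I2, rule tendsto_eventually)
        fix x :: real
        show "\<forall>\<^sub>F K in sequentially. ennreal (h x) * indicator {-real K..real K} x = ennreal (h x)"
          using eventually_ge_at_top[of "nat \<lceil>\<bar>x\<bar>\<rceil>"]
        proof eventually_elim
          case (elim K)
          then have "\<bar>x\<bar> \<le> real K" by linarith
          then show ?case by (simp add: indicator_def abs_le_iff)
        qed
      qed
    qed (auto simp: h indicator_def)
    moreover have "ennreal (1 - e) < (\<integral>\<^sup>+x. ennreal (h x) \<partial>lborel)"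
      using e ennreal_lessI[of 1 "1 - e"] by (simp add: h(3))
    ultimately have "\<forall>\<^sub>F K in sequentially.
        ennreal (1 - e) < (\<integral>\<^sup>+x. ennreal (h x) * indicator {-real K..real K} x \<partial>lborel)"
      by (rule order_tendstoD)
    then show ?thesis
      using that by (auto simp: eventually_sequentially)
  qed
  define l where "l n y = \<lfloor>b n + y * a n\<rfloor>" for n y
  define H where "H n y = ennreal (a n * pmf (q n) (l n y)) * indicator {-real K..real K} y" for n y
  have [measurable]: "H n \<in> borel_measurable borel" for n
    unfolding H_def l_def by measurable
  have H_lim: "(\<lambda>n. H n y) \<longlonglongrightarrow> ennreal (h y) * indicator {-real K..real K} y" for y
  proof -
    have inv: "(\<lambda>n. 1 / a n) \<longlonglongrightarrow> 0"
      using a by (rule tendsto_divide_0[OF tendsto_const filterlim_at_top_imp_at_infinity])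
    have "(\<lambda>n. (real_of_int (l n y) - b n) / a n) \<longlonglongrightarrow> y"
    proof (rule tendsto_sandwich)
      show "(\<lambda>n. y - 1 / a n) \<longlonglongrightarrow> y"
        using tendsto_diff[OF tendsto_const inv, of y] by simp
      have pos: "\<forall>\<^sub>F n in sequentially. a n > 0"
        using a by (simp add: filterlim_at_top_dense)
      show "\<forall>\<^sub>F n in sequentially. y - 1 / a n \<le> (real_of_int (l n y) - b n) / a n"
        using pos
      proof eventually_elim
        case (elim n)
        have "b n + y * a n - 1 \<le> real_of_int (l n y)"
          unfolding l_def by linarith
        then show ?case using elim by (simp add: pos_le_divide_eq pos_divide_le_eq left_diff_distrib)
      qed
      show "\<forall>\<^sub>F n in sequentially. (real_of_int (l n y) - b n) / a n \<le> y"
        using pos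
      proof eventually_elim
        case (elim n)
        have "real_of_int (l n y) \<le> b n + y * a n"
          unfolding l_def by linarith
        then show ?case using elim by (simp add: pos_le_divide_eq pos_divide_le_eq left_diff_distrib)
      qed
    qed (rule tendsto_const)
    then have h_lim: "(\<lambda>n. h ((real_of_int (l n y) - b n) / a n)) \<longlonglongrightarrow> h y"
      using h(2) by (intro isCont_tendsto_compose[where g = h]) (auto simp: continuous_on_eq_continuous_at)
    have "(\<lambda>n. a n * pmf (q n) (l n y) - h ((real_of_int (l n y) - b n) / a n)) \<longlonglongrightarrow> 0"
    proof (rule tendstoI)
      fix d :: real assume "d > 0"
      then have "\<forall>\<^sub>F n in sequentially. \<forall>l. \<bar>a n * pmf (q n) l - h ((real_of_int l - b n) / a n)\<bar> \<le> d / 2"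
        by (intro llt) simp
      then show "\<forall>\<^sub>F n in sequentially.
          dist (a n * pmf (q n) (l n y) - h ((real_of_int (l n y) - b n) / a n)) 0 < d"
      proof eventually_elim
        case (elim n)
        then have "\<bar>a n * pmf (q n) (l n y) - h ((real_of_int (l n y) - b n) / a n)\<bar> \<le> d / 2"
          by blast
        then show ?case using \<open>d > 0\<close> by (simp only: dist_real_def diff_0_right)
      qed
    qed
    from tendsto_add[OF this h_lim] have "(\<lambda>n. a n * pmf (q n) (l n y)) \<longlonglongrightarrow> h y"
      by simp
    then show ?thesis
      unfolding H_def by (cases "y \<in> {-real K..real K}") (auto simp: indicator_def intro: tendsto_ennrealI)
  qed
  have H_int: "(\<integral>\<^sup>+y. H n y \<partial>lborel) \<le> ennreal (measure_pmf.prob (q n) {l. \<bar>real_of_int l - b n\<bar> \<le> (real K + 1) * a n})"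
    if an: "a n \<ge> 1" for n
  proof -
    define I where "I = {\<lfloor>b n - real K * a n\<rfloor>..\<lfloor>b n + real K * a n\<rfloor>}"
    define J where "J i = {(real_of_int i - b n) / a n ..< (real_of_int i + 1 - b n) / a n}" for i :: int
    have J: "l n y = i \<longleftrightarrow> y \<in> J i" for y i
      using an unfolding l_def J_def by (auto simp: floor_eq_iff field_simps)
    have "(\<integral>\<^sup>+y. H n y \<partial>lborel) \<le> (\<integral>\<^sup>+y. (\<Sum>i\<in>I. ennreal (a n * pmf (q n) i) * indicator (J i) y) \<partial>lborel)"
    proof (rule nn_integral_mono)
      fix y
      show "H n y \<le> (\<Sum>i\<in>I. ennreal (a n * pmf (q n) i) * indicator (J i) y)"
      proof (cases "y \<in> {-real K..real K}")
        case True
        have "- real K * a n \<le> y * a n" "y * a n \<le> real K * a n"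
          using mult_right_mono[of "- real K" y "a n"] mult_right_mono[of y "real K" "a n"] True an
          by auto
        then have "l n y \<in> I"
          unfolding I_def l_def by (auto intro!: floor_mono)
        then have "ennreal (a n * pmf (q n) (l n y)) * indicator (J (l n y)) y
            \<le> (\<Sum>i\<in>I. ennreal (a n * pmf (q n) i) * indicator (J i) y)"
          by (intro member_le_sum) (auto simp: I_def)
        then show ?thesis
          using J[of y "l n y"] True by (simp add: H_def)
      qed (simp add: H_def)
    qed
    also have "\<dots> = (\<Sum>i\<in>I. ennreal (a n * pmf (q n) i) * emeasure lborel (J i))"
      by (subst nn_integral_sum) (auto simp: J_def nn_integral_cmult)
    also have "\<dots> = (\<Sum>i\<in>I. ennreal (pmf (q n) i))"
    proof (intro sum.cong refl)
      fix i
      have "emeasure lborel (J i) = ennreal (1 / a n)"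
        using an unfolding J_def by (subst emeasure_lborel_Ico) (auto simp: field_simps)
      then show "ennreal (a n * pmf (q n) i) * emeasure lborel (J i) = ennreal (pmf (q n) i)"
        using an by (simp add: ennreal_mult[symmetric])
    qed
    also have "\<dots> = ennreal (measure_pmf.prob (q n) I)"
      by (simp add: measure_measure_pmf_finite I_def)
    also have "\<dots> \<le> ennreal (measure_pmf.prob (q n) {l. \<bar>real_of_int l - b n\<bar> \<le> (real K + 1) * a n})"
    proof (intro ennreal_leI measure_pmf.finite_measure_mono subsetI, unfold mem_Collect_eq)
      fix i assume "i \<in> I"
      then have "real_of_int i \<le> b n + real K * a n" "b n - real K * a n - 1 \<le> real_of_int i"
        unfolding I_def by (auto simp: le_floor_iff floor_le_iff)
      then show "\<bar>real_of_int i - b n\<bar> \<le> (real K + 1) * a n"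
        using an by (simp add: algebra_simps abs_le_iff)
    qed auto
    finally show ?thesis .
  qed
  have "liminf (\<lambda>n. H n y) = ennreal (h y) * indicator {-real K..real K} y" for y
    using H_lim by (intro lim_imp_Liminf) auto
  then have "ennreal (1 - e) < (\<integral>\<^sup>+y. liminf (\<lambda>n. H n y) \<partial>lborel)"
    using K by simp
  also have "\<dots> \<le> liminf (\<lambda>n. \<integral>\<^sup>+y. H n y \<partial>lborel)"
    by (rule nn_integral_liminf) auto
  finally have "\<forall>\<^sub>F n in sequentially. ennreal (1 - e) < (\<integral>\<^sup>+y. H n y \<partial>lborel)"
    by (rule less_LiminfD)
  moreover have "\<forall>\<^sub>F n in sequentially. a n \<ge> 1"
    using a by (simp add: filterlim_at_top)
  ultimately have "\<forall>\<^sub>F n in sequentially.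
      measure_pmf.prob (q n) {l. \<bar>real_of_int l - b n\<bar> \<le> (real K + 1) * a n} > 1 - e"
  proof eventually_elim
    case (elim n)
    then have "ennreal (1 - e) < ennreal (measure_pmf.prob (q n) {l. \<bar>real_of_int l - b n\<bar> \<le> (real K + 1) * a n})"
      using H_int[of n] by (metis less_le_trans)
    then show ?case
      by (metis ennreal_leI not_le)
  qed
  then show ?thesis
    by (intro exI[of _ "real K + 1"]) auto
qed

text \<open>If the sums were concentrated on a scale of smaller order than the square root of \<open>n\<close>, then their
  characteristic function would be close to one in modulus at frequencies of order \<open>n\<^bsup>-1/2\<^esup>\<close>,
  contradicting its Gaussian decay.\<close>

lemma scale_ge_sqrt:
  fixes p :: "nat pmf" and a :: "nat \<Rightarrow> real" and c :: real
  assumes p: "pmf p j > 0" "pmf p (Suc j) > 0" and K: "K > 0"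
    and tight: "\<forall>\<^sub>F n in sequentially. measure_pmf.prob (replicate_pmf n p)
      {xs. \<bar>real (sum_list xs) - c * real n\<bar> \<le> K * a n} > 7 / 8"
  shows "\<exists>d>0. \<forall>\<^sub>F n in sequentially. d * sqrt (real n) \<le> a n"
proof -
  define m where "m = min (pmf p j) (pmf p (Suc j))"
  have "pmf p j + pmf p (Suc j) = measure_pmf.prob p {j, Suc j}"
    by (simp add: measure_measure_pmf_finite)
  then have "pmf p j + pmf p (Suc j) \<le> 1"
    by simp
  then have m: "m > 0" "m \<le> pmf p j" "m \<le> pmf p (Suc j)" "2 * m \<le> 1"
    using p by (auto simp: m_def)
  \<comment> \<open>With \<open>b\<close> this large the Gaussian decay is below \<open>1 / 4\<close>, and with \<open>d\<close> this small the phase is at most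
    \<open>1 / 2\<close> on the likely event, where the cosine then is at least \<open>7 / 8\<close>.\<close>
  define b where "b = sqrt (8 / m)"
  have b: "b > 0" "b\<^sup>2 = 8 / m"
    using m by (auto simp: b_def)
  define d where "d = 1 / (2 * b * K)"
  have d: "d > 0" using b K by (simp add: d_def)
  have "(\<lambda>n. exp (- (2 * m * (1 - cos (b / sqrt (real n) / 2)) * real n))) \<longlonglongrightarrow> exp (- (b * (b * m) / 4))"
    using b m by real_asymp
  moreover have "exp (- (b * (b * m) / 4)) < (1 / 4 :: real)"
  proof -
    have "(4::real) < exp 2"
      using exp_lower_Taylor_quadratic[of 2] by simp
    then have "exp (- 2) < (1 / 4 :: real)"
      by (simp add: exp_minus field_simps)
    moreover have "b * (b * m) = 8"
      using m b(2) by (simp add: power2_eq_square mult.assoc[symmetric])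
    ultimately show ?thesis by simp
  qed
  ultimately have "\<forall>\<^sub>F n in sequentially. exp (- (2 * m * (1 - cos (b / sqrt (real n) / 2)) * real n)) < 1 / 4"
    by (rule order_tendstoD)
  moreover have "\<forall>\<^sub>F n in sequentially. b / sqrt (real n) \<le> pi"
    using b by real_asymp
  ultimately have "\<forall>\<^sub>F n in sequentially. d * sqrt (real n) \<le> a n"
    using tight eventually_gt_at_top[of 0]
  proof eventually_elim
    case (elim n)
    define t where "t = b / sqrt (real n)"
    have t: "0 < t" "t \<le> pi" "t * sqrt (real n) = b"
      using b elim by (auto simp: t_def)
    define G where "G = {xs. \<bar>real (sum_list xs) - c * real n\<bar> \<le> K * a n}"
    show ?case
    proof (rule ccontr)
      assume "\<not> d * sqrt (real n) \<le> a n"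
      then have an: "a n < d * sqrt (real n)" by simp
      have G: "cos (t * real (sum_list xs) - t * (c * real n)) \<ge> 7 / 8 * indicator G xs - indicator (- G) xs" for xs
      proof (cases "xs \<in> G")
        case True
        have "\<bar>t * real (sum_list xs) - t * (c * real n)\<bar> = t * \<bar>real (sum_list xs) - c * real n\<bar>"
          using t by (simp add: abs_mult right_diff_distrib[symmetric])
        also have "\<dots> \<le> t * (K * (d * sqrt (real n)))"
          using True an K t unfolding G_def
          by (intro mult_left_mono) (auto intro: order_trans[OF _ mult_left_mono])
        also have "\<dots> = K * d * (t * sqrt (real n))"
          by simp
        also have "\<dots> = 1 / 2"
          using b K by (simp add: t d_def)
        finally have "(t * real (sum_list xs) - t * (c * real n))\<^sup>2 \<le> (1 / 2)\<^sup>2"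
          by (simp add: abs_le_square_iff[symmetric])
        then have sq: "(t * real (sum_list xs) - t * (c * real n))\<^sup>2 \<le> 1 / 4"
          by (simp only: power_one_over) simp
        have "1 - x\<^sup>2 / 2 \<le> cos x" for x :: real
        proof -
          have "\<bar>sin (x / 2)\<bar> \<le> \<bar>x / 2\<bar>"
            by (rule abs_sin_x_le_abs_x)
          then have "(sin (x / 2))\<^sup>2 \<le> (x / 2)\<^sup>2"
            by (simp only: abs_le_square_iff)
          then show ?thesis
            using cos_double_sin[of "x / 2"] by (simp add: power2_eq_square)
        qed
        from this[of "t * real (sum_list xs) - t * (c * real n)"] sq
        have "7 / 8 \<le> cos (t * real (sum_list xs) - t * (c * real n))"
          by linarith
        then show ?thesis
          using True by simp
      qed auto
      have int: "integrable (measure_pmf (replicate_pmf n p)) f" if "\<And>x. \<bar>f x\<bar> \<le> 2" for f :: "nat list \<Rightarrow> real"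
        using that by (intro measure_pmf.integrable_const_bound[where B = 2]) auto
      define P where "P = measure_pmf.prob (replicate_pmf n p) G"
      have intI: "integrable (measure_pmf (replicate_pmf n p)) (indicat_real A)" for A
        by (rule int) (auto simp: indicator_def)
      have compl: "measure_pmf.prob (replicate_pmf n p) (- G) = 1 - P"
        unfolding P_def using measure_pmf.prob_compl[of G "replicate_pmf n p"]
        by (simp add: Compl_eq_Diff_UNIV)
      have "7 / 8 * P - (1 - P) = (\<integral>xs. 7 / 8 * indicator G xs - indicator (- G) xs \<partial>replicate_pmf n p)"
        by (simp add: intI compl flip: P_def)
      also have "\<dots> \<le> (\<integral>xs. cos (t * real (sum_list xs) - t * (c * real n)) \<partial>replicate_pmf n p)"
        by (intro integral_mono int G) (auto simp: indicator_def intro: order_trans[OF abs_cos_le_one])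
      also have "\<dots> \<le> (1 - 2 * m * (1 - cos (t / 2))) ^ n"
        using t m by (intro cos_replicate_bound) auto
      also have "\<dots> \<le> exp (- (2 * m * (1 - cos (t / 2)))) ^ n"
      proof (rule power_mono)
        show "1 - 2 * m * (1 - cos (t / 2)) \<le> exp (- (2 * m * (1 - cos (t / 2))))"
          using exp_ge_add_one_self[of "- (2 * m * (1 - cos (t / 2)))"] by simp
        have "2 * m * (1 - cos (t / 2)) \<le> 1 * 1"
          using m t by (intro mult_mono) (auto intro!: cos_ge_zero)
        then show "0 \<le> 1 - 2 * m * (1 - cos (t / 2))" by simp
      qed
      also have "\<dots> = exp (- (2 * m * (1 - cos (b / sqrt (real n) / 2)) * real n))"
        by (simp add: exp_of_nat_mult[symmetric] t_def mult.commute)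
      also have "\<dots> < 1 / 4" by (rule elim)
      finally show False
        using elim(3) by (simp add: P_def G_def)
    qed
  qed
  with d show ?thesis by blast
qed

section \<open>Cutting and grafting plane trees\<close>

lemma vertices_iff [simp]: "v \<in> vertices T \<longleftrightarrow> is_vertex v T"
  by (simp add: vertices_def)

lemma outdegree_simps [simp]:
  "outdegree T [] = length (children T)" "outdegree T (i # v) = outdegree (children T ! i) v"
  by (simp_all add: outdegree_def)

lemma L_Node: "L \<Omega> (Node ts) = of_bool (length ts \<in> \<Omega>) + (\<Sum>t\<leftarrow>ts. L \<Omega> t)"
proof -
  define V where "V T = {v \<in> vertices T. outdegree T v \<in> \<Omega>}" for T
  have fin: "finite (V T)" for T
    by (rule finite_subset[OF _ finite_vertices[of T]]) (auto simp: V_def)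
  have "V (Node ts) = {v. v = [] \<and> length ts \<in> \<Omega>} \<union> (\<Union>i<length ts. (#) i ` V (ts ! i))"
  proof (rule set_eqI)
    fix v show "v \<in> V (Node ts)
        \<longleftrightarrow> v \<in> {v. v = [] \<and> length ts \<in> \<Omega>} \<union> (\<Union>i<length ts. (#) i ` V (ts ! i))"
      by (cases v) (auto simp: V_def)
  qed
  then have "card (V (Node ts)) = card {v :: nat list. v = [] \<and> length ts \<in> \<Omega>}
      + card (\<Union>i<length ts. (#) i ` V (ts ! i))"
    by (simp only:) (rule card_Un_disjoint, auto simp: fin)
  also have "card (\<Union>i<length ts. (#) i ` V (ts ! i)) = (\<Sum>i<length ts. card ((#) i ` V (ts ! i)))"
    by (rule card_UN_disjoint) (auto simp: fin)
  also have "\<dots> = (\<Sum>t\<leftarrow>ts. card (V t))"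
    by (simp add: card_image sum_list_sum_nth atLeast0LessThan)
  also have "card {v :: nat list. v = [] \<and> length ts \<in> \<Omega>} = of_bool (length ts \<in> \<Omega>)"
    by auto
  finally show ?thesis
    by (simp add: L_def V_def)
qed

text \<open>The possible values of \<open>F0\<close>.\<close>

definition marked_leaf :: "plane_tree \<Rightarrow> nat list \<Rightarrow> bool" where
  "marked_leaf S v \<longleftrightarrow> is_vertex v S \<and> fringe v S = Node []"

text \<open>Inverse to cutting: the vertex at the given address receives the trees \<open>us\<close> as children.\<close>

primrec graft :: "nat list \<Rightarrow> plane_tree list \<Rightarrow> plane_tree \<Rightarrow> plane_tree" where
  "graft [] us S = Node us"
| "graft (i # v) us S = Node ((children S)[i := graft v us (children S ! i)])"

lemma cut_below_graft: "marked_leaf S v \<Longrightarrow> cut_below v (graft v us S) = S"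
  by (induction v arbitrary: S) (auto simp: marked_leaf_def plane_tree.expand)

lemma fringe_graft: "is_vertex v S \<Longrightarrow> fringe v (graft v us S) = Node us"
  and is_vertex_graft: "is_vertex v S \<Longrightarrow> is_vertex v (graft v us S)"
  by (induction v arbitrary: S) auto

lemma graft_cut_below:
  "is_vertex v T \<Longrightarrow> graft v (children (fringe v T)) (cut_below v T) = T"
  by (induction v arbitrary: T) (auto simp: plane_tree.expand)

lemma marked_leaf_cut_below: "is_vertex v T \<Longrightarrow> marked_leaf (cut_below v T) v"
  by (induction v arbitrary: T) (auto simp: marked_leaf_def)

lemma F0_Fs_graft:
  assumes "F0 T = (S, v)"
  shows "marked_leaf S v" "T = graft v (Fs T) S"
proof -
  have v: "v = first_max_vertex T" and S: "S = cut_below v T"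
    using assms by (auto simp: F0_def)
  have "is_vertex v T"
    using first_max_vertex(1)[of T] v by simp
  then show "marked_leaf S v" "T = graft v (Fs T) S"
    by (simp_all add: S marked_leaf_cut_below Fs_def v[symmetric] graft_cut_below)
qed

text \<open>The marked leaf stops being a leaf, which explains the term for outdegree zero on the left.\<close>

lemma L_graft:
  "marked_leaf S v \<Longrightarrow> L \<Omega> (graft v us S) + of_bool (0 \<in> \<Omega>)
    = L \<Omega> S + of_bool (length us \<in> \<Omega>) + (\<Sum>u\<leftarrow>us. L \<Omega> u)"
proof (induction v arbitrary: S)
  case Nil
  then show ?case by (simp add: marked_leaf_def L_Node)
next
  case (Cons i v)
  obtain cs where S: "S = Node cs" by (cases S)
  have i: "i < length cs" and IH: "marked_leaf (cs ! i) v"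
    using Cons.prems by (auto simp: marked_leaf_def S)
  have "L \<Omega> S = of_bool (length cs \<in> \<Omega>) + (\<Sum>t\<leftarrow>take i cs @ cs ! i # drop (Suc i) cs. L \<Omega> t)"
    using id_take_nth_drop[OF i] by (simp add: S L_Node)
  moreover have "L \<Omega> (graft (i # v) us S) = of_bool (length cs \<in> \<Omega>)
      + (\<Sum>t\<leftarrow>take i cs @ graft v us (cs ! i) # drop (Suc i) cs. L \<Omega> t)"
    by (simp add: S L_Node upd_conv_take_nth_drop[OF i, symmetric] del: map_append sum_list_append)
  ultimately show ?case
    using Cons.IH[OF IH] by simp
qed

text \<open>That all outdegrees in \<open>S\<close> and \<open>us\<close> are below \<open>D\<close> is expressed by \<open>L {D..}\<close> being zero. By
  additivity of \<open>L\<close> the grafted tree then has exactly one vertex of outdegree at least \<open>D\<close>.\<close>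

lemma first_max_vertex_graft:
  assumes leaf: "marked_leaf S v" and S: "L {D..} S = 0" and us: "\<And>u. u \<in> set us \<Longrightarrow> L {D..} u = 0"
    and D: "0 < D" "D \<le> length us"
  shows "first_max_vertex (graft v us S) = v"
proof -
  let ?T = "graft v us S"
  let ?V = "{w \<in> vertices ?T. outdegree ?T w \<in> {D..}}"
  have "(\<Sum>u\<leftarrow>us. L {D..} u) = 0"
    using us by simp
  then have "L {D..} ?T = 1"
    using L_graft[OF leaf, of "{D..}" us] S D by simp
  then have "card ?V = 1"
    by (simp only: L_def)
  then obtain w where w: "?V = {w}"
    by (rule card_1_singletonE)
  have "v \<in> ?V"
    using leaf D by (simp add: marked_leaf_def is_vertex_graft outdegree_def fringe_graft)
  moreover have "first_max_vertex ?T \<in> ?V"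
  proof -
    have "outdegree ?T v \<le> max_outdegree ?T"
      unfolding max_outdegree_def using \<open>v \<in> ?V\<close> by (intro Max_ge) (auto simp: finite_vertices)
    then have "D \<le> outdegree ?T (first_max_vertex ?T)"
      using \<open>v \<in> ?V\<close> first_max_vertex(2)[of ?T] by simp
    then show ?thesis
      using first_max_vertex(1)[of ?T] by blast
  qed
  ultimately show ?thesis
    unfolding w by (simp only: singleton_iff)
qed

lemma F0_Fs_of_graft:
  assumes "marked_leaf S v" "L {D..} S = 0" "\<And>u. u \<in> set us \<Longrightarrow> L {D..} u = 0" "0 < D" "D \<le> length us"
  shows "F0 (graft v us S) = (S, v)" "Fs (graft v us S) = us"
  using first_max_vertex_graft[OF assms] assms(1)
  by (simp_all add: F0_def Fs_def cut_below_graft fringe_graft marked_leaf_def)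

lemma L_eq_0_of_max_outdegree: "max_outdegree T < D \<Longrightarrow> L {D..} T = 0"
proof -
  assume "max_outdegree T < D"
  moreover have "outdegree T v \<le> max_outdegree T" if "v \<in> vertices T" for v
    unfolding max_outdegree_def using that by (intro Max_ge) (auto simp: finite_vertices)
  ultimately have "{v \<in> vertices T. outdegree T v \<in> {D..}} = {}"
    by fastforce
  then show ?thesis
    by (simp only: L_def card.empty)
qed

section \<open>The laws of the unconditioned trees\<close>

lemma iid_spmf_of_pmf: "iid_spmf k (spmf_of_pmf p) = spmf_of_pmf (replicate_pmf k p)"
proof (induction k)
  case (Suc k)
  then have "iid_spmf (Suc k) (spmf_of_pmf p)
      = bind_pmf p (\<lambda>x. spmf_of_pmf (map_pmf ((#) x) (replicate_pmf k p)))"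
    by simp
  also have "\<dots> = spmf_of_pmf (bind_pmf p (\<lambda>x. map_pmf ((#) x) (replicate_pmf k p)))"
    by (rule spmf_of_pmf_bind[symmetric])
  also have "\<dots> = spmf_of_pmf (replicate_pmf (Suc k) p)"
    by (simp add: map_pmf_def)
  finally show ?case .
qed simp

lemma pmf_replicate_pmf:
  "pmf (replicate_pmf k p) xs = (if length xs = k then prod_list (map (pmf p) xs) else 0)"
proof (induction k arbitrary: xs)
  case (Suc k)
  have eq: "replicate_pmf (Suc k) p = map_pmf (\<lambda>(x, xs). x # xs) (pair_pmf p (replicate_pmf k p))"
    by (simp add: pair_pmf_def map_bind_pmf)
  show ?case
  proof (cases xs)
    case Nil
    then show ?thesis
      by (simp add: pmf_eq_0_set_pmf set_replicate_pmf del: replicate_pmf.simps)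
  next
    case (Cons y ys)
    have "pmf (replicate_pmf (Suc k) p) ((\<lambda>(x, xs). x # xs) (y, ys)) = pmf p y * pmf (replicate_pmf k p) ys"
      unfolding eq by (subst pmf_map_inj') (auto simp: inj_on_def pmf_pair)
    then show ?thesis using Cons Suc by simp
  qed
qed (simp add: indicator_def)

locale subcritical =
  fixes \<xi> :: "nat pmf"
  assumes int: "integrable (measure_pmf \<xi>) real" and sub: "mean \<xi> < 1" and p0: "pmf \<xi> 0 > 0"
begin

text \<open>In the subcritical case the tree is finite almost surely, so its law is a probability mass function.\<close>

definition gw :: "plane_tree pmf" where "gw = (SOME p. GW \<xi> = spmf_of_pmf p)"

lemma GW_eq: "GW \<xi> = spmf_of_pmf gw"
  unfolding gw_def
  using lossless_GW[OF int sub] unfolding lossless_spmf_conv_spmf_of_pmf by (rule someI_ex)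

lemma gw_unfold: "gw = bind_pmf \<xi> (\<lambda>k. map_pmf Node (replicate_pmf k gw))"
proof -
  have "spmf_of_pmf gw = bind_spmf (spmf_of_pmf \<xi>) (\<lambda>k. map_spmf Node (iid_spmf k (spmf_of_pmf gw)))"
    using GW.simps[of \<xi>] by (simp only: GW_eq)
  also have "\<dots> = spmf_of_pmf (bind_pmf \<xi> (\<lambda>k. map_pmf Node (replicate_pmf k gw)))"
    by (simp add: iid_spmf_of_pmf spmf_of_pmf_bind)
  finally have eq: "spmf_of_pmf gw = spmf_of_pmf (bind_pmf \<xi> (\<lambda>k. map_pmf Node (replicate_pmf k gw)))" .
  have "pmf gw T = pmf (bind_pmf \<xi> (\<lambda>k. map_pmf Node (replicate_pmf k gw))) T" for T
    using arg_cong[OF eq, of "\<lambda>p. spmf p T"] unfolding spmf_spmf_of_pmf .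
  then show ?thesis by (rule pmf_eqI)
qed

lemma nn_integral_gw: "(\<integral>\<^sup>+T. f T \<partial>gw) = (\<integral>\<^sup>+k. \<integral>\<^sup>+ts. f (Node ts) \<partial>replicate_pmf k gw \<partial>\<xi>)"
  by (subst gw_unfold) simp

text \<open>A finite tree has an explicit weight, because the recursion for its probability ends at the leaves.\<close>

lemma pmf_gw: "pmf gw (Node ts) = pmf \<xi> (length ts) * prod_list (map (pmf gw) ts)"
proof -
  have "pmf gw (Node ts) = (\<integral>k. pmf (map_pmf Node (replicate_pmf k gw)) (Node ts) \<partial>\<xi>)"
    by (subst gw_unfold) (rule pmf_bind)
  also have "\<dots> = (\<integral>k. indicator {length ts} k * prod_list (map (pmf gw) ts) \<partial>\<xi>)"
    by (intro Bochner_Integration.integral_cong refl, subst pmf_map_inj')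
      (auto simp: inj_on_def pmf_replicate_pmf)
  also have "\<dots> = (\<integral>k. indicator {length ts} k \<partial>\<xi>) * prod_list (map (pmf gw) ts)"
    by (rule integral_mult_left_zero)
  also have "(\<integral>k. indicat_real {length ts} k \<partial>\<xi>) = pmf \<xi> (length ts)"
    by (simp add: measure_pmf_single)
  finally show ?thesis .
qed

lemma pmf_gw_graft:
  "marked_leaf S v \<Longrightarrow> pmf gw (graft v us S) * pmf \<xi> 0
    = pmf gw S * (pmf \<xi> (length us) * prod_list (map (pmf gw) us))"
proof (induction v arbitrary: S)
  case Nil
  then show ?case by (simp add: marked_leaf_def pmf_gw)
next
  case (Cons i v)
  obtain cs where S: "S = Node cs" by (cases S)
  have i: "i < length cs" and IH: "marked_leaf (cs ! i) v"
    using Cons.prems by (auto simp: marked_leaf_def S)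
  have "pmf gw S = pmf \<xi> (length cs)
      * prod_list (map (pmf gw) (take i cs @ cs ! i # drop (Suc i) cs))"
    using id_take_nth_drop[OF i] by (simp add: S pmf_gw)
  moreover have "pmf gw (graft (i # v) us S) = pmf \<xi> (length cs)
      * prod_list (map (pmf gw) (take i cs @ graft v us (cs ! i) # drop (Suc i) cs))"
    by (simp add: S pmf_gw upd_conv_take_nth_drop[OF i, symmetric] del: map_append)
  ultimately show ?case
    using Cons.IH[OF IH] by (simp add: mult_ac)
qed

text \<open>A bound of an expectation may be proved by induction on the height: it suffices that the bound
  passes from the trees whose fringe subtrees at the children of the root lie in \<open>A\<close> to one generation
  more. The bound itself then shows that the expectation is finite.\<close>

lemma nn_integral_gw_le:
  assumes step: "\<And>A. (\<integral>\<^sup>+T. F T * indicator A T \<partial>gw) \<le> y \<Longrightarrow>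
    (\<integral>\<^sup>+T. F T * indicator (Node ` lists A) T \<partial>gw) \<le> y"
  shows "(\<integral>\<^sup>+T. F T \<partial>gw) \<le> y"
proof -
  define A where "A k = ((\<lambda>A. Node ` lists A) ^^ k) {}" for k
  have A_Suc: "A (Suc k) = Node ` lists (A k)" and A_0: "A 0 = {}" for k
    by (simp_all add: A_def)
  have A_mono: "A k \<subseteq> A (Suc k)" for k
    by (induction k) (auto simp: A_0, auto simp: A_Suc)
  then have inc: "incseq A" by (rule incseq_SucI)
  have mem: "\<exists>k. T \<in> A k" for T
  proof (induction T)
    case (Node ts)
    then obtain k where k: "\<And>t. t \<in> set ts \<Longrightarrow> t \<in> A (k t)" by metis
    have "t \<in> A (Max (k ` set ts))" if "t \<in> set ts" for t
      using incseqD[OF inc, of "k t" "Max (k ` set ts)"] k[OF that] that by auto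
    then have "Node ts \<in> A (Suc (Max (k ` set ts)))"
      by (auto simp: A_Suc)
    then show ?case by blast
  qed
  have le: "(\<integral>\<^sup>+T. F T * indicator (A k) T \<partial>gw) \<le> y" for k
    by (induction k) (auto simp: A_0, auto simp: A_Suc intro: step)
  have "(\<integral>\<^sup>+T. F T \<partial>gw) = (\<integral>\<^sup>+T. (SUP k. F T * indicator (A k) T) \<partial>gw)"
  proof (rule nn_integral_cong)
    fix T
    obtain k where k: "T \<in> A k" using mem by blast
    show "F T = (SUP k. F T * indicator (A k) T)"
    proof (rule antisym)
      show "F T \<le> (SUP k. F T * indicator (A k) T)"
        using k by (intro SUP_upper2[of k]) auto
      show "(SUP k. F T * indicator (A k) T) \<le> F T"
        by (intro SUP_least) (auto simp: indicator_def)
    qed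
  qed
  also have "\<dots> = (SUP k. \<integral>\<^sup>+T. F T * indicator (A k) T \<partial>gw)"
    using inc by (intro nn_integral_monotone_convergence_SUP)
      (auto simp: incseq_def le_fun_def indicator_def)
  also have "\<dots> \<le> y"
    by (intro SUP_least le)
  finally show ?thesis .
qed

lemma mean_nonneg: "0 \<le> mean \<xi>"
  by (intro integral_nonneg_AE) auto

lemma nn_integral_mean: "(\<integral>\<^sup>+k. of_nat k \<partial>\<xi>) = ennreal (mean \<xi>)"
proof -
  have "(\<integral>\<^sup>+k. of_nat k \<partial>\<xi>) = (\<integral>\<^sup>+k. ennreal (real k) \<partial>\<xi>)"
    by (intro nn_integral_cong ennreal_of_nat_eq_real_of_nat)
  also have "\<dots> = ennreal (mean \<xi>)"
    using int by (intro nn_integral_eq_integral) auto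
  finally show ?thesis .
qed

lemma ennreal_sum_list: "ennreal (real (\<Sum>t\<leftarrow>ts. f t)) = (\<Sum>t\<leftarrow>ts. ennreal (real (f t)))"
  by (induction ts) (auto simp: ennreal_plus)

text \<open>Splitting at the root gives \<open>E[L] = P(\<xi> \<in> \<Omega>) + E[\<xi>] E[L]\<close>. Finiteness comes first, by induction on the
  height.\<close>

lemma nn_integral_L:
  "(\<integral>\<^sup>+T. ennreal (real (L \<Omega> T)) \<partial>gw) = ennreal (measure_pmf.prob \<xi> \<Omega> / (1 - mean \<xi>))"
proof -
  define e where "e = measure_pmf.prob \<xi> \<Omega> / (1 - mean \<xi>)"
  have e: "0 \<le> e" using sub by (simp add: e_def)
  have step: "(\<integral>\<^sup>+k. (\<integral>\<^sup>+ts. of_bool (k \<in> \<Omega>) + (\<Sum>t\<leftarrow>ts. f t) \<partial>replicate_pmf k gw) \<partial>\<xi>)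
      = ennreal (measure_pmf.prob \<xi> \<Omega>) + ennreal (mean \<xi>) * (\<integral>\<^sup>+T. f T \<partial>gw)" for f :: "plane_tree \<Rightarrow> ennreal"
  proof -
    have "(\<integral>\<^sup>+k. (\<integral>\<^sup>+ts. of_bool (k \<in> \<Omega>) + (\<Sum>t\<leftarrow>ts. f t) \<partial>replicate_pmf k gw) \<partial>\<xi>)
        = (\<integral>\<^sup>+k. indicator \<Omega> k + of_nat k * (\<integral>\<^sup>+T. f T \<partial>gw) \<partial>\<xi>)"
      by (intro nn_integral_cong) (simp add: nn_integral_add nn_integral_replicate_pmf_sum indicator_def)
    also have "\<dots> = emeasure \<xi> \<Omega> + (\<integral>\<^sup>+k. of_nat k \<partial>\<xi>) * (\<integral>\<^sup>+T. f T \<partial>gw)"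
      by (simp add: nn_integral_add nn_integral_multc)
    finally show ?thesis
      by (simp add: nn_integral_mean measure_pmf.emeasure_eq_measure)
  qed
  have L_eq: "ennreal (real (L \<Omega> (Node ts))) = of_bool (length ts \<in> \<Omega>) + (\<Sum>t\<leftarrow>ts. ennreal (real (L \<Omega> t)))" for ts
    by (auto simp: L_Node ennreal_plus ennreal_sum_list[symmetric])
  have fin: "(\<integral>\<^sup>+T. ennreal (real (L \<Omega> T)) \<partial>gw) \<le> ennreal e"
  proof (rule nn_integral_gw_le)
    fix A assume A: "(\<integral>\<^sup>+T. ennreal (real (L \<Omega> T)) * indicator A T \<partial>gw) \<le> ennreal e"
    have ind: "(\<Sum>t\<leftarrow>ts. ennreal (real (L \<Omega> t))) * indicator (Node ` lists A) (Node ts)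
        \<le> (\<Sum>t\<leftarrow>ts. ennreal (real (L \<Omega> t)) * indicator A t)" for ts
    proof (cases "set ts \<subseteq> A")
      case True
      then have "(\<Sum>t\<leftarrow>ts. ennreal (real (L \<Omega> t)) * indicator A t) = (\<Sum>t\<leftarrow>ts. ennreal (real (L \<Omega> t)))"
        by (intro arg_cong[where f = sum_list] map_cong) auto
      then show ?thesis by (auto simp: indicator_def)
    qed (auto simp: indicator_def)
    have "(\<integral>\<^sup>+T. ennreal (real (L \<Omega> T)) * indicator (Node ` lists A) T \<partial>gw)
        \<le> (\<integral>\<^sup>+k. (\<integral>\<^sup>+ts. of_bool (k \<in> \<Omega>) + (\<Sum>t\<leftarrow>ts. ennreal (real (L \<Omega> t)) * indicator A t)
            \<partial>replicate_pmf k gw) \<partial>\<xi>)"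
      unfolding nn_integral_gw
    proof (rule nn_integral_mono, rule nn_integral_mono_AE, rule AE_pmfI)
      fix k ts assume "ts \<in> set_pmf (replicate_pmf k gw)"
      then have "length ts = k" by (simp add: set_replicate_pmf)
      then show "ennreal (real (L \<Omega> (Node ts))) * indicator (Node ` lists A) (Node ts)
          \<le> of_bool (k \<in> \<Omega>) + (\<Sum>t\<leftarrow>ts. ennreal (real (L \<Omega> t)) * indicator A t)"
        unfolding L_eq distrib_right
        by (intro add_mono ind) (auto simp: indicator_def)
    qed
    also have "\<dots> \<le> ennreal (measure_pmf.prob \<xi> \<Omega>) + ennreal (mean \<xi>) * ennreal e"
      unfolding step by (intro add_left_mono mult_left_mono A) auto
    also have "\<dots> = ennreal (measure_pmf.prob \<xi> \<Omega> + mean \<xi> * e)"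
      using e mean_nonneg by (simp add: ennreal_plus ennreal_mult)
    also have "measure_pmf.prob \<xi> \<Omega> + mean \<xi> * e = e"
      using sub by (simp add: e_def field_simps)
    finally show "(\<integral>\<^sup>+T. ennreal (real (L \<Omega> T)) * indicator (Node ` lists A) T \<partial>gw) \<le> ennreal e" .
  qed
  then obtain x where x: "0 \<le> x" "(\<integral>\<^sup>+T. ennreal (real (L \<Omega> T)) \<partial>gw) = ennreal x"
    by (metis ennreal_cases le_ennreal_iff top.extremum_unique ennreal_neq_top)
  have "(\<integral>\<^sup>+T. ennreal (real (L \<Omega> T)) \<partial>gw)
      = (\<integral>\<^sup>+k. (\<integral>\<^sup>+ts. of_bool (k \<in> \<Omega>) + (\<Sum>t\<leftarrow>ts. ennreal (real (L \<Omega> t))) \<partial>replicate_pmf k gw) \<partial>\<xi>)"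
    unfolding nn_integral_gw L_eq
    by (intro nn_integral_cong nn_integral_cong_AE AE_pmfI) (auto simp: set_replicate_pmf)
  then have "ennreal x = ennreal (measure_pmf.prob \<xi> \<Omega> + mean \<xi> * x)"
    unfolding step x(2) using x(1) mean_nonneg by (simp add: ennreal_plus ennreal_mult)
  then have "x = measure_pmf.prob \<xi> \<Omega> + mean \<xi> * x"
    using x(1) mean_nonneg by (subst (asm) ennreal_inj) auto
  then have "x = e"
    using sub by (simp add: e_def field_simps)
  then show ?thesis by (simp add: x e_def)
qed

lemma integrable_L: "integrable (measure_pmf gw) (\<lambda>T. real (L \<Omega> T))"
  and expectation_L: "measure_pmf.expectation gw (\<lambda>T. real (L \<Omega> T)) = measure_pmf.prob \<xi> \<Omega> / (1 - mean \<xi>)"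
proof -
  show *: "integrable (measure_pmf gw) (\<lambda>T. real (L \<Omega> T))"
    by (rule integrableI_nonneg) (auto simp: nn_integral_L)
  have "ennreal (measure_pmf.expectation gw (\<lambda>T. real (L \<Omega> T))) = ennreal (measure_pmf.prob \<xi> \<Omega> / (1 - mean \<xi>))"
    unfolding nn_integral_L[symmetric] using * by (intro nn_integral_eq_integral[symmetric]) auto
  then show "measure_pmf.expectation gw (\<lambda>T. real (L \<Omega> T)) = measure_pmf.prob \<xi> \<Omega> / (1 - mean \<xi>)"
    using sub by (subst (asm) ennreal_inj) (auto intro!: integral_nonneg_AE)
qed

text \<open>First moment bound for the existence of a vertex with outdegree in \<open>A\<close>.\<close>

lemma prob_L_pos_le: "measure_pmf.prob gw {T. L A T \<noteq> 0} \<le> measure_pmf.prob \<xi> A / (1 - mean \<xi>)"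
proof -
  have "measure_pmf.prob gw {T. L A T \<noteq> 0} = (\<integral>T. indicator {T. L A T \<noteq> 0} T \<partial>gw)"
    by simp
  also have "\<dots> \<le> (\<integral>T. real (L A T) \<partial>gw)"
    by (intro integral_mono integrable_L measure_pmf.integrable_const_bound[where B = 1])
      (auto simp: indicator_def)
  finally show ?thesis by (simp add: expectation_L)
qed

text \<open>Each vertex of the spine with \<open>k\<close> children contributes \<open>k P(\<xi> = k)\<close> from the size-biased law and \<open>1 / k\<close>
  from the choice of the special child. So the tree with a marked leaf has the weight of the unmarked
  tree, up to the factor \<open>1 - E[\<xi>]\<close> for stopping in place of \<open>P(\<xi> = 0)\<close> for the marked leaf.\<close>

lemma GW_bullet_density:
  "spmf (GW_bullet \<xi>) (S, v) = (if marked_leaf S v then (1 - mean \<xi>) * pmf gw S / pmf \<xi> 0 else 0)"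
proof (induction v arbitrary: S)
  define K where "K = (\<lambda>k i. bind_spmf (iid_spmf i (GW \<xi>)) (\<lambda>ls.
          bind_spmf (GW_bullet \<xi>) (\<lambda>(S, v).
          bind_spmf (iid_spmf (k - 1 - i) (GW \<xi>)) (\<lambda>rs.
          return_spmf (Node (ls @ S # rs), i # v)))))"
  define h where "h i = (\<lambda>(ls, (S, v), rs). (Node (ls @ S # rs), i # v :: nat list))" for i :: nat
  have K_eq: "K k i = map_spmf (h i) (pair_spmf (spmf_of_pmf (replicate_pmf i gw))
      (pair_spmf (GW_bullet \<xi>) (spmf_of_pmf (replicate_pmf (k - 1 - i) gw))))" for k i
    by (simp add: K_def h_def pair_spmf_alt_def map_spmf_conv_bind_spmf case_prod_unfold
      GW_eq iid_spmf_of_pmf del: bind_spmf_of_pmf)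
  have unfold: "spmf (GW_bullet \<xi>) x = (\<integral>k. spmf (if k = \<infinity> then return_spmf (Node [], [])
      else bind_spmf (spmf_of_set {..<the_enat k}) (K (the_enat k))) x \<partial>xi_hat \<xi>)" for x
    unfolding K_def by (subst GW_bullet.simps) (simp add: spmf_bind[of "spmf_of_pmf _"] del: bind_spmf_of_pmf)
  {
    case Nil
    have K0: "spmf (K k i) (S, []) = 0" for k i
      by (auto simp: spmf_eq_0_set_spmf K_eq h_def case_prod_unfold)
    have "spmf (GW_bullet \<xi>) (S, []) = (\<integral>k. indicator {\<infinity>} k * of_bool (S = Node []) \<partial>xi_hat \<xi>)"
      unfolding unfold
      by (intro Bochner_Integration.integral_cong refl) (auto simp: spmf_bind K0 indicator_def)
    also have "\<dots> = of_bool (S = Node []) * (1 - mean \<xi>)"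
      using pmf_xi_hat(2)[OF int] sub by (simp add: measure_pmf_single)
    finally show ?case
      using p0 pmf_gw[of "[]"] by (auto simp: marked_leaf_def)
  next
    case (Cons i v)
    obtain cs where S: "S = Node cs" by (cases S)
    have Kval: "spmf (K k j) (S, i # v) = (if j = i \<and> k = length cs then
        prod_list (map (pmf gw) (take i cs)) * (spmf (GW_bullet \<xi>) (cs ! i, v)
          * prod_list (map (pmf gw) (drop (Suc i) cs))) else 0)" if "j < k" for k j
    proof (cases "j = i \<and> k = length cs")
      case False
      have "(S, i # v) \<notin> set_spmf (K k j)"
      proof
        assume "(S, i # v) \<in> set_spmf (K k j)"
        then obtain ls S' rs where "length ls = j" "length rs = k - 1 - j" "cs = ls @ S' # rs" "j = i"
          by (auto simp: K_eq h_def S set_replicate_pmf)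
        with False that show False by simp
      qed
      then have "spmf (K k j) (S, i # v) = 0"
        by (simp add: spmf_eq_0_set_spmf)
      then show ?thesis
        using False by (simp only: if_False)
    next
      case True
      then have i: "i < length cs" using that by simp
      let ?M = "pair_spmf (spmf_of_pmf (replicate_pmf i gw))
        (pair_spmf (GW_bullet \<xi>) (spmf_of_pmf (replicate_pmf (k - 1 - i) gw)))"
      let ?x = "(take i cs, (cs ! i, v), drop (Suc i) cs)"
      have x: "h i ?x = (S, i # v)"
        using id_take_nth_drop[OF i] by (simp add: h_def S)
      have pre: "y = ?x" if "y \<in> set_spmf ?M" "h i y = (S, i # v)" for y
      proof -
        obtain ls S' v' rs where y: "y = (ls, (S', v'), rs)"
          by (metis surj_pair)
        have "length ls = i" "cs = ls @ S' # rs" "v' = v"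
          using that by (auto simp: y h_def S set_replicate_pmf)
        then show ?thesis by (auto simp: y)
      qed
      have "spmf (K k j) (S, i # v) = measure (measure_spmf ?M) (h i -` {(S, i # v)})"
        using True by (simp add: K_eq spmf_map)
      also have "\<dots> = measure (measure_spmf ?M) {?x}"
        by (rule measure_spmf.finite_measure_eq_AE) (use pre x in auto)
      also have "\<dots> = spmf ?M ?x"
        by (simp add: spmf_conv_measure_spmf)
      also have "\<dots> = prod_list (map (pmf gw) (take i cs)) * (spmf (GW_bullet \<xi>) (cs ! i, v)
          * prod_list (map (pmf gw) (drop (Suc i) cs)))"
        using True i by (simp add: pmf_replicate_pmf)
      finally show ?thesis using True by simp
    qed
    define c where "c = prod_list (map (pmf gw) (take i cs)) * (spmf (GW_bullet \<xi>) (cs ! i, v)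
          * prod_list (map (pmf gw) (drop (Suc i) cs)))"
    have "spmf (GW_bullet \<xi>) (S, i # v) = (\<integral>k. indicator {enat (length cs)} k
        * (of_bool (i < length cs) * c / real (length cs)) \<partial>xi_hat \<xi>)"
      unfolding unfold
    proof (intro Bochner_Integration.integral_cong refl)
      fix k
      show "spmf (if k = \<infinity> then return_spmf (Node [], [])
            else bind_spmf (spmf_of_set {..<the_enat k}) (K (the_enat k))) (S, i # v)
          = indicator {enat (length cs)} k * (of_bool (i < length cs) * c / real (length cs))"
      proof (cases k)
        case (enat n)
        have "spmf (bind_spmf (spmf_of_set {..<n}) (K n)) (S, i # v)
            = (\<integral>j. spmf (K n j) (S, i # v) \<partial>measure_spmf (spmf_of_set {..<n}))"
          by (rule spmf_bind)
        also have "\<dots> = (\<Sum>j<n. spmf (K n j) (S, i # v)) / real n"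
          by (cases "n = 0") (simp_all add: measure_spmf_spmf_of_set integral_pmf_of_set lessThan_empty_iff)
        also have "(\<Sum>j<n. spmf (K n j) (S, i # v)) = (\<Sum>j<n. if j = i then of_bool (n = length cs) * c else 0)"
          by (intro sum.cong refl) (simp add: Kval c_def)
        also have "\<dots> = of_bool (i < n) * (of_bool (n = length cs) * c)"
          by simp
        finally show ?thesis
          using enat by (auto simp: indicator_def)
      qed simp
    qed
    also have "\<dots> = real (length cs) * pmf \<xi> (length cs) * (of_bool (i < length cs) * c / real (length cs))"
      using pmf_xi_hat(1)[OF int, of "length cs"] sub by (simp add: measure_pmf_single)
    also have "\<dots> = of_bool (i < length cs) * (pmf \<xi> (length cs) * c)"
      by auto
    also have "\<dots> = (if marked_leaf S (i # v) then (1 - mean \<xi>) * pmf gw S / pmf \<xi> 0 else 0)"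
    proof (cases "i < length cs")
      case True
      have "pmf gw S = pmf \<xi> (length cs)
          * prod_list (map (pmf gw) (take i cs @ cs ! i # drop (Suc i) cs))"
        using id_take_nth_drop[OF True] by (simp add: S pmf_gw)
      then show ?thesis
        using True Cons.IH[of "cs ! i"] by (auto simp: marked_leaf_def S c_def mult_ac)
    qed (simp add: marked_leaf_def S)
    finally show ?case .
  }
qed

end

section \<open>Forests and random walks\<close>

context subcritical
begin

text \<open>Exploring the first vertex of a forest with \<open>N > 0\<close> trees turns it into a forest with
  \<open>N - 1 + \<xi>\<close> trees, where \<open>\<xi>\<close> is the outdegree of that vertex. If \<open>M\<close> outdegrees suffice to exhaust the
  forest, then the vertices counted by \<open>L \<Omega>\<close> are among the explored ones.\<close>

lemma walk_le_forest:
  "(\<integral>\<^sup>+xs. of_bool (N + sum_list xs \<le> M \<and> a + (\<Sum>x\<leftarrow>xs. of_bool (x \<in> \<Omega>)) \<le> b) \<partial>replicate_pmf M \<xi>)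
    \<le> (\<integral>\<^sup>+ts. of_bool (a + (\<Sum>t\<leftarrow>ts. L \<Omega> t) \<le> b) \<partial>replicate_pmf N gw)"
proof (induction M arbitrary: N a)
  case 0
  then show ?case by (cases "N = 0") auto
next
  case (Suc M)
  show ?case
  proof (cases N)
    case 0
    have "(\<integral>\<^sup>+xs. of_bool (N + sum_list xs \<le> Suc M \<and> a + (\<Sum>x\<leftarrow>xs. of_bool (x \<in> \<Omega>)) \<le> b)
        \<partial>replicate_pmf (Suc M) \<xi>) \<le> (\<integral>\<^sup>+xs. of_bool (a \<le> b) \<partial>replicate_pmf (Suc M) \<xi>)"
      by (intro nn_integral_mono) (auto simp: of_bool_def)
    also have "\<dots> = of_bool (a \<le> b)"
      by (simp add: measure_pmf.emeasure_space_1 del: replicate_pmf.simps)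
    finally show ?thesis using 0 by simp
  next
    case (Suc N')
    have "(\<integral>\<^sup>+xs. of_bool (N + sum_list xs \<le> Suc M \<and> a + (\<Sum>x\<leftarrow>xs. of_bool (x \<in> \<Omega>)) \<le> b)
        \<partial>replicate_pmf (Suc M) \<xi>)
      = (\<integral>\<^sup>+x. \<integral>\<^sup>+xs. of_bool (x + N' + sum_list xs \<le> M
          \<and> (a + of_bool (x \<in> \<Omega>)) + (\<Sum>x\<leftarrow>xs. of_bool (x \<in> \<Omega>)) \<le> b) \<partial>replicate_pmf M \<xi> \<partial>\<xi>)"
      by (simp add: Suc add_ac)
    also have "\<dots> \<le> (\<integral>\<^sup>+x. \<integral>\<^sup>+ts. of_bool (a + of_bool (x \<in> \<Omega>) + (\<Sum>t\<leftarrow>ts. L \<Omega> t) \<le> b)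
        \<partial>replicate_pmf (x + N') gw \<partial>\<xi>)"
      by (intro nn_integral_mono Suc.IH)
    also have "\<dots> = (\<integral>\<^sup>+x. \<integral>\<^sup>+us. \<integral>\<^sup>+ts. of_bool (a + L \<Omega> (Node us) + (\<Sum>t\<leftarrow>ts. L \<Omega> t) \<le> b)
        \<partial>replicate_pmf N' gw \<partial>replicate_pmf x gw \<partial>\<xi>)"
    proof (rule nn_integral_cong)
      fix x
      have "(\<integral>\<^sup>+ts. of_bool (a + of_bool (x \<in> \<Omega>) + (\<Sum>t\<leftarrow>ts. L \<Omega> t) \<le> b) \<partial>replicate_pmf (x + N') gw)
          = (\<integral>\<^sup>+us. \<integral>\<^sup>+ts. of_bool (a + of_bool (x \<in> \<Omega>) + ((\<Sum>t\<leftarrow>us. L \<Omega> t) + (\<Sum>t\<leftarrow>ts. L \<Omega> t)) \<le> b)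
              \<partial>replicate_pmf N' gw \<partial>replicate_pmf x gw)"
        by (simp add: replicate_pmf_distrib)
      also have "\<dots> = (\<integral>\<^sup>+us. \<integral>\<^sup>+ts. of_bool (a + L \<Omega> (Node us) + (\<Sum>t\<leftarrow>ts. L \<Omega> t) \<le> b)
          \<partial>replicate_pmf N' gw \<partial>replicate_pmf x gw)"
        by (intro nn_integral_cong_AE AE_pmfI) (simp add: set_replicate_pmf L_Node add_ac)
      finally show "(\<integral>\<^sup>+ts. of_bool (a + of_bool (x \<in> \<Omega>) + (\<Sum>t\<leftarrow>ts. L \<Omega> t) \<le> b) \<partial>replicate_pmf (x + N') gw)
          = (\<integral>\<^sup>+us. \<integral>\<^sup>+ts. of_bool (a + L \<Omega> (Node us) + (\<Sum>t\<leftarrow>ts. L \<Omega> t) \<le> b)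
              \<partial>replicate_pmf N' gw \<partial>replicate_pmf x gw)" .
    qed
    also have "\<dots> = (\<integral>\<^sup>+T. \<integral>\<^sup>+ts. of_bool (a + L \<Omega> T + (\<Sum>t\<leftarrow>ts. L \<Omega> t) \<le> b)
        \<partial>replicate_pmf N' gw \<partial>gw)"
      by (rule nn_integral_gw[symmetric])
    also have "\<dots> = (\<integral>\<^sup>+ts. of_bool (a + (\<Sum>t\<leftarrow>ts. L \<Omega> t) \<le> b) \<partial>replicate_pmf N gw)"
      by (simp add: Suc add_ac)
    finally show ?thesis .
  qed
qed

lemma prob_walk_le_forest:
  "measure_pmf.prob (replicate_pmf M \<xi>) {xs. N + sum_list xs \<le> M \<and> (\<Sum>x\<leftarrow>xs. of_bool (x \<in> \<Omega>)) \<le> b}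
    \<le> measure_pmf.prob (replicate_pmf N gw) {ts. (\<Sum>t\<leftarrow>ts. L \<Omega> t) \<le> b}"
proof -
  have ind: "(\<integral>\<^sup>+x. of_bool (P x) \<partial>measure_pmf p) = ennreal (measure_pmf.prob p {x. P x})"
    for P and p :: "'b pmf"
  proof -
    have "(\<integral>\<^sup>+x. of_bool (P x) \<partial>measure_pmf p) = (\<integral>\<^sup>+x. indicator {x. P x} x \<partial>measure_pmf p)"
      by (intro nn_integral_cong) (auto simp: indicator_def)
    then show ?thesis
      by (simp add: measure_pmf.emeasure_eq_measure)
  qed
  have "ennreal (measure_pmf.prob (replicate_pmf M \<xi>)
        {xs. N + sum_list xs \<le> M \<and> 0 + (\<Sum>x\<leftarrow>xs. of_bool (x \<in> \<Omega>)) \<le> b})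
      \<le> ennreal (measure_pmf.prob (replicate_pmf N gw) {ts. 0 + (\<Sum>t\<leftarrow>ts. L \<Omega> t) \<le> b})"
    unfolding ind[symmetric] by (rule walk_le_forest)
  then show ?thesis by simp
qed

end

section \<open>Regular variation of the offspring law\<close>

lemma integrable_pmf_nat:
  fixes p :: "nat pmf" and f :: "nat \<Rightarrow> real"
  assumes "\<And>k. f k \<ge> 0" "summable (\<lambda>k. pmf p k * f k)"
  shows "integrable (measure_pmf p) f"
proof (rule integrableI_nonneg)
  have "(\<integral>\<^sup>+k. ennreal (f k) \<partial>p) = (\<Sum>k. ennreal (pmf p k * f k))"
    using assms(1) by (simp add: nn_integral_measure_pmf nn_integral_count_space_nat ennreal_mult)
  also have "\<dots> = ennreal (\<Sum>k. pmf p k * f k)"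
    using assms by (intro suminf_ennreal2) auto
  finally show "(\<integral>\<^sup>+k. ennreal (f k) \<partial>p) < \<infinity>" by simp
qed (use assms in auto)

lemma nn_integral_pmf_nat_le:
  fixes p :: "nat pmf" and f :: "nat \<Rightarrow> real"
  assumes "\<And>k. f k \<ge> 0" "\<And>K. (\<Sum>k<K. pmf p k * f k) \<le> B"
  shows "(\<integral>\<^sup>+k. ennreal (f k) \<partial>p) \<le> ennreal B"
proof -
  have "(\<integral>\<^sup>+k. ennreal (f k) \<partial>p) = (\<Sum>k. ennreal (pmf p k * f k))"
    using assms(1) by (simp add: nn_integral_measure_pmf nn_integral_count_space_nat ennreal_mult)
  also have "\<dots> \<le> ennreal B"
    unfolding suminf_eq_SUP
    by (intro SUP_least) (simp add: sum_nonneg assms ennreal_leI)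
  finally show ?thesis .
qed

locale heavy_tailed = subcritical \<xi> for \<xi> +
  fixes f :: "real \<Rightarrow> real" and \<alpha> :: real and \<Omega> :: "nat set"
  assumes f: "slowly_varying f" and alpha: "\<alpha> > 1"
    and tail: "\<forall>\<^sub>F n in sequentially. pmf \<xi> n = f (real n) * real n powr (- 1 - \<alpha>)"
    and Omega_pos: "measure_pmf.prob \<xi> \<Omega> > 0" and Omega_fin: "finite \<Omega> \<or> finite (- \<Omega>)"
begin

text \<open>The outdegree of the vertex of maximal outdegree in a tree with \<open>L \<Omega> T = n\<close> is about \<open>c n\<close>.\<close>

definition c :: real where "c = (1 - mean \<xi>) / measure_pmf.prob \<xi> \<Omega>"

text \<open>The value of the regularly varying function in the tail of \<open>\<xi>\<close> at \<open>c n\<close>, except that the slowly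
  varying factor is taken at \<open>n\<close>, which makes no difference asymptotically.\<close>

definition jump :: "nat \<Rightarrow> real" where "jump n = f (real n) * (c * real n) powr (- 1 - \<alpha>)"

lemma c_pos: "c > 0"
  using sub Omega_pos by (simp add: c_def)

lemma f_pos: "\<forall>\<^sub>F n in sequentially. f (real n) > 0"
  by (rule eventually_compose_filterlim[OF slowly_varying_pos[OF f] filterlim_real_sequentially])

lemma jump_pos: "\<forall>\<^sub>F n in sequentially. jump n > 0"
  using f_pos eventually_gt_at_top[of 0] by eventually_elim (use c_pos in \<open>simp add: jump_def\<close>)

lemma pmf_pos: "\<forall>\<^sub>F n in sequentially. pmf \<xi> n > 0"
  using f_pos tail eventually_gt_at_top[of 0] by eventually_elim simp

lemma eventually_all_ge_scaled:
  assumes P: "\<forall>\<^sub>F n in sequentially. P n" and d: "d > 0"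
  shows "\<forall>\<^sub>F n in sequentially. \<forall>k. d * real n \<le> real k \<longrightarrow> P k"
proof -
  obtain N where N: "\<And>k. k \<ge> N \<Longrightarrow> P k"
    using P by (auto simp: eventually_sequentially)
  have "\<forall>\<^sub>F n in sequentially. d * real n \<ge> real N"
    using d by real_asymp
  then show ?thesis
    by eventually_elim (use N in \<open>auto intro: order_trans\<close>)
qed

text \<open>Both sides of the comparison are evaluated in logarithms, where slow variation is an additive error
  and the power is explicit.\<close>

lemma ln_pmf_jump:
  assumes e: "e > 0" and b: "0 < b"
  shows "\<forall>\<^sub>F n in sequentially. \<forall>d. b * real n \<le> real d \<and> real d \<le> B * real n \<longrightarrow>
    0 < pmf \<xi> d \<and> \<bar>ln (pmf \<xi> d) - ln (jump n) + (1 + \<alpha>) * ln (real d / (c * real n))\<bar> \<le> e"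
proof -
  have "\<forall>\<^sub>F n in sequentially. \<forall>u\<in>{b..B}. \<bar>ln (f (u * real n)) - ln (f (real n))\<bar> \<le> e"
    by (rule eventually_compose_filterlim[OF slowly_varying_uniform_compact[OF f e b] filterlim_real_sequentially])
  moreover note f_pos eventually_gt_at_top[of 0] eventually_all_ge_scaled[OF f_pos b] eventually_all_ge_scaled[OF tail b]
  ultimately show ?thesis
  proof eventually_elim
    case (elim n)
    show ?case
    proof (intro allI impI conjI)
      fix d assume d: "b * real n \<le> real d \<and> real d \<le> B * real n"
      have n: "0 < real n" using elim by simp
      then have "0 < b * real n" using b by simp
      then have dpos: "0 < real d" using d by linarith
      have fd: "f (real d) > 0" and pd: "pmf \<xi> d = f (real d) * real d powr (- 1 - \<alpha>)"
        using elim d by auto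
      show "0 < pmf \<xi> d" using fd pd dpos by simp
      have "\<bar>ln (f (real d / real n * real n)) - ln (f (real n))\<bar> \<le> e"
        using d n by (intro bspec[OF elim(1)]) (auto simp: field_simps)
      then have "\<bar>ln (f (real d)) - ln (f (real n))\<bar> \<le> e"
        using n by simp
      moreover have "ln (pmf \<xi> d) = ln (f (real d)) - (1 + \<alpha>) * ln (real d)"
        using fd dpos by (simp add: pd ln_mult ln_powr algebra_simps)
      moreover have "ln (jump n) = ln (f (real n)) - (1 + \<alpha>) * ln (c * real n)"
        using elim n c_pos by (simp add: jump_def ln_mult ln_powr algebra_simps)
      ultimately show "\<bar>ln (pmf \<xi> d) - ln (jump n) + (1 + \<alpha>) * ln (real d / (c * real n))\<bar> \<le> e"
        using dpos n c_pos by (simp add: ln_div algebra_simps)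
    qed
  qed
qed

lemma pmf_near_jump:
  assumes e: "e > 0"
  shows "\<exists>\<delta>>0. \<delta> < c \<and> (\<forall>\<^sub>F n in sequentially. \<forall>d. \<bar>real d - c * real n\<bar> \<le> \<delta> * real n \<longrightarrow>
    (1 - e) * jump n \<le> pmf \<xi> d \<and> pmf \<xi> d \<le> (1 + e) * jump n)"
proof -
  define e' where "e' = ln (1 + e) / 2"
  have e': "e' > 0" using e by (simp add: e'_def)
  have "isCont (\<lambda>x. (1 + \<alpha>) * ln (x / c)) c"
    using c_pos by (intro continuous_intros) auto
  then obtain \<delta>0 where \<delta>0: "\<delta>0 > 0" "\<And>x. \<bar>x - c\<bar> < \<delta>0 \<Longrightarrow> \<bar>(1 + \<alpha>) * ln (x / c)\<bar> < e'"
    using e' c_pos unfolding continuous_at_eps_delta by (force simp: dist_real_def)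
  define \<delta> where "\<delta> = min \<delta>0 c / 2"
  have \<delta>: "0 < \<delta>" "\<delta> < \<delta>0" "\<delta> < c" using \<delta>0(1) c_pos by (auto simp: \<delta>_def)
  then have c_minus: "0 < c - \<delta>" by simp
  have "\<forall>\<^sub>F n in sequentially. \<forall>d. \<bar>real d - c * real n\<bar> \<le> \<delta> * real n \<longrightarrow>
    (1 - e) * jump n \<le> pmf \<xi> d \<and> pmf \<xi> d \<le> (1 + e) * jump n"
    using ln_pmf_jump[OF e' c_minus, of "c + \<delta>"] jump_pos eventually_gt_at_top[of 0]
  proof eventually_elim
    case (elim n)
    show ?case
    proof (intro allI impI)
      fix d assume d: "\<bar>real d - c * real n\<bar> \<le> \<delta> * real n"
      have n: "0 < real n" using elim by simp
      have "(c - \<delta>) * real n \<le> real d \<and> real d \<le> (c + \<delta>) * real n"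
        using d by (simp add: abs_le_iff algebra_simps)
      then have pd: "0 < pmf \<xi> d"
        and ln: "\<bar>ln (pmf \<xi> d) - ln (jump n) + (1 + \<alpha>) * ln (real d / (c * real n))\<bar> \<le> e'"
        using elim by auto
      have "\<bar>real d / real n - c\<bar> = \<bar>real d - c * real n\<bar> / real n"
        using n by (simp add: field_simps abs_divide[symmetric])
      also have "\<dots> \<le> \<delta>" using d n by (simp add: field_simps)
      finally have "\<bar>(1 + \<alpha>) * ln (real d / real n / c)\<bar> < e'"
        using \<delta>(2) by (intro \<delta>0(2)) simp
      moreover have "real d / real n / c = real d / (c * real n)"
        by (simp add: mult.commute)
      ultimately have "\<bar>ln (pmf \<xi> d) - ln (jump n)\<bar> \<le> 2 * e'"
        using ln by (simp only: abs_le_iff abs_less_iff) linarith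
      also have "2 * e' = ln (1 + e)"
        by (simp add: e'_def)
      finally have "\<bar>ln (pmf \<xi> d) - ln (jump n)\<bar> \<le> ln (1 + e)" .
      then have le: "ln (pmf \<xi> d) \<le> ln ((1 + e) * jump n)" "ln (jump n) \<le> ln ((1 + e) * pmf \<xi> d)"
        using e elim pd by (auto simp: ln_mult)
      from le have "pmf \<xi> d \<le> (1 + e) * jump n" "jump n \<le> (1 + e) * pmf \<xi> d"
        using e elim pd by (auto simp: ln_le_cancel_iff)
      moreover have "(1 - e) * jump n \<le> pmf \<xi> d"
      proof (cases "e \<le> 1")
        case True
        have "(1 - e) * jump n \<le> (1 - e) * ((1 + e) * pmf \<xi> d)"
          using True \<open>jump n \<le> _\<close> by (intro mult_left_mono) auto
        also have "\<dots> = pmf \<xi> d - e\<^sup>2 * pmf \<xi> d"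
          by (simp add: algebra_simps power2_eq_square)
        finally show ?thesis
          using mult_nonneg_nonneg[OF zero_le_power2 less_imp_le[OF pd], of e] by linarith
      next
        case False
        then have "(1 - e) * jump n \<le> 0"
          using elim by (intro mult_nonpos_nonneg) auto
        then show ?thesis using pd by linarith
      qed
      ultimately show "(1 - e) * jump n \<le> pmf \<xi> d \<and> pmf \<xi> d \<le> (1 + e) * jump n"
        by simp
    qed
  qed
  then show ?thesis using \<delta> by blast
qed

lemma pmf_le_jump:
  assumes d: "\<delta> > 0"
  shows "\<exists>C>0. \<forall>\<^sub>F n in sequentially. \<forall>d. \<delta> * real n \<le> real d \<longrightarrow> pmf \<xi> d \<le> C * jump n"
proof -
  define b where "b = min \<delta> 1"
  have b: "0 < b" "b \<le> \<delta>" "b \<le> 1" using d by (auto simp: b_def)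
  have "\<forall>\<^sub>F x in at_top. \<forall>y\<ge>x. \<bar>ln (f y) - ln (f x)\<bar> \<le> 1 * (ln (y / x) + 1)"
    by (rule slowly_varying_Potter[OF f]) simp
  moreover have "filterlim (\<lambda>n. b * real n) at_top sequentially"
    using b by real_asymp
  ultimately have "\<forall>\<^sub>F n in sequentially. \<forall>y\<ge>b * real n. \<bar>ln (f y) - ln (f (b * real n))\<bar> \<le> 1 * (ln (y / (b * real n)) + 1)"
    by (rule eventually_compose_filterlim)
  moreover have "\<forall>\<^sub>F n in sequentially. \<forall>u\<in>{b..1}. \<bar>ln (f (u * real n)) - ln (f (real n))\<bar> \<le> 1"
    by (rule eventually_compose_filterlim[OF slowly_varying_uniform_compact[OF f _ b(1)] filterlim_real_sequentially]) simp
  ultimately have "\<forall>\<^sub>F n in sequentially. \<forall>d. \<delta> * real n \<le> real d \<longrightarrow> pmf \<xi> d \<le> exp (2 - (1 + \<alpha>) * ln (b / c)) * jump n"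
    using f_pos eventually_gt_at_top[of 0] eventually_all_ge_scaled[OF f_pos d] eventually_all_ge_scaled[OF tail d]
  proof eventually_elim
    case (elim n)
    show ?case
    proof (intro allI impI)
      fix d assume d': "\<delta> * real n \<le> real d"
      have n: "0 < real n" using elim by simp
      have bn: "0 < b * real n" "b * real n \<le> real d"
        using b n by (auto intro!: mult_right_mono order_trans[OF _ d'])
      then have dpos: "0 < real d" by linarith
      have fd: "f (real d) > 0" and pd: "pmf \<xi> d = f (real d) * real d powr (- 1 - \<alpha>)"
        using elim d' by auto
      have "\<bar>ln (f (real d)) - ln (f (b * real n))\<bar> \<le> ln (real d / (b * real n)) + 1"
        using elim(1) bn by auto
      moreover have "\<bar>ln (f (b * real n)) - ln (f (real n))\<bar> \<le> 1"
        using elim(2) b by auto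
      moreover have "ln (real d / (b * real n)) = ln (real d) - ln (b * real n)"
        using b n dpos by (simp add: ln_div)
      moreover have "\<alpha> * ln (b * real n) \<le> \<alpha> * ln (real d)"
        using alpha bn by (intro mult_left_mono) auto
      moreover have bc: "ln (b * real n) = ln (b / c) + ln (c * real n)"
        using b n c_pos by (simp add: ln_mult ln_div)
      moreover have "\<alpha> * ln (b * real n) = \<alpha> * ln (b / c) + \<alpha> * ln (c * real n)"
        unfolding bc by (rule distrib_left)
      moreover have "ln (pmf \<xi> d) = ln (f (real d)) - (1 + \<alpha>) * ln (real d)"
        using fd dpos by (simp add: pd ln_mult ln_powr algebra_simps)
      moreover have "ln (jump n) = ln (f (real n)) - (1 + \<alpha>) * ln (c * real n)"
        using elim n c_pos by (simp add: jump_def ln_mult ln_powr algebra_simps)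
      ultimately have "ln (pmf \<xi> d) \<le> 2 - (1 + \<alpha>) * ln (b / c) + ln (jump n)"
        by (simp only: abs_le_iff distrib_right mult_1_left) linarith
      then have "exp (ln (pmf \<xi> d)) \<le> exp (2 - (1 + \<alpha>) * ln (b / c)) * exp (ln (jump n))"
        by (simp add: exp_add[symmetric])
      then show "pmf \<xi> d \<le> exp (2 - (1 + \<alpha>) * ln (b / c)) * jump n"
        using fd dpos elim n c_pos by (simp add: pd jump_def)
    qed
  qed
  then show ?thesis by (intro exI[of _ "exp (2 - (1 + \<alpha>) * ln (b / c))"]) auto
qed

lemma powr_le_jump:
  assumes e: "e > 0"
  shows "\<forall>\<^sub>F n in sequentially. real n powr (- (3 + \<alpha>)) \<le> e * jump n"
proof -
  have "\<forall>\<^sub>F n in sequentially. real n powr (- 1) \<le> f (real n) \<and> f (real n) \<le> real n powr 1"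
    by (rule eventually_compose_filterlim[OF slowly_varying_powr_bounds[OF f] filterlim_real_sequentially]) simp
  moreover have "\<forall>\<^sub>F n in sequentially. real n powr (- (3 + \<alpha>)) \<le> e * c powr (- 1 - \<alpha>) * real n powr (- (2 + \<alpha>))"
  proof -
    have "\<forall>\<^sub>F n in sequentially. 1 / (e * c powr (- 1 - \<alpha>)) \<le> real n"
      by real_asymp
    then show ?thesis
      using eventually_gt_at_top[of 0]
    proof eventually_elim
      case (elim n)
      have pos: "0 < e * c powr (- 1 - \<alpha>)"
        using e c_pos by simp
      have "1 \<le> e * c powr (- 1 - \<alpha>) * real n"
        using elim(1) pos by (simp add: pos_divide_le_eq mult.commute)
      then have "real n powr (- (3 + \<alpha>)) * 1 \<le> real n powr (- (3 + \<alpha>)) * (e * c powr (- 1 - \<alpha>) * real n)"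
        by (intro mult_left_mono) auto
      also have "\<dots> = e * c powr (- 1 - \<alpha>) * (real n powr (- (3 + \<alpha>)) * real n powr 1)"
        using elim by simp
      also have "real n powr (- (3 + \<alpha>)) * real n powr 1 = real n powr (- (2 + \<alpha>))"
        by (subst powr_add[symmetric]) simp
      finally show ?case by simp
    qed
  qed
  ultimately show ?thesis
    using eventually_gt_at_top[of 0]
  proof eventually_elim
    case (elim n)
    have "real n powr (- (2 + \<alpha>)) = real n powr (- 1) * real n powr (- 1 - \<alpha>)"
      by (subst powr_add[symmetric]) simp
    then have "e * c powr (- 1 - \<alpha>) * real n powr (- (2 + \<alpha>))
        = e * c powr (- 1 - \<alpha>) * (real n powr (- 1) * real n powr (- 1 - \<alpha>))"
      by (simp only:)
    also have "\<dots> \<le> e * c powr (- 1 - \<alpha>) * (f (real n) * real n powr (- 1 - \<alpha>))"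
      using elim e by (intro mult_left_mono mult_right_mono) auto
    also have "\<dots> = e * jump n"
      using c_pos by (simp add: jump_def powr_mult)
    finally show ?case using elim(2) by linarith
  qed
qed

text \<open>The tail index \<open>\<alpha>\<close> exceeds one, and by Potter's bound the slowly varying factor is smaller than any power.\<close>

lemma moment_above_one: "\<exists>\<eta>>0. \<eta> \<le> 1 \<and> integrable (measure_pmf \<xi>) (\<lambda>k. real k powr (1 + \<eta>))"
proof -
  define \<eta> where "\<eta> = min 1 ((\<alpha> - 1) / 3)"
  have eta: "\<eta> > 0" "\<eta> \<le> 1" "2 * \<eta> - \<alpha> < - 1"
    using alpha by (auto simp: \<eta>_def min_def field_simps)
  have "summable (\<lambda>k. pmf \<xi> k * real k powr (1 + \<eta>))"
  proof (rule summable_comparison_test_ev)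
    show "summable (\<lambda>k. real k powr (2 * \<eta> - \<alpha>))"
      using eta by (simp add: summable_real_powr_iff)
    have "\<forall>\<^sub>F n in sequentially. real n powr (- \<eta>) \<le> f (real n) \<and> f (real n) \<le> real n powr \<eta>"
      by (rule eventually_compose_filterlim[OF slowly_varying_powr_bounds[OF f] filterlim_real_sequentially])
        (use eta in simp)
    then show "\<forall>\<^sub>F k in sequentially. norm (pmf \<xi> k * real k powr (1 + \<eta>)) \<le> real k powr (2 * \<eta> - \<alpha>)"
      using tail
    proof eventually_elim
      case (elim k)
      have "pmf \<xi> k * real k powr (1 + \<eta>) \<le> real k powr \<eta> * real k powr (- 1 - \<alpha>) * real k powr (1 + \<eta>)"
        using elim by (auto intro!: mult_right_mono)
      also have "\<dots> = real k powr (2 * \<eta> - \<alpha>)"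
        by (simp add: powr_add[symmetric])
      finally show ?case by simp
    qed
  qed
  then show ?thesis
    using eta by (intro exI[of _ \<eta>]) (auto intro!: integrable_pmf_nat)
qed

end

section \<open>Renewals of the sizes of independent trees\<close>

text \<open>The set \<open>G\<close> restricts the samples; it allows for the defective laws that arise when trees with a
  large outdegree are discarded.\<close>

lemma renewal_pmf_sum:
  fixes p :: "'a pmf" and X :: "'a \<Rightarrow> nat"
  shows "measure_pmf.prob (replicate_pmf k p) {xs. (\<Sum>x\<leftarrow>xs. X x) = m \<and> (\<forall>x\<in>set xs. x \<in> G)}
    = (Abs_fps (\<lambda>j. measure_pmf.prob p {x. X x = j \<and> x \<in> G}) ^ k) $ m"
proof (induction k arbitrary: m)
  case 0
  then show ?case by (auto simp: indicator_def)
next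
  case (Suc k)
  let ?q = "\<lambda>j. measure_pmf.prob p {x. X x = j \<and> x \<in> G}"
  let ?S = "\<lambda>m. {xs. (\<Sum>x\<leftarrow>xs. X x) = m \<and> (\<forall>x\<in>set xs. x \<in> G)}"
  have "measure_pmf.prob (replicate_pmf (Suc k) p) (?S m)
      = (\<integral>xs. indicator (?S m) xs \<partial>replicate_pmf (Suc k) p)"
    by simp
  also have "\<dots> = (\<integral>x. \<integral>xs. indicator (?S m) (x # xs) \<partial>replicate_pmf k p \<partial>p)"
    by (simp only: replicate_pmf.simps)
      (simp add: integral_bind_pmf_bounded[where B = 1] indicator_def del: sum_list_simps)
  also have "\<dots> = (\<integral>x. (\<Sum>j\<le>m. indicator {x. X x = j \<and> x \<in> G} x * (Abs_fps ?q ^ k) $ (m - j)) \<partial>p)"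
  proof (intro Bochner_Integration.integral_cong refl)
    fix x
    show "(\<integral>xs. indicator (?S m) (x # xs) \<partial>replicate_pmf k p)
        = (\<Sum>j\<le>m. indicator {x. X x = j \<and> x \<in> G} x * (Abs_fps ?q ^ k) $ (m - j))"
    proof (cases "x \<in> G \<and> X x \<le> m")
      case True
      have "(\<integral>xs. indicator (?S m) (x # xs) \<partial>replicate_pmf k p)
          = (\<integral>xs. indicator (?S (m - X x)) xs \<partial>replicate_pmf k p)"
        using True by (intro Bochner_Integration.integral_cong refl) (auto simp: indicator_def)
      also have "\<dots> = (Abs_fps ?q ^ k) $ (m - X x)"
        using Suc by simp
      also have "\<dots> = (\<Sum>j\<le>m. if j = X x then (Abs_fps ?q ^ k) $ (m - j) else 0)"
        using True by simp
      also have "\<dots> = (\<Sum>j\<le>m. indicator {x. X x = j \<and> x \<in> G} x * (Abs_fps ?q ^ k) $ (m - j))"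
        using True by (intro sum.cong) (auto simp: indicator_def)
      finally show ?thesis .
    next
      case False
      then have "indicator (?S m) (x # xs) = (0::real)" for xs
        by (auto simp: indicator_def)
      moreover have "(\<Sum>j\<le>m. indicator {x. X x = j \<and> x \<in> G} x * (Abs_fps ?q ^ k) $ (m - j)) = (0::real)"
        using False by (intro sum.neutral) (auto simp: indicator_def)
      ultimately show ?thesis by simp
    qed
  qed
  also have "\<dots> = (\<Sum>j\<le>m. ?q j * (Abs_fps ?q ^ k) $ (m - j))"
    by (subst Bochner_Integration.integral_sum)
      (auto intro!: integrable_mult_left measure_pmf.integrable_const_bound[where B = 1])
  finally show ?case
    by (simp add: fps_mult_nth atLeast0AtMost)
qed

lemma sum_eq_prob_le:
  fixes X :: "'a \<Rightarrow> nat"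
  shows "(\<Sum>j\<le>m. measure_pmf.prob p {x. X x = j \<and> P x}) = measure_pmf.prob p {x. X x \<le> m \<and> P x}"
proof -
  have "measure_pmf.prob p (\<Union>j\<le>m. {x. X x = j \<and> P x}) = (\<Sum>j\<le>m. measure_pmf.prob p {x. X x = j \<and> P x})"
    by (rule measure_pmf.finite_measure_finite_Union) (auto simp: disjoint_family_on_def)
  moreover have "(\<Union>j\<le>m. {x. X x = j \<and> P x}) = {x. X x \<le> m \<and> P x}"
    by auto
  ultimately show ?thesis by simp
qed

lemma mean_eq_sum_tails:
  fixes X :: "'a \<Rightarrow> nat"
  assumes "integrable (measure_pmf p) (\<lambda>x. real (X x))"
  shows "(\<lambda>j. measure_pmf.prob p {x. X x > j}) sums measure_pmf.expectation p (\<lambda>x. real (X x))"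
proof -
  have X: "real (X x) = (\<Sum>j. indicator {x. X x > j} x)" "summable (\<lambda>j. indicat_real {x. X x > j} x)" for x
  proof -
    have "(\<lambda>j. indicat_real {x. X x > j} x) sums (\<Sum>j<X x. indicat_real {x. X x > j} x)"
      by (rule sums_finite) auto
    also have "(\<Sum>j<X x. indicat_real {x. X x > j} x) = real (X x)"
      by simp
    finally show "real (X x) = (\<Sum>j. indicator {x. X x > j} x)" "summable (\<lambda>j. indicat_real {x. X x > j} x)"
      by (simp_all add: sums_iff)
  qed
  have "(\<Sum>j. ennreal (measure_pmf.prob p {x. X x > j})) = (\<Sum>j. \<integral>\<^sup>+x. indicator {x. X x > j} x \<partial>p)"
    by (simp add: measure_pmf.emeasure_eq_measure)
  also have "\<dots> = (\<integral>\<^sup>+x. (\<Sum>j. indicator {x. X x > j} x) \<partial>p)"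
    by (rule nn_integral_suminf[symmetric]) simp
  also have "\<dots> = (\<integral>\<^sup>+x. ennreal (real (X x)) \<partial>p)"
  proof (intro nn_integral_cong)
    fix x
    have "(\<Sum>j. ennreal (indicator {x. X x > j} x)) = ennreal (\<Sum>j. indicator {x. X x > j} x)"
      using X(2) by (intro suminf_ennreal2) auto
    then show "(\<Sum>j. indicator {x. X x > j} x) = ennreal (real (X x))"
      by (simp add: X(1) ennreal_indicator)
  qed
  also have "\<dots> = ennreal (measure_pmf.expectation p (\<lambda>x. real (X x)))"
    using assms by (intro nn_integral_eq_integral) auto
  finally have eq: "(\<Sum>j. ennreal (measure_pmf.prob p {x. X x > j})) = ennreal (measure_pmf.expectation p (\<lambda>x. real (X x)))" .
  then have "summable (\<lambda>j. measure_pmf.prob p {x. X x > j})"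
    by (intro summable_suminf_not_top) auto
  moreover from this have "(\<Sum>j. measure_pmf.prob p {x. X x > j}) = measure_pmf.expectation p (\<lambda>x. real (X x))"
    using eq by (subst (asm) suminf_ennreal2) (auto simp: suminf_nonneg integral_nonneg_AE)
  ultimately show ?thesis
    by (simp add: sums_iff)
qed

lemma real_sum_list: "real (\<Sum>t\<leftarrow>ts. f t) = (\<Sum>t\<leftarrow>ts. real (f t))"
  by (induction ts) auto

context heavy_tailed
begin

definition q :: "nat \<Rightarrow> real" where "q j = measure_pmf.prob gw {T. L \<Omega> T = j}"

definition eventually_in :: bool where "eventually_in \<longleftrightarrow> infinite \<Omega>"

lemma eventually_in: "\<forall>\<^sub>F k in sequentially. k \<in> \<Omega> \<longleftrightarrow> eventually_in"
proof (cases "finite \<Omega>")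
  case True
  then have "\<forall>\<^sub>F k in sequentially. k \<notin> \<Omega>"
    by (simp add: cofinite_eq_sequentially[symmetric] eventually_cofinite)
  with True show ?thesis by (simp add: eventually_in_def)
next
  case False
  then have "finite (- \<Omega>)" using Omega_fin by blast
  then have "\<forall>\<^sub>F k in sequentially. k \<in> \<Omega>"
    by (simp add: cofinite_eq_sequentially[symmetric] eventually_cofinite Compl_eq)
  with False show ?thesis by (simp add: eventually_in_def)
qed

text \<open>The leaf will do if zero is in \<open>\<Omega>\<close>. Otherwise leaves are not counted, and a star whose centre has an
  outdegree in \<open>\<Omega>\<close> will do.\<close>

lemma unit_tree: "\<exists>t. L \<Omega> t = 1 \<and> pmf gw t > 0"
proof (cases "0 \<in> \<Omega>")
  case True
  then show ?thesis
    using p0 pmf_gw[of "[]"] by (intro exI[of _ "Node []"]) (simp add: L_Node)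
next
  case False
  have "\<exists>k\<in>\<Omega>. pmf \<xi> k > 0"
  proof (rule ccontr)
    assume "\<not> ?thesis"
    then have "set_pmf \<xi> \<inter> \<Omega> = {}"
      by (auto simp: set_pmf_iff)
    then show False
      using Omega_pos measure_pmf_zero_iff[of \<xi> \<Omega>] by simp
  qed
  then obtain k where "k \<in> \<Omega>" "pmf \<xi> k > 0" by blast
  then show ?thesis
    using False p0 by (intro exI[of _ "Node (replicate k (Node []))"])
      (simp add: L_Node pmf_gw sum_list_replicate)
qed

text \<open>Take a root with many children and a copy of a tree with \<open>L = 1\<close> at each of them. As \<open>\<Omega>\<close> or its
  complement is finite, large outdegrees are either all counted or not at all, so that all large values
  are attained.\<close>

lemma q_pos: "\<forall>\<^sub>F n in sequentially. q n > 0"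
proof -
  obtain t where t: "L \<Omega> t = 1" "pmf gw t > 0" using unit_tree by blast
  define e :: nat where "e = of_bool eventually_in"
  have "\<forall>\<^sub>F k in sequentially. q (k + e) > 0"
    using pmf_pos eventually_in
  proof eventually_elim
    case (elim k)
    have "L \<Omega> (Node (replicate k t)) = k + e"
      using t elim by (simp add: L_Node sum_list_replicate e_def)
    moreover have "0 < pmf gw (Node (replicate k t))"
      using t elim by (simp add: pmf_gw)
    ultimately have "0 < measure_pmf.prob gw {Node (replicate k t)}" "{Node (replicate k t)} \<subseteq> {T. L \<Omega> T = k + e}"
      by (auto simp: measure_pmf_single)
    then show ?case
      unfolding q_def using measure_pmf.finite_measure_mono[of "{Node (replicate k t)}" "{T. L \<Omega> T = k + e}" gw]
      by simp
  qed
  then obtain k0 where k0: "\<And>k. k \<ge> k0 \<Longrightarrow> q (k + e) > 0"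
    by (auto simp: eventually_sequentially)
  have "q n > 0" if "n \<ge> k0 + e" for n
    using k0[of "n - e"] that by simp
  then show ?thesis
    by (auto simp: eventually_sequentially)
qed

lemma q_consecutive: "\<exists>j. q j > 0 \<and> q (Suc j) > 0"
  using q_pos unfolding eventually_sequentially by (meson le_refl le_SucI)

lemma q_sum: "(\<Sum>j\<le>m. q j) = measure_pmf.prob gw {T. L \<Omega> T \<le> m}"
  using sum_eq_prob_le[of gw "L \<Omega>" "\<lambda>_. True" m] by (simp add: q_def)

lemma prob_gt: "1 - (\<Sum>j\<le>m. q j) = measure_pmf.prob gw {T. L \<Omega> T > m}"
proof -
  have "{T. L \<Omega> T > m} = UNIV - {T. L \<Omega> T \<le> m}" by auto
  then show ?thesis
    using measure_pmf.prob_compl[of "{T. L \<Omega> T \<le> m}" gw] by (simp add: q_sum)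
qed

sublocale renewal q
proof
  show nonneg: "q j \<ge> 0" for j by (simp add: q_def)
  have "(\<lambda>j. measure_pmf.prob gw {T. L \<Omega> T > j}) \<longlonglongrightarrow> 0"
    using mean_eq_sum_tails[OF integrable_L] by (intro summable_LIMSEQ_zero) (rule sums_summable)
  then have "(\<lambda>m. 1 - (\<Sum>j\<le>m. q j)) \<longlonglongrightarrow> 0"
    by (simp only: prob_gt)
  from tendsto_diff[OF tendsto_const[of 1] this] show "q sums 1"
    by (simp add: sums_def_le)
  obtain j where j: "q j > 0" "q (Suc j) > 0" using q_consecutive by blast
  have "q 0 + q (Suc j) = measure_pmf.prob gw {T. L \<Omega> T = 0} + measure_pmf.prob gw {T. L \<Omega> T = Suc j}"
    by (simp add: q_def)
  also have "\<dots> = measure_pmf.prob gw ({T. L \<Omega> T = 0} \<union> {T. L \<Omega> T = Suc j})"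
    by (rule measure_pmf.finite_measure_Union[symmetric]) auto
  also have "\<dots> \<le> 1" by simp
  finally show "q 0 < 1" using j by simp
qed

text \<open>The renewal theorem applies with mean step \<open>1 / c\<close>, because sizes attain two consecutive values with
  positive probability.\<close>

lemma U_lim: "(\<lambda>n. U $ n) \<longlonglongrightarrow> c"
proof -
  have surv: "surv = (\<lambda>j. measure_pmf.prob gw {T. L \<Omega> T > j})"
    unfolding surv_def by (intro ext prob_gt)
  have "surv sums (1 / c)"
    unfolding surv using mean_eq_sum_tails[OF integrable_L[of \<Omega>]] by (simp add: expectation_L c_def)
  then have "summable surv" "suminf surv = 1 / c"
    by (simp_all add: sums_iff)
  moreover obtain j where "q j > 0" "q (Suc j) > 0" using q_consecutive by blast
  ultimately show ?thesis
    using renewal_theorem by fastforce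
qed

definition U_max :: real where "U_max = 1 / (1 - q 0)"

lemma U_max_pos: "U_max > 0"
  using q0 by (simp add: U_max_def)

lemma prob_sum_eq: "measure_pmf.prob (replicate_pmf k gw) {ts. (\<Sum>t\<leftarrow>ts. L \<Omega> t) = m} = (Q ^ k) $ m"
proof -
  have "Q = Abs_fps (\<lambda>j. measure_pmf.prob gw {T. L \<Omega> T = j \<and> T \<in> UNIV})"
    unfolding Q_def by (rule arg_cong[where f = Abs_fps]) (auto simp: q_def)
  then show ?thesis
    using renewal_pmf_sum[of k gw "L \<Omega>" m UNIV] by simp
qed

lemma sum_power_eq: "(\<Sum>j\<le>m. (Q ^ k) $ j) = measure_pmf.prob (replicate_pmf k gw) {ts. (\<Sum>t\<leftarrow>ts. L \<Omega> t) \<le> m}"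
  using sum_eq_prob_le[of "replicate_pmf k gw" "\<lambda>ts. \<Sum>t\<leftarrow>ts. L \<Omega> t" "\<lambda>_. True" m]
  by (simp add: prob_sum_eq)

lemma Q_nonneg: "(Q ^ k) $ m \<ge> 0"
  by (simp add: prob_sum_eq[symmetric])

lemma late_visits_le:
  "(\<Sum>k\<in>{K..<K'}. (Q ^ k) $ m) \<le> U_max * measure_pmf.prob (replicate_pmf K gw) {ts. (\<Sum>t\<leftarrow>ts. L \<Omega> t) \<le> m}"
proof (cases "K \<le> K'")
  case True
  have "(\<Sum>k\<in>{K..<K'}. (Q ^ k) $ m) = (\<Sum>k<K'. (Q ^ k) $ m) - (\<Sum>k<K. (Q ^ k) $ m)"
    using sum_diff_nat_ivl[of 0 K K' "\<lambda>k. (Q ^ k) $ m"] True by (simp add: atLeast0LessThan)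
  also have "\<dots> \<le> (\<Sum>j\<le>m. (Q ^ K) $ j * U $ (m - j))"
    using sum_power_le_U[of m K'] U_tail[of m K] by linarith
  also have "\<dots> \<le> (\<Sum>j\<le>m. (Q ^ K) $ j) / (1 - q 0)"
    by (rule sum_power_tail_le)
  finally show ?thesis by (simp add: sum_power_eq U_max_def)
qed (simp add: mult_nonneg_nonneg U_max_pos less_imp_le)

text \<open>If the walk is still below \<open>m\<close> by at least \<open>M\<close> at time \<open>K\<close>, then nearly \<open>c\<close> visits to \<open>m\<close> are yet to come, and
  since there are only about \<open>c\<close> visits in total, few can have happened before.\<close>

lemma early_visits_le:
  assumes M: "\<And>i. i \<ge> M \<Longrightarrow> U $ i \<ge> c - e" and e: "0 \<le> e" and m: "M \<le> m" and U: "U $ m \<le> c + e"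
  shows "(\<Sum>k<K. (Q ^ k) $ m) \<le> 2 * e
    + c * measure_pmf.prob (replicate_pmf K gw) {ts. (\<Sum>t\<leftarrow>ts. L \<Omega> t) > m - M}"
proof -
  define P where "P = measure_pmf.prob (replicate_pmf K gw) {ts. (\<Sum>t\<leftarrow>ts. L \<Omega> t) \<le> m - M}"
  have "(c - e) * P = (\<Sum>j\<le>m - M. (Q ^ K) $ j * (c - e))"
    by (simp add: P_def sum_power_eq[symmetric] sum_distrib_left mult.commute)
  also have "\<dots> \<le> (\<Sum>j\<le>m - M. (Q ^ K) $ j * U $ (m - j))"
    using m by (intro sum_mono mult_left_mono Q_nonneg M) auto
  also have "\<dots> \<le> (\<Sum>j\<le>m. (Q ^ K) $ j * U $ (m - j))"
    by (intro sum_mono2) (auto intro!: mult_nonneg_nonneg Q_nonneg U_nonneg)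
  also have "\<dots> = U $ m - (\<Sum>k<K. (Q ^ k) $ m)"
    using U_tail[of m K] by simp
  finally have 1: "(\<Sum>k<K. (Q ^ k) $ m) \<le> c + e - (c - e) * P"
    using U by simp
  have "{ts. (\<Sum>t\<leftarrow>ts. L \<Omega> t) > m - M} = UNIV - {ts. (\<Sum>t\<leftarrow>ts. L \<Omega> t) \<le> m - M}"
    by auto
  then have 2: "measure_pmf.prob (replicate_pmf K gw) {ts. (\<Sum>t\<leftarrow>ts. L \<Omega> t) > m - M} = 1 - P"
    using measure_pmf.prob_compl[of "{ts. (\<Sum>t\<leftarrow>ts. L \<Omega> t) \<le> m - M}" "replicate_pmf K gw"] by (simp add: P_def)
  have "e * P \<le> e * 1"
    using e by (intro mult_left_mono) (auto simp: P_def)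
  then show ?thesis
    using 1 unfolding 2 by (simp add: algebra_simps)
qed

lemma weak_law_L_lower:
  assumes e: "e > 0" and K: "filterlim K at_top sequentially"
  shows "(\<lambda>n. measure_pmf.prob (replicate_pmf (K n) gw)
    {ts. real (\<Sum>t\<leftarrow>ts. L \<Omega> t) \<le> (1 / c - e) * real (K n)}) \<longlonglongrightarrow> 0"
proof -
  have "(\<lambda>k. measure_pmf.prob (replicate_pmf k gw)
    {ts. (\<Sum>t\<leftarrow>ts. real (L \<Omega> t)) \<le> (measure_pmf.expectation gw (\<lambda>T. real (L \<Omega> T)) - e) * real k}) \<longlonglongrightarrow> 0"
    by (rule weak_law_lower[OF _ integrable_L e]) simp
  then have "(\<lambda>k. measure_pmf.prob (replicate_pmf k gw)
    {ts. real (\<Sum>t\<leftarrow>ts. L \<Omega> t) \<le> (1 / c - e) * real k}) \<longlonglongrightarrow> 0"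
    by (simp add: expectation_L c_def real_sum_list)
  then show ?thesis
    by (rule filterlim_compose[OF _ K])
qed

lemma weak_law_L_upper:
  assumes e: "e > 0" and K: "filterlim K at_top sequentially"
  shows "(\<lambda>n. measure_pmf.prob (replicate_pmf (K n) gw)
    {ts. (1 / c + e) * real (K n) \<le> real (\<Sum>t\<leftarrow>ts. L \<Omega> t)}) \<longlonglongrightarrow> 0"
proof -
  have "(\<lambda>k. measure_pmf.prob (replicate_pmf k gw)
    {ts. (measure_pmf.expectation gw (\<lambda>T. real (L \<Omega> T)) + e) * real k \<le> (\<Sum>t\<leftarrow>ts. real (L \<Omega> t))}) \<longlonglongrightarrow> 0"
    by (rule weak_law_upper[OF _ integrable_L e]) simp
  then have "(\<lambda>k. measure_pmf.prob (replicate_pmf k gw)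
    {ts. (1 / c + e) * real k \<le> real (\<Sum>t\<leftarrow>ts. L \<Omega> t)}) \<longlonglongrightarrow> 0"
    by (simp add: expectation_L c_def real_sum_list)
  then show ?thesis
    by (rule filterlim_compose[OF _ K])
qed

end

section \<open>Trees without a vertex of large outdegree\<close>

context subcritical
begin

text \<open>The truncated exponential moment is multiplicative over the fringe subtrees at the children of the
  root. So every \<open>y\<close> that dominates the recursion at the root dominates the moment, even though the
  moment might be infinite a priori.\<close>

lemma truncated_supersolution:
  fixes y s :: real
  assumes y: "0 \<le> y" and super: "(\<integral>\<^sup>+k. ennreal (exp s * y ^ k) * of_bool (k < D) \<partial>\<xi>) \<le> ennreal y" and s: "0 \<le> s"
  shows "(\<integral>\<^sup>+T. ennreal (exp (s * real (L \<Omega> T))) * of_bool (L {D..} T = 0) \<partial>gw) \<le> ennreal y"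
proof (rule nn_integral_gw_le)
  define F where "F T = ennreal (exp (s * real (L \<Omega> T))) * of_bool (L {D..} T = 0)" for T
  fix A
  assume A: "(\<integral>\<^sup>+T. ennreal (exp (s * real (L \<Omega> T))) * of_bool (L {D..} T = 0) * indicator A T \<partial>gw) \<le> ennreal y"
  have prod: "ennreal (exp (s * real (\<Sum>t\<leftarrow>ts. L \<Omega> t))) * of_bool (\<forall>t\<in>set ts. L {D..} t = 0 \<and> t \<in> A)
      = (\<Prod>t\<leftarrow>ts. F t * indicator A t)" for ts
  proof (induction ts)
    case (Cons a ts)
    have "(\<Prod>t\<leftarrow>a # ts. F t * indicator A t) = ennreal (exp (s * real (L \<Omega> a))) * of_bool (L {D..} a = 0 \<and> a \<in> A)
        * (ennreal (exp (s * real (\<Sum>t\<leftarrow>ts. L \<Omega> t))) * of_bool (\<forall>t\<in>set ts. L {D..} t = 0 \<and> t \<in> A))"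
      unfolding Cons by (auto simp: F_def)
    then show ?case
      by (cases "L {D..} a = 0 \<and> a \<in> A"; cases "\<forall>t\<in>set ts. L {D..} t = 0 \<and> t \<in> A")
        (auto simp: exp_add distrib_left ennreal_mult)
  qed simp
  have F_Node: "F (Node ts) * indicator (Node ` lists A) (Node ts)
      \<le> ennreal (exp s) * of_bool (length ts < D) * (\<Prod>t\<leftarrow>ts. F t * indicator A t)" for ts
  proof (cases "length ts < D \<and> (\<forall>t\<in>set ts. L {D..} t = 0 \<and> t \<in> A)")
    case True
    have "exp (s * real (L \<Omega> (Node ts))) \<le> exp s * exp (s * real (\<Sum>t\<leftarrow>ts. L \<Omega> t))"
      using s by (auto simp: L_Node exp_add[symmetric] distrib_left)
    then have "ennreal (exp (s * real (L \<Omega> (Node ts)))) \<le> ennreal (exp s) * ennreal (exp (s * real (\<Sum>t\<leftarrow>ts. L \<Omega> t)))"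
      by (simp add: ennreal_mult[symmetric] ennreal_leI)
    moreover have "F (Node ts) * indicator (Node ` lists A) (Node ts) \<le> ennreal (exp (s * real (L \<Omega> (Node ts))))"
      by (auto simp: F_def indicator_def of_bool_def)
    moreover have "(\<Prod>t\<leftarrow>ts. F t * indicator A t) = ennreal (exp (s * real (\<Sum>t\<leftarrow>ts. L \<Omega> t)))"
      unfolding prod[symmetric] using True by simp
    ultimately show ?thesis
      using True by simp
  next
    case False
    then have "F (Node ts) * indicator (Node ` lists A) (Node ts) = 0"
      by (auto simp: F_def L_Node indicator_def)
    then show ?thesis by (simp only: zero_le)
  qed
  have "(\<integral>\<^sup>+T. F T * indicator (Node ` lists A) T \<partial>gw)
      \<le> (\<integral>\<^sup>+k. \<integral>\<^sup>+ts. ennreal (exp s) * of_bool (k < D) * (\<Prod>t\<leftarrow>ts. F t * indicator A t) \<partial>replicate_pmf k gw \<partial>\<xi>)"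
    unfolding nn_integral_gw
  proof (rule nn_integral_mono, rule nn_integral_mono_AE, rule AE_pmfI)
    fix k ts assume "ts \<in> set_pmf (replicate_pmf k gw)"
    then have "length ts = k" by (simp add: set_replicate_pmf)
    then show "F (Node ts) * indicator (Node ` lists A) (Node ts)
        \<le> ennreal (exp s) * of_bool (k < D) * (\<Prod>t\<leftarrow>ts. F t * indicator A t)"
      using F_Node[of ts] by simp
  qed
  also have "\<dots> = (\<integral>\<^sup>+k. ennreal (exp s) * of_bool (k < D) * (\<integral>\<^sup>+T. F T * indicator A T \<partial>gw) ^ k \<partial>\<xi>)"
    by (simp add: nn_integral_cmult nn_integral_replicate_pmf_prod)
  also have "\<dots> \<le> (\<integral>\<^sup>+k. ennreal (exp s) * of_bool (k < D) * ennreal y ^ k \<partial>\<xi>)"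
    using A by (intro nn_integral_mono mult_left_mono power_mono) (auto simp: F_def)
  also have "\<dots> = (\<integral>\<^sup>+k. ennreal (exp s * y ^ k) * of_bool (k < D) \<partial>\<xi>)"
    using y by (intro nn_integral_cong) (simp add: ennreal_mult ennreal_power mult_ac)
  also note super
  finally show "(\<integral>\<^sup>+T. ennreal (exp (s * real (L \<Omega> T))) * of_bool (L {D..} T = 0) * indicator (Node ` lists A) T \<partial>gw) \<le> ennreal y"
    by (simp add: F_def)
qed

lemma prob_truncated_le:
  fixes y s :: real
  assumes "0 \<le> y" "(\<integral>\<^sup>+k. ennreal (exp s * y ^ k) * of_bool (k < D) \<partial>\<xi>) \<le> ennreal y" "0 \<le> s"
  shows "measure_pmf.prob gw {T. L \<Omega> T = n \<and> L {D..} T = 0} \<le> exp (- s * real n) * y"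
proof -
  have "ennreal (measure_pmf.prob gw {T. L \<Omega> T = n \<and> L {D..} T = 0})
      = (\<integral>\<^sup>+T. indicator {T. L \<Omega> T = n \<and> L {D..} T = 0} T \<partial>gw)"
    by (simp add: measure_pmf.emeasure_eq_measure)
  also have "\<dots> \<le> (\<integral>\<^sup>+T. ennreal (exp (- s * real n)) * (ennreal (exp (s * real (L \<Omega> T))) * of_bool (L {D..} T = 0)) \<partial>gw)"
    by (intro nn_integral_mono) (auto simp: indicator_def ennreal_mult[symmetric] exp_add[symmetric])
  also have "\<dots> = ennreal (exp (- s * real n)) * (\<integral>\<^sup>+T. ennreal (exp (s * real (L \<Omega> T))) * of_bool (L {D..} T = 0) \<partial>gw)"
    by (simp add: nn_integral_cmult)
  also have "\<dots> \<le> ennreal (exp (- s * real n)) * ennreal y"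
    by (intro mult_left_mono truncated_supersolution assms) auto
  also have "\<dots> = ennreal (exp (- s * real n) * y)"
    using assms(1) by (simp add: ennreal_mult)
  finally show ?thesis
    using assms(1) by (simp add: ennreal_le_iff)
qed

end

text \<open>A second order Taylor bound in which only \<open>1 + \<eta>\<close> moments are used.\<close>

lemma exp_le_powr_remainder:
  fixes u \<eta> :: real
  assumes "0 \<le> u" "0 < \<eta>" "\<eta> \<le> 1"
  shows "exp u \<le> 1 + u + u powr (1 + \<eta>) * exp u"
proof (cases "u \<le> 1")
  case True
  have "exp u \<le> 1 + u + u\<^sup>2 * 1"
    using exp_bound[of u] assms True by simp
  also have "u\<^sup>2 * 1 \<le> u powr (1 + \<eta>) * exp u"
  proof (cases "u = 0")
    case False
    then have "u\<^sup>2 = u powr 2" using assms by (simp add: powr_numeral)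
    also have "\<dots> \<le> u powr (1 + \<eta>)"
      using assms True False by (intro powr_mono') auto
    finally show ?thesis using assms by (intro mult_mono) auto
  qed simp
  finally show ?thesis by simp
next
  case False
  then have "1 \<le> u powr (1 + \<eta>)"
    using assms by (intro ge_one_powr_ge_zero) auto
  then have "1 * exp u \<le> u powr (1 + \<eta>) * exp u"
    by (intro mult_right_mono) auto
  then show ?thesis using assms by linarith
qed

context heavy_tailed
begin

text \<open>A moment bound at an exponent \<open>s\<close> of order \<open>ln n / n\<close>. With outdegrees below \<open>\<delta> n\<close> the factors \<open>y ^ k\<close> are at
  most a small power of \<open>n\<close>, so that the remainder in the expansion of \<open>E[y ^ \<xi>]\<close> is of smaller order
  than \<open>s\<close>. Subcriticality leaves room for \<open>y = 1 + C s\<close> to dominate the recursion.\<close>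

lemma no_big_jump:
  "\<exists>\<delta>>0. \<forall>\<^sub>F n in sequentially.
    measure_pmf.prob gw {T. L \<Omega> T = n \<and> L {nat \<lceil>\<delta> * real n\<rceil>..} T = 0} \<le> 2 * real n powr (- (3 + \<alpha>))"
proof -
  obtain \<eta> where eta: "0 < \<eta>" "\<eta> \<le> 1" and mom: "integrable (measure_pmf \<xi>) (\<lambda>k. real k powr (1 + \<eta>))"
    using moment_above_one by blast
  define A where "A = 3 + \<alpha>"
  \<comment> \<open>Substituting \<open>y = 1 + C s\<close> yields \<open>1 + s + E[\<xi>] C s\<close> to first order. This choice of \<open>C\<close> makes it
    \<open>1 + (C - 1) s\<close>, and \<open>\<delta>\<close> is such that \<open>y ^ k \<le> n powr (\<eta> / 2)\<close> for \<open>k \<le> \<delta> n\<close>.\<close>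
  define C where "C = 2 / (1 - mean \<xi>)"
  define E where "E = measure_pmf.expectation \<xi> (\<lambda>k. real k powr (1 + \<eta>))"
  have A: "A > 0" using alpha by (simp add: A_def)
  have C: "C > 0" "C * mean \<xi> = C - 2" using sub by (auto simp: C_def field_simps)
  have E: "E \<ge> 0" unfolding E_def by (intro integral_nonneg_AE) auto
  define \<delta> where "\<delta> = \<eta> / (2 * C * A)"
  have delta: "\<delta> > 0" using eta C A by (simp add: \<delta>_def)
  define s where "s n = A * ln (real n) / real n" for n
  define R where "R n = C powr (1 + \<eta>) * E * (s n powr \<eta> * real n powr (\<eta> / 2))" for n
  have "(\<lambda>n. s n powr \<eta> * real n powr (\<eta> / 2)) \<longlonglongrightarrow> 0"
    unfolding s_def using A eta by real_asymp
  then have "R \<longlonglongrightarrow> 0"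
    unfolding R_def by (rule tendsto_mult_right_zero)
  then have R_small: "\<forall>\<^sub>F n in sequentially. R n < 1 / 4"
    by (rule order_tendstoD) simp
  have s_lim: "s \<longlonglongrightarrow> 0"
    unfolding s_def by real_asymp
  have s_small: "\<forall>\<^sub>F n in sequentially. s n < min 1 (1 / (4 * (C + 3)))"
    by (rule order_tendstoD[OF s_lim]) (use C in auto)
  have s_small': "\<forall>\<^sub>F n in sequentially. C * s n < 1"
    by (rule order_tendstoD[OF tendsto_mult_right_zero[OF s_lim]]) simp
  have "\<forall>\<^sub>F n in sequentially.
    measure_pmf.prob gw {T. L \<Omega> T = n \<and> L {nat \<lceil>\<delta> * real n\<rceil>..} T = 0} \<le> 2 * real n powr (- (3 + \<alpha>))"
    using R_small s_small s_small' eventually_gt_at_top[of 1]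
  proof eventually_elim
    case (elim n)
    define D where "D = nat \<lceil>\<delta> * real n\<rceil>"
    have s: "0 < s n" "s n < 1" "s n < 1 / (4 * (C + 3))"
      using elim A by (auto simp: s_def)
    define y where "y = 1 + C * s n"
    have y: "0 \<le> y" "y \<le> 2" using C s elim by (auto simp: y_def)
    have pointwise: "y ^ k * of_bool (k < D) \<le> 1 + C * s n * real k
        + (C * s n) powr (1 + \<eta>) * real n powr (\<eta> / 2) * real k powr (1 + \<eta>)" for k
    proof (cases "k < D")
      case True
      then have "int k < \<lceil>\<delta> * real n\<rceil>"
        unfolding D_def by linarith
      then have k: "real k \<le> \<delta> * real n"
        by (simp add: less_ceiling_iff)
      define u where "u = C * s n * real k"
      have u: "0 \<le> u" using C s by (simp add: u_def)
      have "u \<le> C * s n * (\<delta> * real n)"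
        unfolding u_def using C s k by (intro mult_left_mono) auto
      also have "\<dots> = \<eta> / 2 * ln (real n)"
        using elim C A by (simp add: s_def \<delta>_def field_simps)
      finally have exp_u: "exp u \<le> real n powr (\<eta> / 2)"
        using elim by (simp add: powr_def)
      have "y ^ k \<le> exp (C * s n) ^ k"
        using y exp_ge_add_one_self[of "C * s n"] by (intro power_mono) (auto simp: y_def)
      also have "\<dots> = exp u"
        by (simp add: u_def exp_of_nat_mult[symmetric] mult_ac)
      also have "\<dots> \<le> 1 + u + u powr (1 + \<eta>) * exp u"
        by (rule exp_le_powr_remainder[OF u eta])
      also have "\<dots> \<le> 1 + u + u powr (1 + \<eta>) * real n powr (\<eta> / 2)"
        using exp_u by (intro add_left_mono mult_left_mono) auto
      also have "u powr (1 + \<eta>) = (C * s n) powr (1 + \<eta>) * real k powr (1 + \<eta>)"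
        using C s by (simp add: u_def powr_mult)
      finally show ?thesis
        using True by (simp add: u_def mult_ac)
    next
      case False
      then show ?thesis using C s by (auto intro!: add_nonneg_nonneg mult_nonneg_nonneg)
    qed
    have C2: "0 \<le> C - 2" using C mean_nonneg by (metis less_imp_le mult_nonneg_nonneg)
    have R0: "0 \<le> R n" using E by (auto simp: R_def)
    have CsR: "(C * s n) powr (1 + \<eta>) * real n powr (\<eta> / 2) * E = s n * R n"
      using C s by (simp add: R_def powr_mult powr_add mult_ac)
    have int_pow: "integrable (measure_pmf \<xi>) (\<lambda>k. 1 + C * s n * real k
        + (C * s n) powr (1 + \<eta>) * real n powr (\<eta> / 2) * real k powr (1 + \<eta>))"
      by (intro Bochner_Integration.integrable_add integrable_mult_right int mom) auto
    have "(\<integral>\<^sup>+k. ennreal (exp (s n) * y ^ k) * of_bool (k < D) \<partial>\<xi>)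
        \<le> (\<integral>\<^sup>+k. ennreal (exp (s n)) * ennreal (1 + C * s n * real k
        + (C * s n) powr (1 + \<eta>) * real n powr (\<eta> / 2) * real k powr (1 + \<eta>)) \<partial>\<xi>)"
    proof (rule nn_integral_mono)
      fix k
      have "ennreal (exp (s n) * y ^ k) * of_bool (k < D) = ennreal (exp (s n)) * ennreal (y ^ k * of_bool (k < D))"
        using y by (auto simp: ennreal_mult)
      then show "ennreal (exp (s n) * y ^ k) * of_bool (k < D) \<le> ennreal (exp (s n)) * ennreal (1 + C * s n * real k
        + (C * s n) powr (1 + \<eta>) * real n powr (\<eta> / 2) * real k powr (1 + \<eta>))"
        using pointwise[of k] by (simp only:) (intro mult_left_mono ennreal_leI, auto)
    qed
    also have "\<dots> = ennreal (exp (s n)) * (\<integral>\<^sup>+k. ennreal (1 + C * s n * real k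
        + (C * s n) powr (1 + \<eta>) * real n powr (\<eta> / 2) * real k powr (1 + \<eta>)) \<partial>\<xi>)"
      by (simp add: nn_integral_cmult)
    also have "(\<integral>\<^sup>+k. ennreal (1 + C * s n * real k
        + (C * s n) powr (1 + \<eta>) * real n powr (\<eta> / 2) * real k powr (1 + \<eta>)) \<partial>\<xi>)
      = ennreal (\<integral>k. 1 + C * s n * real k
        + (C * s n) powr (1 + \<eta>) * real n powr (\<eta> / 2) * real k powr (1 + \<eta>) \<partial>\<xi>)"
      using C s by (intro nn_integral_eq_integral int_pow) (auto intro!: add_nonneg_nonneg mult_nonneg_nonneg)
    also have "(\<integral>k. 1 + C * s n * real k
        + (C * s n) powr (1 + \<eta>) * real n powr (\<eta> / 2) * real k powr (1 + \<eta>) \<partial>\<xi>)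
      = 1 + C * s n * mean \<xi> + (C * s n) powr (1 + \<eta>) * real n powr (\<eta> / 2) * E"
      using int mom by (simp add: E_def)
    also have "\<dots> = 1 + s n * (C - 2 + R n)"
      unfolding CsR C(2)[symmetric] by (simp add: algebra_simps)
    also have "ennreal (exp (s n)) * ennreal (1 + s n * (C - 2 + R n)) = ennreal (exp (s n) * (1 + s n * (C - 2 + R n)))"
      using s C2 R0 by (intro ennreal_mult[symmetric]) (auto intro!: add_nonneg_nonneg mult_nonneg_nonneg)
    also have "\<dots> \<le> ennreal y"
    proof (rule ennreal_leI)
      have "exp (s n) \<le> 1 + s n + (s n)\<^sup>2"
        using s by (intro exp_bound) auto
      then have "exp (s n) * (1 + s n * (C - 2 + R n)) \<le> (1 + s n + (s n)\<^sup>2) * (1 + s n * (C - 2 + 1 / 4))"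
        using C2 R0 s elim by (intro mult_mono add_left_mono mult_left_mono) auto
      also have "\<dots> = 1 + s n * (C - 3 / 4 + s n * (C - 3 / 4) + s n * s n * (C - 7 / 4))"
        by (simp add: algebra_simps power2_eq_square)
      also have "\<dots> \<le> 1 + s n * C"
      proof -
        have "s n * (C - 3 / 4) \<le> s n * (C + 3)"
          using s by (intro mult_left_mono) auto
        moreover have "s n * s n * (C - 7 / 4) \<le> s n * 1 * (C + 3)"
          using s C2 by (intro mult_mono mult_left_mono) auto
        moreover have "s n * (C + 3) \<le> 1 / 4"
          using s C by (simp add: field_simps)
        ultimately have "C - 3 / 4 + s n * (C - 3 / 4) + s n * s n * (C - 7 / 4) \<le> C"
          by simp
        then show ?thesis using s by (intro add_left_mono mult_left_mono) auto
      qed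
      finally show "exp (s n) * (1 + s n * (C - 2 + R n)) \<le> y"
        by (simp add: y_def mult.commute)
    qed
    finally have "measure_pmf.prob gw {T. L \<Omega> T = n \<and> L {D..} T = 0} \<le> exp (- s n * real n) * y"
      using y s by (intro prob_truncated_le) auto
    also have "exp (- s n * real n) = real n powr (- A)"
      using elim by (simp add: s_def powr_def)
    also have "real n powr (- A) * y \<le> real n powr (- A) * 2"
      using y by (intro mult_left_mono) auto
    finally show ?case by (simp add: A_def D_def mult.commute)
  qed
  then show ?thesis using delta by blast
qed

end

section \<open>The probability of the conditioning event\<close>

context subcritical
begin

definition gw_bullet :: "marked_tree pmf" where "gw_bullet = (SOME p. GW_bullet \<xi> = spmf_of_pmf p)"

lemma GW_bullet_eq: "GW_bullet \<xi> = spmf_of_pmf gw_bullet"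
  unfolding gw_bullet_def
  using lossless_GW_bullet[OF int sub] unfolding lossless_spmf_conv_spmf_of_pmf by (rule someI_ex)

lemma pmf_gw_bullet:
  "pmf gw_bullet (S, v) = (if marked_leaf S v then (1 - mean \<xi>) * pmf gw S / pmf \<xi> 0 else 0)"
  using GW_bullet_density[of S v] by (simp add: GW_bullet_eq)

lemma pmf_graft_decompose:
  "marked_leaf S v \<Longrightarrow> pmf gw (graft v us S) * (1 - mean \<xi>) = pmf gw_bullet (S, v) * pmf gw (Node us)"
  using pmf_gw_graft[of S v us] p0 by (simp add: pmf_gw_bullet pmf_gw field_simps)

lemma pmf_gw_decompose: "pmf gw T * (1 - mean \<xi>) = pmf gw_bullet (F0 T) * pmf gw (Node (Fs T))"
proof -
  obtain S v where F0: "F0 T = (S, v)" by (cases "F0 T")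
  show ?thesis
    using pmf_graft_decompose[OF F0_Fs_graft(1)[OF F0], of "Fs T"] F0_Fs_graft(2)[OF F0]
    by (simp add: F0)
qed

lemma inj_F0_Fs: "inj (\<lambda>T. (F0 T, Node (Fs T)))"
proof (rule injI)
  fix T T' assume eq: "(F0 T, Node (Fs T)) = (F0 T', Node (Fs T'))"
  obtain S v where F0: "F0 T = (S, v)" by (cases "F0 T")
  then have "F0 T' = (S, v)" using eq by simp
  then show "T = T'"
    using F0_Fs_graft(2)[OF F0] F0_Fs_graft(2)[of T' S v] eq by simp
qed

text \<open>Pairing \<open>F0\<close> with the whole fringe subtree \<open>Node (Fs T)\<close> turns the decomposition into a product of
  two known laws: the marked tree and an independent unconditioned tree, up to the normalisation.\<close>

lemma prob_gw_le_pair: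
  assumes "\<And>T. T \<in> A \<Longrightarrow> (F0 T, Node (Fs T)) \<in> B"
  shows "measure_pmf.prob gw A * (1 - mean \<xi>) \<le> measure_pmf.prob (pair_pmf gw_bullet gw) B"
proof -
  let ?\<phi> = "\<lambda>T. (F0 T, Node (Fs T))"
  have "ennreal (measure_pmf.prob gw A * (1 - mean \<xi>)) = (\<integral>\<^sup>+T. ennreal (pmf gw T) \<partial>count_space A) * ennreal (1 - mean \<xi>)"
    using sub by (simp add: nn_integral_pmf measure_pmf.emeasure_eq_measure ennreal_mult)
  also have "\<dots> = (\<integral>\<^sup>+T. ennreal (pmf gw T * (1 - mean \<xi>)) \<partial>count_space A)"
    using sub by (simp add: nn_integral_multc[symmetric] ennreal_mult)
  also have "\<dots> = (\<integral>\<^sup>+T. ennreal (pmf (pair_pmf gw_bullet gw) (?\<phi> T)) \<partial>count_space A)"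
    by (simp add: pmf_gw_decompose pmf_pair)
  also have "\<dots> = (\<integral>\<^sup>+x. ennreal (pmf (pair_pmf gw_bullet gw) x) \<partial>count_space (?\<phi> ` A))"
    by (rule nn_integral_bij_count_space) (auto intro: inj_on_imp_bij_betw inj_on_subset[OF inj_F0_Fs])
  also have "\<dots> = emeasure (pair_pmf gw_bullet gw) (?\<phi> ` A)"
    by (rule nn_integral_pmf)
  also have "\<dots> \<le> emeasure (pair_pmf gw_bullet gw) B"
    using assms by (intro emeasure_mono) auto
  also have "\<dots> = ennreal (measure_pmf.prob (pair_pmf gw_bullet gw) B)"
    by (rule measure_pmf.emeasure_eq_measure)
  finally show ?thesis by (simp add: ennreal_le_iff)
qed

lemma L_decompose: "L \<Omega> T + of_bool (0 \<in> \<Omega>) = L \<Omega> (fst (F0 T)) + L \<Omega> (Node (Fs T))"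
proof -
  obtain S v where F0: "F0 T = (S, v)" by (cases "F0 T")
  show ?thesis
    using L_graft[OF F0_Fs_graft(1)[OF F0], of \<Omega> "Fs T"] F0_Fs_graft(2)[OF F0]
    by (simp add: F0 L_Node)
qed

end

context heavy_tailed
begin

text \<open>By the law of large numbers the walk passes \<open>m\<close> at a time close to \<open>c m\<close>. The early visits
  are controlled by \<open>early_visits_le\<close> and the late ones by the walk still being below \<open>m\<close>.\<close>

lemma visits_off_window:
  assumes d: "0 < \<delta>" "\<delta> < c" and e: "e > 0"
  shows "\<forall>\<^sub>F n in sequentially. \<forall>m K. n \<le> m + j \<and> m \<le> n + j \<longrightarrow>
    (\<Sum>k<nat \<lceil>(c - \<delta>) * real n\<rceil>. (Q ^ k) $ m) + (\<Sum>k\<in>{nat \<lfloor>(c + \<delta>) * real n\<rfloor>..<K}. (Q ^ k) $ m) \<le> e"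
proof -
  define e0 where "e0 = e / 8"
  have e0: "e0 > 0" using e by (simp add: e0_def)
  define k1 where "k1 n = nat \<lceil>(c - \<delta>) * real n\<rceil>" for n
  define k2 where "k2 n = nat \<lfloor>(c + \<delta>) * real n\<rfloor>" for n
  have "\<forall>\<^sub>F n in sequentially. dist (U $ n) c < e0"
    using U_lim e0 by (rule tendstoD)
  then obtain M where M0: "\<And>i. i \<ge> M \<Longrightarrow> dist (U $ i) c < e0"
    by (auto simp: eventually_sequentially)
  have M: "U $ i \<ge> c - e0" "U $ i \<le> c + e0" if "i \<ge> M" for i
    using M0[OF that] by (auto simp: dist_real_def abs_less_iff)
  \<comment> \<open>These make the mean displacement at the two ends of the window differ from \<open>n\<close> by half of the
    available margin.\<close>
  define e1 where "e1 = \<delta> / (2 * c * (c + \<delta>))"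
  define e2 where "e2 = \<delta> / (2 * c * (c - \<delta>))"
  have e12: "e1 > 0" "e2 > 0" using d c_pos by (auto simp: e1_def e2_def)
  have eq1: "(1 / c - e1) * (c + \<delta>) = 1 + \<delta> / (2 * c)"
  proof -
    have "e1 * (c + \<delta>) = \<delta> / (2 * c)"
      using d c_pos by (simp add: e1_def)
    moreover have "1 / c * (c + \<delta>) = 1 + \<delta> / c"
      using c_pos by (simp add: add_divide_distrib)
    moreover have "\<delta> / c = \<delta> / (2 * c) + \<delta> / (2 * c)"
      by simp
    ultimately show ?thesis
      unfolding left_diff_distrib by linarith
  qed
  have eq2: "(1 / c + e2) * (c - \<delta>) = 1 - \<delta> / (2 * c)"
  proof -
    have "e2 * (c - \<delta>) = \<delta> / (2 * c)"
      using d c_pos by (simp add: e2_def)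
    moreover have "1 / c * (c - \<delta>) = 1 - \<delta> / c"
      using c_pos by (simp add: diff_divide_distrib)
    moreover have "\<delta> / c = \<delta> / (2 * c) + \<delta> / (2 * c)"
      by simp
    ultimately show ?thesis
      unfolding distrib_right by linarith
  qed
  have e1_le: "1 / c - e1 > 0"
  proof (rule ccontr)
    assume "\<not> ?thesis"
    then have "(1 / c - e1) * (c + \<delta>) \<le> 0"
      using d by (intro mult_nonpos_nonneg) auto
    moreover have "0 < \<delta> / (2 * c)" using d c_pos by simp
    ultimately show False unfolding eq1 by linarith
  qed
  have k1_top: "filterlim k1 at_top sequentially"
    unfolding k1_def using d by real_asymp
  have k2_top: "filterlim k2 at_top sequentially"
    unfolding k2_def using d c_pos by real_asymp
  have "\<forall>\<^sub>F n in sequentially. measure_pmf.prob (replicate_pmf (k1 n) gw)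
      {ts. (1 / c + e2) * real (k1 n) \<le> real (\<Sum>t\<leftarrow>ts. L \<Omega> t)} < e0 / c"
    by (rule order_tendstoD(2)[OF weak_law_L_upper[OF e12(2) k1_top]]) (use e0 c_pos in simp)
  moreover have "\<forall>\<^sub>F n in sequentially. measure_pmf.prob (replicate_pmf (k2 n) gw)
      {ts. real (\<Sum>t\<leftarrow>ts. L \<Omega> t) \<le> (1 / c - e1) * real (k2 n)} < e0 / U_max"
    by (rule order_tendstoD(2)[OF weak_law_L_lower[OF e12(1) k2_top]]) (use e0 U_max_pos in simp)
  moreover have "\<forall>\<^sub>F n in sequentially. (1 - \<delta> / (2 * c)) * real n + (1 / c + e2) \<le> real n - real (j + M)"
    using d c_pos by real_asymp
  moreover have "\<forall>\<^sub>F n in sequentially. real n + real j \<le> (1 + \<delta> / (2 * c)) * real n - (1 / c - e1)"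
    using d c_pos by real_asymp
  moreover have "\<forall>\<^sub>F n in sequentially. j + M \<le> n"
    by (rule eventually_ge_at_top)
  ultimately show ?thesis
  proof eventually_elim
    case (elim n)
    show ?case
    proof (intro allI impI)
      fix m K assume m: "n \<le> m + j \<and> m \<le> n + j"
      have A1: "(\<Sum>k<k1 n. (Q ^ k) $ m) \<le> 2 * e0
          + c * measure_pmf.prob (replicate_pmf (k1 n) gw) {ts. (\<Sum>t\<leftarrow>ts. L \<Omega> t) > m - M}"
        using m elim e0 by (intro early_visits_le M) auto
      have B1: "measure_pmf.prob (replicate_pmf (k1 n) gw) {ts. (\<Sum>t\<leftarrow>ts. L \<Omega> t) > m - M}
          \<le> measure_pmf.prob (replicate_pmf (k1 n) gw)
              {ts. (1 / c + e2) * real (k1 n) \<le> real (\<Sum>t\<leftarrow>ts. L \<Omega> t)}"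
      proof (intro measure_pmf.finite_measure_mono subsetI, unfold mem_Collect_eq)
        fix ts :: "plane_tree list" assume ts: "m - M < (\<Sum>t\<leftarrow>ts. L \<Omega> t)"
        have "real (k1 n) \<le> (c - \<delta>) * real n + 1"
          unfolding k1_def using d by (simp add: of_nat_ceiling)
        then have "(1 / c + e2) * real (k1 n) \<le> (1 / c + e2) * ((c - \<delta>) * real n + 1)"
          using c_pos e12 by (intro mult_left_mono) auto
        also have "\<dots> = (1 / c + e2) * (c - \<delta>) * real n + (1 / c + e2)"
          by (simp only: distrib_left mult_1_right mult.assoc)
        also have "\<dots> \<le> real n - real (j + M)"
          unfolding eq2 by (rule elim)
        also have "\<dots> \<le> real (m - M)"
          using m elim(5) by linarith
        finally show "(1 / c + e2) * real (k1 n) \<le> real (\<Sum>t\<leftarrow>ts. L \<Omega> t)"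
          using ts by linarith
      qed simp
      have early: "(\<Sum>k<k1 n. (Q ^ k) $ m) \<le> 2 * e0 + c * (e0 / c)"
        using A1 mult_left_mono[OF order_trans[OF B1 less_imp_le[OF elim(1)]] less_imp_le[OF c_pos]]
        by linarith
      have A2: "(\<Sum>k\<in>{k2 n..<K}. (Q ^ k) $ m) \<le> U_max * measure_pmf.prob (replicate_pmf (k2 n) gw) {ts. (\<Sum>t\<leftarrow>ts. L \<Omega> t) \<le> m}"
        by (rule late_visits_le)
      have B2: "measure_pmf.prob (replicate_pmf (k2 n) gw) {ts. (\<Sum>t\<leftarrow>ts. L \<Omega> t) \<le> m}
          \<le> measure_pmf.prob (replicate_pmf (k2 n) gw) {ts. real (\<Sum>t\<leftarrow>ts. L \<Omega> t) \<le> (1 / c - e1) * real (k2 n)}"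
      proof (intro measure_pmf.finite_measure_mono subsetI, unfold mem_Collect_eq)
        fix ts :: "plane_tree list" assume ts: "(\<Sum>t\<leftarrow>ts. L \<Omega> t) \<le> m"
        have "real (\<Sum>t\<leftarrow>ts. L \<Omega> t) \<le> real n + real j"
          using ts m by linarith
        also have "\<dots> \<le> (1 / c - e1) * (c + \<delta>) * real n - (1 / c - e1)"
          unfolding eq1 by (rule elim)
        also have "\<dots> = (1 / c - e1) * ((c + \<delta>) * real n - 1)"
          by (simp only: right_diff_distrib mult_1_right mult.assoc)
        also have "\<dots> \<le> (1 / c - e1) * real (k2 n)"
        proof (rule mult_left_mono)
          show "(c + \<delta>) * real n - 1 \<le> real (k2 n)"
            unfolding k2_def by linarith
        qed (use e1_le in simp)
        finally show "real (\<Sum>t\<leftarrow>ts. L \<Omega> t) \<le> (1 / c - e1) * real (k2 n)" .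
      qed simp
      have late: "(\<Sum>k\<in>{k2 n..<K}. (Q ^ k) $ m) \<le> U_max * (e0 / U_max)"
        using A2 mult_left_mono[OF order_trans[OF B2 less_imp_le[OF elim(2)]] less_imp_le[OF U_max_pos]]
        by linarith
      show "(\<Sum>k<nat \<lceil>(c - \<delta>) * real n\<rceil>. (Q ^ k) $ m) + (\<Sum>k\<in>{nat \<lfloor>(c + \<delta>) * real n\<rfloor>..<K}. (Q ^ k) $ m) \<le> e"
        using early late c_pos U_max_pos e unfolding k1_def[symmetric] k2_def[symmetric]
        by (simp add: e0_def)
    qed
  qed
qed

text \<open>The law of the size of an unconditioned tree on the event that its root has at least \<open>D\<close> children.\<close>

definition big :: "nat \<Rightarrow> nat \<Rightarrow> real" where
  "big D m = measure_pmf.prob gw {T. D \<le> length (children T) \<and> L \<Omega> T = m}"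

lemma big_le:
  assumes e: "\<And>k. k \<ge> D \<Longrightarrow> k \<in> \<Omega> \<longleftrightarrow> eventually_in"
    and B: "\<And>K. (\<Sum>k<K. pmf \<xi> k * (of_bool (D \<le> k) * (Q ^ k) $ (m - of_bool eventually_in))) \<le> B"
  shows "big D m \<le> B"
proof -
  have "ennreal (big D m) = (\<integral>\<^sup>+T. indicator {T. D \<le> length (children T) \<and> L \<Omega> T = m} T \<partial>gw)"
    by (simp add: big_def measure_pmf.emeasure_eq_measure)
  also have "\<dots> \<le> (\<integral>\<^sup>+k. ennreal (of_bool (D \<le> k) * (Q ^ k) $ (m - of_bool eventually_in)) \<partial>\<xi>)"
    unfolding nn_integral_gw
  proof (rule nn_integral_mono)
    fix k
    let ?E = "{ts. (\<Sum>t\<leftarrow>ts. L \<Omega> t) = m - of_bool eventually_in}"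
    have "(\<integral>\<^sup>+ts. indicator {T. D \<le> length (children T) \<and> L \<Omega> T = m} (Node ts) \<partial>replicate_pmf k gw)
        \<le> (\<integral>\<^sup>+ts. ennreal (of_bool (D \<le> k)) * indicator ?E ts \<partial>replicate_pmf k gw)"
    proof (rule nn_integral_mono_AE, rule AE_pmfI)
      fix ts assume "ts \<in> set_pmf (replicate_pmf k gw)"
      then have "length ts = k" by (simp add: set_replicate_pmf)
      then show "indicator {T. D \<le> length (children T) \<and> L \<Omega> T = m} (Node ts) \<le> ennreal (of_bool (D \<le> k)) * indicator ?E ts"
        using e[of k] by (auto simp: indicator_def L_Node)
    qed
    also have "\<dots> = ennreal (of_bool (D \<le> k)) * emeasure (replicate_pmf k gw) ?E"
      by (simp add: nn_integral_cmult)
    also have "\<dots> = ennreal (of_bool (D \<le> k) * (Q ^ k) $ (m - of_bool eventually_in))"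
      by (simp add: measure_pmf.emeasure_eq_measure prob_sum_eq)
    finally show "(\<integral>\<^sup>+ts. indicator {T. D \<le> length (children T) \<and> L \<Omega> T = m} (Node ts) \<partial>replicate_pmf k gw)
        \<le> ennreal (of_bool (D \<le> k) * (Q ^ k) $ (m - of_bool eventually_in))" .
  qed
  also have "\<dots> \<le> ennreal B"
    by (rule nn_integral_pmf_nat_le) (auto simp: Q_nonneg B)
  finally have "ennreal (big D m) \<le> ennreal B" .
  moreover have "0 \<le> B" using B[of 0] by simp
  ultimately show ?thesis by (simp add: ennreal_le_iff)
qed

lemma eventually_in_ge: "\<delta> > 0 \<Longrightarrow> \<forall>\<^sub>F n in sequentially. \<forall>k\<ge>nat \<lceil>\<delta> * real n\<rceil>. k \<in> \<Omega> \<longleftrightarrow> eventually_in"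
  using eventually_all_ge_scaled[OF eventually_in, of \<delta>] by (auto elim!: eventually_mono simp: nat_le_iff ceiling_le_iff)

lemma big_bounded:
  assumes d: "\<delta> > 0"
  shows "\<exists>C>0. \<forall>\<^sub>F n in sequentially. \<forall>m. big (nat \<lceil>\<delta> * real n\<rceil>) m \<le> C * jump n"
proof -
  obtain C where C: "C > 0" "\<forall>\<^sub>F n in sequentially. \<forall>d. \<delta> * real n \<le> real d \<longrightarrow> pmf \<xi> d \<le> C * jump n"
    using pmf_le_jump[OF d] by blast
  have "\<forall>\<^sub>F n in sequentially. \<forall>m. big (nat \<lceil>\<delta> * real n\<rceil>) m \<le> C * U_max * jump n"
    using C(2) eventually_in_ge[OF d] jump_pos
  proof eventually_elim
    case (elim n)
    show ?case
    proof (intro allI big_le)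
      fix m K
      have "(\<Sum>k<K. pmf \<xi> k * (of_bool (nat \<lceil>\<delta> * real n\<rceil> \<le> k) * (Q ^ k) $ (m - of_bool eventually_in)))
          \<le> (\<Sum>k<K. (C * jump n) * (Q ^ k) $ (m - of_bool eventually_in))"
        using elim C(1) by (intro sum_mono) (auto simp: Q_nonneg nat_le_iff ceiling_le_iff intro!: mult_right_mono)
      also have "\<dots> = (C * jump n) * (\<Sum>k<K. (Q ^ k) $ (m - of_bool eventually_in))"
        by (simp add: sum_distrib_left)
      also have "\<dots> \<le> (C * jump n) * U_max"
        using sum_power_le_U U_le C(1) elim(3) unfolding U_max_def by (intro mult_left_mono) (auto intro: order_trans)
      finally show "(\<Sum>k<K. pmf \<xi> k * (of_bool (nat \<lceil>\<delta> * real n\<rceil> \<le> k) * (Q ^ k) $ (m - of_bool eventually_in))) \<le> C * U_max * jump n"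
        by (simp add: mult_ac)
    qed (use elim in auto)
  qed
  then show ?thesis
    using C(1) U_max_pos by (intro exI[of _ "C * U_max"]) auto
qed

text \<open>Near \<open>c n\<close> the probabilities of \<open>\<xi>\<close> are nearly constant, and the number of visits is at most
  about \<open>c\<close>. Elsewhere they are bounded by a multiple of \<open>jump n\<close>, and there are few visits.\<close>

lemma big_asymp:
  assumes d: "\<delta> > 0" and e: "e > 0"
  shows "\<forall>\<^sub>F n in sequentially. \<forall>m. n \<le> m + j \<and> m \<le> n + j \<longrightarrow> big (nat \<lceil>\<delta> * real n\<rceil>) m \<le> (c + e) * jump n"
proof -
  obtain C where C: "C > 0" "\<forall>\<^sub>F n in sequentially. \<forall>d. \<delta> * real n \<le> real d \<longrightarrow> pmf \<xi> d \<le> C * jump n"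
    using pmf_le_jump[OF d] by blast
  define w where "w = 2 + c"
  have w: "w > 0" using c_pos by (simp add: w_def)
  define e0 where "e0 = min 1 (e / w / 2)"
  have e0: "e0 > 0" "e0 \<le> 1" using e w by (auto simp: e0_def)
  have "e0 * w \<le> e / w / 2 * w"
    using w by (intro mult_right_mono) (auto simp: e0_def)
  also have "\<dots> = e / 2" using w by simp
  finally have e0_le: "e0 * (2 + c) \<le> e / 2" by (simp only: w_def)
  obtain \<delta>' where d': "0 < \<delta>'" "\<delta>' < c"
    and near: "\<forall>\<^sub>F n in sequentially. \<forall>d. \<bar>real d - c * real n\<bar> \<le> \<delta>' * real n \<longrightarrow>
      (1 - e0) * jump n \<le> pmf \<xi> d \<and> pmf \<xi> d \<le> (1 + e0) * jump n"
    using pmf_near_jump[OF e0(1)] by blast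
  have U_le: "\<forall>\<^sub>F n in sequentially. \<forall>m\<ge>n. U $ m \<le> c + e0"
  proof -
    have "\<forall>\<^sub>F n in sequentially. U $ n < c + e0"
      by (rule order_tendstoD(2)[OF U_lim]) (use e0 in simp)
    then obtain N where N: "\<And>n. n \<ge> N \<Longrightarrow> U $ n < c + e0"
      by (auto simp: eventually_sequentially)
    show ?thesis
      using eventually_ge_at_top[of N] by eventually_elim (meson N less_imp_le order_trans)
  qed
  have U_le': "\<forall>\<^sub>F n in sequentially. \<forall>m. n \<le> m + (j + 1) \<longrightarrow> U $ m \<le> c + e0"
    using eventually_compose_filterlim[OF U_le filterlim_minus_const_nat_at_top[of "j + 1"]]
    by eventually_elim auto
  have "\<forall>\<^sub>F n in sequentially. \<forall>m K. n \<le> m + (j + 1) \<and> m \<le> n + (j + 1) \<longrightarrow>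
    (\<Sum>k<nat \<lceil>(c - \<delta>') * real n\<rceil>. (Q ^ k) $ m) + (\<Sum>k\<in>{nat \<lfloor>(c + \<delta>') * real n\<rfloor>..<K}. (Q ^ k) $ m) \<le> e / (2 * C)"
    using d' e C(1) by (intro visits_off_window) auto
  then show ?thesis
    using C(2) near U_le' eventually_in_ge[OF d] jump_pos
  proof eventually_elim
    case (elim n)
    show ?case
    proof (intro allI impI big_le)
      fix m K assume "n \<le> m + j \<and> m \<le> n + j"
      define m' where "m' = m - of_bool eventually_in"
      have m': "n \<le> m' + (j + 1)" "m' \<le> n + (j + 1)"
        using \<open>n \<le> m + j \<and> m \<le> n + j\<close> by (auto simp: m'_def of_bool_def)
      define k1 k2 where "k1 = nat \<lceil>(c - \<delta>') * real n\<rceil>" and "k2 = nat \<lfloor>(c + \<delta>') * real n\<rfloor>"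
      define D where "D = nat \<lceil>\<delta> * real n\<rceil>"
      have summand: "pmf \<xi> k * (of_bool (D \<le> k) * (Q ^ k) $ m')
          \<le> (1 + e0) * jump n * (Q ^ k) $ m' + C * jump n * (of_bool (k < k1) * (Q ^ k) $ m')
            + C * jump n * (of_bool (k2 \<le> k) * (Q ^ k) $ m')" for k
      proof (cases "D \<le> k")
        case True
        then have k: "\<delta> * real n \<le> real k"
          unfolding D_def by linarith
        have nn: "0 \<le> C * jump n" "0 \<le> (1 + e0) * jump n"
          using C(1) elim(6) e0 by auto
        have "pmf \<xi> k \<le> (1 + e0) * jump n + C * jump n * of_bool (k < k1) + C * jump n * of_bool (k2 \<le> k)"
        proof (cases "\<bar>real k - c * real n\<bar> \<le> \<delta>' * real n")
          case True
          then have "pmf \<xi> k \<le> (1 + e0) * jump n" using elim(3) by blast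
          then show ?thesis
            using nn by (cases "k < k1"; cases "k2 \<le> k"; simp; linarith)
        next
          case False
          then have "real k < (c - \<delta>') * real n \<or> (c + \<delta>') * real n < real k"
            by (auto simp: algebra_simps abs_le_iff)
          then have "k < k1 \<or> k2 \<le> k"
          proof
            assume "real k < (c - \<delta>') * real n"
            then show ?thesis unfolding k1_def by linarith
          next
            assume "(c + \<delta>') * real n < real k"
            then show ?thesis unfolding k2_def by linarith
          qed
          moreover have "pmf \<xi> k \<le> C * jump n" using elim(2) k by blast
          ultimately show ?thesis
            using nn by (cases "k < k1"; cases "k2 \<le> k"; simp; linarith)
        qed
        then have "pmf \<xi> k * (Q ^ k) $ m' \<le> ((1 + e0) * jump n + C * jump n * of_bool (k < k1) + C * jump n * of_bool (k2 \<le> k)) * (Q ^ k) $ m'"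
          by (intro mult_right_mono Q_nonneg)
        then show ?thesis
          using True by (simp add: distrib_right mult.assoc)
      next
        case False
        then show ?thesis
          using C(1) elim(6) e0 by (auto intro!: add_nonneg_nonneg mult_nonneg_nonneg Q_nonneg)
      qed
      have "(\<Sum>k<K. pmf \<xi> k * (of_bool (D \<le> k) * (Q ^ k) $ m'))
          \<le> (\<Sum>k<K. (1 + e0) * jump n * (Q ^ k) $ m' + C * jump n * (of_bool (k < k1) * (Q ^ k) $ m')
            + C * jump n * (of_bool (k2 \<le> k) * (Q ^ k) $ m'))"
        by (intro sum_mono summand)
      also have "\<dots> = (1 + e0) * jump n * (\<Sum>k<K. (Q ^ k) $ m')
          + C * jump n * ((\<Sum>k<K. of_bool (k < k1) * (Q ^ k) $ m') + (\<Sum>k<K. of_bool (k2 \<le> k) * (Q ^ k) $ m'))"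
        by (simp only: sum.distrib sum_distrib_left[symmetric] distrib_left add.assoc)
      also have "\<dots> \<le> (1 + e0) * jump n * (c + e0) + C * jump n * (e / (2 * C))"
      proof (intro add_mono mult_left_mono)
        show "(\<Sum>k<K. (Q ^ k) $ m') \<le> c + e0"
          using sum_power_le_U[of m' K] elim(4) m' by force
        have "(\<Sum>k<K. of_bool (k < k1) * (Q ^ k) $ m') = (\<Sum>k\<in>{..<K} \<inter> {..<k1}. (Q ^ k) $ m')"
          by (intro sum.mono_neutral_cong_right) auto
        also have "\<dots> \<le> (\<Sum>k<k1. (Q ^ k) $ m')"
          by (intro sum_mono2) (auto simp: Q_nonneg)
        finally have "(\<Sum>k<K. of_bool (k < k1) * (Q ^ k) $ m') \<le> (\<Sum>k<k1. (Q ^ k) $ m')" .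
        moreover have "(\<Sum>k<K. of_bool (k2 \<le> k) * (Q ^ k) $ m') = (\<Sum>k\<in>{k2..<K}. (Q ^ k) $ m')"
          by (intro sum.mono_neutral_cong_right) auto
        ultimately show "(\<Sum>k<K. of_bool (k < k1) * (Q ^ k) $ m') + (\<Sum>k<K. of_bool (k2 \<le> k) * (Q ^ k) $ m') \<le> e / (2 * C)"
          using elim(1)[rule_format, of m' K] m' unfolding k1_def k2_def by linarith
      qed (use C(1) elim(6) e0 in auto)
      also have "\<dots> = ((1 + e0) * (c + e0) + e / 2) * jump n"
        using C(1) by (simp add: field_simps)
      also have "\<dots> \<le> (c + e) * jump n"
      proof (rule mult_right_mono)
        have "e0 * e0 \<le> e0 * 1" using e0 by (intro mult_left_mono) auto
        then show "(1 + e0) * (c + e0) + e / 2 \<le> c + e"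
          using e0_le by (simp add: algebra_simps)
      qed (use elim in simp)
      finally show "(\<Sum>k<K. pmf \<xi> k * (of_bool (nat \<lceil>\<delta> * real n\<rceil> \<le> k) * (Q ^ k) $ (m - of_bool eventually_in))) \<le> (c + e) * jump n"
        by (simp add: D_def m'_def)
    qed (use elim in auto)
  qed
qed

text \<open>One big jump. The marked tree that remains after cutting has a law that does not depend on \<open>n\<close>, so up to a
  small probability it shifts the size of the fringe subtree by a bounded amount only.\<close>

lemma prob_L_upper:
  assumes e: "e > 0"
  shows "\<forall>\<^sub>F n in sequentially. measure_pmf.prob gw {T. L \<Omega> T = n} * (1 - mean \<xi>) \<le> (c + e) * jump n"
proof -
  obtain \<delta> where d: "\<delta> > 0" and no_big: "\<forall>\<^sub>F n in sequentially.
    measure_pmf.prob gw {T. L \<Omega> T = n \<and> L {nat \<lceil>\<delta> * real n\<rceil>..} T = 0} \<le> 2 * real n powr (- (3 + \<alpha>))"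
    using no_big_jump by blast
  obtain C where C: "C > 0" "\<forall>\<^sub>F n in sequentially. \<forall>m. big (nat \<lceil>\<delta> * real n\<rceil>) m \<le> C * jump n"
    using big_bounded[OF d] by blast
  have "(\<lambda>I. measure_pmf.prob gw_bullet {x. I < L \<Omega> (fst x)}) \<longlonglongrightarrow> measure_pmf.prob gw_bullet (\<Inter>I. {x. I < L \<Omega> (fst x)})"
    by (rule measure_pmf.finite_Lim_measure_decseq) (auto simp: decseq_def)
  moreover have "(\<Inter>I. {x :: marked_tree. I < L \<Omega> (fst x)}) = {}"
    by auto
  ultimately have "\<forall>\<^sub>F I in sequentially. measure_pmf.prob gw_bullet {x. I < L \<Omega> (fst x)} < e / (4 * C)"
    by (intro order_tendstoD(2)) (use e C in auto)
  then obtain I where I: "measure_pmf.prob gw_bullet {x. I < L \<Omega> (fst x)} < e / (4 * C)"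
    by (auto simp: eventually_sequentially)
  have "\<forall>\<^sub>F n in sequentially. real n powr (- (3 + \<alpha>)) \<le> e / 8 * jump n"
    using e by (intro powr_le_jump) auto
  moreover have "\<forall>\<^sub>F n in sequentially. \<forall>m. n \<le> m + (I + 1) \<and> m \<le> n + (I + 1) \<longrightarrow>
      big (nat \<lceil>\<delta> * real n\<rceil>) m \<le> (c + e / 4) * jump n"
    using e d by (intro big_asymp) auto
  ultimately show ?thesis
    using no_big C(2) jump_pos eventually_ge_at_top[of I]
  proof eventually_elim
    case (elim n)
    define D where "D = nat \<lceil>\<delta> * real n\<rceil>"
    define z0 where "z0 = (of_bool (0 \<in> \<Omega>) :: nat)"
    define B where "B = {(x :: marked_tree, T). D \<le> length (children T) \<and> L \<Omega> (fst x) + L \<Omega> T = n + z0}"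
    have "measure_pmf.prob gw {T. L \<Omega> T = n}
        \<le> measure_pmf.prob gw ({T. L \<Omega> T = n \<and> L {D..} T = 0} \<union> {T. L \<Omega> T = n \<and> D \<le> max_outdegree T})"
      using L_eq_0_of_max_outdegree[of _ D] by (intro measure_pmf.finite_measure_mono) (auto simp: not_less)
    also have "\<dots> \<le> measure_pmf.prob gw {T. L \<Omega> T = n \<and> L {D..} T = 0}
        + measure_pmf.prob gw {T. L \<Omega> T = n \<and> D \<le> max_outdegree T}"
      by (rule measure_Un_le) auto
    finally have "measure_pmf.prob gw {T. L \<Omega> T = n} * (1 - mean \<xi>)
        \<le> (measure_pmf.prob gw {T. L \<Omega> T = n \<and> L {D..} T = 0}
        + measure_pmf.prob gw {T. L \<Omega> T = n \<and> D \<le> max_outdegree T}) * (1 - mean \<xi>)"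
      using sub by (intro mult_right_mono) auto
    also have "\<dots> \<le> measure_pmf.prob gw {T. L \<Omega> T = n \<and> L {D..} T = 0} * 1
        + measure_pmf.prob (pair_pmf gw_bullet gw) B"
      unfolding distrib_right
    proof (intro add_mono mult_left_mono prob_gw_le_pair)
      fix T assume "T \<in> {T. L \<Omega> T = n \<and> D \<le> max_outdegree T}"
      then show "(F0 T, Node (Fs T)) \<in> B"
        using L_decompose[of \<Omega> T] by (simp add: B_def length_Fs z0_def)
    qed (use mean_nonneg in auto)
    also have "measure_pmf.prob (pair_pmf gw_bullet gw) B \<le> (c + e / 2) * jump n"
    proof -
      have "ennreal (measure_pmf.prob (pair_pmf gw_bullet gw) B) = (\<integral>\<^sup>+z. indicator B z \<partial>pair_pmf gw_bullet gw)"
        by (simp add: measure_pmf.emeasure_eq_measure)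
      also have "\<dots> = (\<integral>\<^sup>+x. \<integral>\<^sup>+T. indicator B (x, T) \<partial>gw \<partial>gw_bullet)"
        by (rule nn_integral_pair_pmf')
      also have "\<dots> \<le> (\<integral>\<^sup>+x. ennreal ((c + e / 4) * jump n) + ennreal (C * jump n) * indicator {x. I < L \<Omega> (fst x)} x \<partial>gw_bullet)"
      proof (rule nn_integral_mono)
        fix x :: marked_tree
        have "(\<integral>\<^sup>+T. indicator B (x, T) \<partial>gw)
            \<le> (\<integral>\<^sup>+T. indicator {T. D \<le> length (children T) \<and> L \<Omega> T = n + z0 - L \<Omega> (fst x)} T \<partial>gw)"
          by (intro nn_integral_mono) (auto simp: B_def indicator_def)
        also have "\<dots> = ennreal (big D (n + z0 - L \<Omega> (fst x)))"
          by (simp add: big_def measure_pmf.emeasure_eq_measure)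
        also have "\<dots> \<le> ennreal ((c + e / 4) * jump n) + ennreal (C * jump n) * indicator {x. I < L \<Omega> (fst x)} x"
        proof (cases "I < L \<Omega> (fst x)")
          case True
          then show ?thesis
            using elim(4) by (auto simp: D_def intro!: add_increasing ennreal_leI)
        next
          case False
          then have "n \<le> n + z0 - L \<Omega> (fst x) + (I + 1)" "n + z0 - L \<Omega> (fst x) \<le> n + (I + 1)"
            by (auto simp: z0_def of_bool_def)
          then show ?thesis
            using elim(2) False by (auto simp: D_def intro!: ennreal_leI)
        qed
        finally show "(\<integral>\<^sup>+T. indicator B (x, T) \<partial>gw)
            \<le> ennreal ((c + e / 4) * jump n) + ennreal (C * jump n) * indicator {x. I < L \<Omega> (fst x)} x" .
      qed
      also have "\<dots> = ennreal ((c + e / 4) * jump n) + ennreal (C * jump n) * ennreal (measure_pmf.prob gw_bullet {x. I < L \<Omega> (fst x)})"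
        by (simp add: nn_integral_add nn_integral_cmult measure_pmf.emeasure_eq_measure)
      also have "\<dots> = ennreal ((c + e / 4) * jump n + C * jump n * measure_pmf.prob gw_bullet {x. I < L \<Omega> (fst x)})"
        using C(1) c_pos e elim(5) by (simp add: ennreal_plus ennreal_mult)
      also have "\<dots> \<le> ennreal ((c + e / 4) * jump n + C * jump n * (e / (4 * C)))"
        using C(1) I elim(5) by (intro ennreal_leI add_left_mono mult_left_mono) auto
      also have "(c + e / 4) * jump n + C * jump n * (e / (4 * C)) = (c + e / 2) * jump n"
        using C(1) by (simp add: field_simps)
      finally show ?thesis
        using c_pos e elim(5) by (simp add: ennreal_le_iff)
    qed
    also have "measure_pmf.prob gw {T. L \<Omega> T = n \<and> L {D..} T = 0} * 1 \<le> e / 4 * jump n"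
      using elim(1,3) by (simp add: D_def)
    finally show ?case
      using mult_pos_pos[OF e elim(5)] by (simp add: algebra_simps)
  qed
qed

end

section \<open>The likelihood ratio\<close>

context heavy_tailed
begin

text \<open>Sizes of trees all of whose outdegrees are below \<open>D\<close>.\<close>

definition small_fps :: "nat \<Rightarrow> real fps" where
  "small_fps D = Abs_fps (\<lambda>j. measure_pmf.prob gw {T. L \<Omega> T = j \<and> L {D..} T = 0})"

lemma small_fps_power:
  "(small_fps D ^ k) $ m = measure_pmf.prob (replicate_pmf k gw)
    {us. (\<Sum>u\<leftarrow>us. L \<Omega> u) = m \<and> (\<forall>u\<in>set us. L {D..} u = 0)}"
  using renewal_pmf_sum[of k gw "L \<Omega>" m "{T. L {D..} T = 0}"] by (simp add: small_fps_def)

text \<open>Attach \<open>ts\<close> followed by any \<open>k\<close> trees with the right total size to the marked leaf. As long as no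
  other outdegree reaches \<open>D\<close>, this vertex is the one that \<open>F0\<close> and \<open>Fs\<close> single out, and different
  choices give different trees.\<close>

lemma prob_decomposed_ge:
  fixes S v ts
  assumes leaf: "marked_leaf S v" and D: "length ts = D" "0 < D"
    and S: "L {D..} S = 0" and ts: "\<And>t. t \<in> set ts \<Longrightarrow> L {D..} t = 0"
    and e: "\<And>k. k \<ge> D \<Longrightarrow> k \<in> \<Omega> \<longleftrightarrow> eventually_in"
    and m: "L \<Omega> S + of_bool eventually_in + (\<Sum>t\<leftarrow>ts. L \<Omega> t) + m = n + of_bool (0 \<in> \<Omega>)"
  shows "pmf gw_bullet (S, v) * prod_list (map (pmf gw) ts) * (\<Sum>k<K. pmf \<xi> (D + k) * (small_fps D ^ k) $ m)
    \<le> (1 - mean \<xi>) * measure_pmf.prob gw {T. L \<Omega> T = n \<and> F0 T = (S, v) \<and> take D (Fs T) = ts}"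
proof -
  define E where "E k = {us. length us = k \<and> (\<Sum>u\<leftarrow>us. L \<Omega> u) = m \<and> (\<forall>u\<in>set us. L {D..} u = 0)}" for k
  define G where "G us = graft v (ts @ us) S" for us
  have G: "F0 (G us) = (S, v)" "Fs (G us) = ts @ us" "L \<Omega> (G us) = n" if "us \<in> E k" for us k
  proof -
    show "F0 (G us) = (S, v)" "Fs (G us) = ts @ us"
      unfolding G_def using that ts D by (auto simp: E_def intro!: F0_Fs_of_graft[OF leaf S])
    have "L \<Omega> (G us) + of_bool (0 \<in> \<Omega>) = L \<Omega> S + of_bool eventually_in + ((\<Sum>t\<leftarrow>ts. L \<Omega> t) + m)"
      using L_graft[OF leaf, of \<Omega> "ts @ us"] that e[of "D + k"] D by (simp add: G_def E_def)
    then show "L \<Omega> (G us) = n" using m by simp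
  qed
  have inj: "inj_on G (E k)" for k
    by (rule inj_onI) (metis G(2) append_eq_append_conv same_append_eq)
  have GE: "(1 - mean \<xi>) * measure_pmf.prob gw (G ` E k)
      = pmf gw_bullet (S, v) * prod_list (map (pmf gw) ts) * (pmf \<xi> (D + k) * (small_fps D ^ k) $ m)" for k
  proof -
    define w where "w = pmf gw_bullet (S, v) * prod_list (map (pmf gw) ts) * pmf \<xi> (D + k)"
    have w: "0 \<le> w"
      unfolding w_def by (intro mult_nonneg_nonneg prod_list_nonneg) auto
    have weight: "(1 - mean \<xi>) * pmf gw (G us) = w * pmf (replicate_pmf k gw) us" if "us \<in> E k" for us
      using pmf_graft_decompose[OF leaf, of "ts @ us"] that D
      by (simp add: G_def E_def w_def pmf_gw pmf_replicate_pmf mult_ac)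
    have "ennreal ((1 - mean \<xi>) * measure_pmf.prob gw (G ` E k))
        = ennreal (1 - mean \<xi>) * (\<integral>\<^sup>+T. ennreal (pmf gw T) \<partial>count_space (G ` E k))"
      using sub by (simp add: nn_integral_pmf measure_pmf.emeasure_eq_measure ennreal_mult)
    also have "(\<integral>\<^sup>+T. ennreal (pmf gw T) \<partial>count_space (G ` E k)) = (\<integral>\<^sup>+us. ennreal (pmf gw (G us)) \<partial>count_space (E k))"
      by (rule nn_integral_bij_count_space[symmetric]) (rule inj_on_imp_bij_betw[OF inj])
    also have "ennreal (1 - mean \<xi>) * \<dots> = (\<integral>\<^sup>+us. ennreal ((1 - mean \<xi>) * pmf gw (G us)) \<partial>count_space (E k))"
      using sub by (simp add: nn_integral_cmult[symmetric] ennreal_mult)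
    also have "\<dots> = (\<integral>\<^sup>+us. ennreal w * ennreal (pmf (replicate_pmf k gw) us) \<partial>count_space (E k))"
      using w by (intro nn_integral_cong) (simp add: weight ennreal_mult)
    also have "\<dots> = ennreal w * emeasure (replicate_pmf k gw) (E k)"
      by (simp add: nn_integral_cmult nn_integral_pmf)
    also have "emeasure (replicate_pmf k gw) (E k)
        = emeasure (replicate_pmf k gw) {us. (\<Sum>u\<leftarrow>us. L \<Omega> u) = m \<and> (\<forall>u\<in>set us. L {D..} u = 0)}"
      by (rule emeasure_eq_AE) (auto simp: E_def set_replicate_pmf intro!: AE_pmfI)
    also have "\<dots> = ennreal ((small_fps D ^ k) $ m)"
      by (simp add: small_fps_power measure_pmf.emeasure_eq_measure)
    also have "ennreal w * \<dots> = ennreal (w * (small_fps D ^ k) $ m)"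
      using w by (simp add: ennreal_mult small_fps_power)
    finally have "ennreal ((1 - mean \<xi>) * measure_pmf.prob gw (G ` E k)) = ennreal (w * (small_fps D ^ k) $ m)" .
    moreover have "0 \<le> w * (small_fps D ^ k) $ m" "0 \<le> (1 - mean \<xi>) * measure_pmf.prob gw (G ` E k)"
      using w sub by (auto simp: small_fps_power)
    ultimately have "(1 - mean \<xi>) * measure_pmf.prob gw (G ` E k) = w * (small_fps D ^ k) $ m"
      by (simp only: ennreal_inj)
    then show ?thesis by (simp add: w_def mult_ac)
  qed
  have "pmf gw_bullet (S, v) * prod_list (map (pmf gw) ts) * (\<Sum>k<K. pmf \<xi> (D + k) * (small_fps D ^ k) $ m)
      = (\<Sum>k<K. (1 - mean \<xi>) * measure_pmf.prob gw (G ` E k))"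
    by (simp only: GE sum_distrib_left)
  also have "\<dots> = (1 - mean \<xi>) * measure_pmf.prob gw (\<Union>k<K. G ` E k)"
    unfolding sum_distrib_left[symmetric]
  proof (subst measure_pmf.finite_measure_finite_Union)
    show "disjoint_family_on (\<lambda>k. G ` E k) {..<K}"
      unfolding disjoint_family_on_def
    proof (intro ballI impI, rule ccontr)
      fix k k' assume kk: "k \<noteq> k'" "G ` E k \<inter> G ` E k' \<noteq> {}"
      then obtain us us' where us: "us \<in> E k" "us' \<in> E k'" "G us = G us'" by auto
      then have "length (ts @ us) = length (ts @ us')"
        using G(2) by metis
      then show False using us kk by (simp add: E_def)
    qed
  qed auto
  also have "\<dots> \<le> (1 - mean \<xi>) * measure_pmf.prob gw {T. L \<Omega> T = n \<and> F0 T = (S, v) \<and> take D (Fs T) = ts}"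
    using sub D by (intro mult_left_mono measure_pmf.finite_measure_mono) (auto simp: G)
  finally show ?thesis .
qed

lemma small_visits_ge:
  assumes D: "\<And>k. k < K \<Longrightarrow> w \<le> pmf \<xi> (D + k)" and w: "0 \<le> w"
  shows "w * (U $ m - U_max * measure_pmf.prob (replicate_pmf K gw) {ts. (\<Sum>t\<leftarrow>ts. L \<Omega> t) \<le> m}
      - U_max * (real K * (measure_pmf.prob \<xi> {D..} / (1 - mean \<xi>))))
    \<le> (\<Sum>k<K. pmf \<xi> (D + k) * (small_fps D ^ k) $ m)"
proof -
  define s where "s = measure_pmf.prob \<xi> {D..} / (1 - mean \<xi>)"
  have diff: "(\<Sum>k<K. (Q ^ k) $ m - (small_fps D ^ k) $ m) \<le> real K * s / (1 - q 0)"
  proof (rule sum_power_diff_le)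
    show "0 \<le> small_fps D $ j" for j by (simp add: small_fps_def)
    show "small_fps D $ j \<le> q j" for j
      unfolding small_fps_def q_def fps_nth_Abs_fps by (intro measure_pmf.finite_measure_mono) auto
    fix m
    have "q j - small_fps D $ j = measure_pmf.prob gw {T. L \<Omega> T = j \<and> L {D..} T \<noteq> 0}" for j
    proof -
      have "q j - small_fps D $ j = measure_pmf.prob gw ({T. L \<Omega> T = j} - {T. L \<Omega> T = j \<and> L {D..} T = 0})"
        unfolding small_fps_def q_def fps_nth_Abs_fps
        by (rule measure_pmf.finite_measure_Diff[symmetric]) auto
      also have "{T. L \<Omega> T = j} - {T. L \<Omega> T = j \<and> L {D..} T = 0} = {T. L \<Omega> T = j \<and> L {D..} T \<noteq> 0}"
        by auto
      finally show ?thesis .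
    qed
    then have "(\<Sum>j\<le>m. q j - small_fps D $ j) = measure_pmf.prob gw {T. L \<Omega> T \<le> m \<and> L {D..} T \<noteq> 0}"
      by (simp add: sum_eq_prob_le)
    also have "\<dots> \<le> measure_pmf.prob gw {T. L {D..} T \<noteq> 0}"
      by (intro measure_pmf.finite_measure_mono) auto
    also have "\<dots> \<le> s"
      unfolding s_def by (rule prob_L_pos_le)
    finally show "(\<Sum>j\<le>m. q j - small_fps D $ j) \<le> s" .
  qed
  have "U $ m - U_max * measure_pmf.prob (replicate_pmf K gw) {ts. (\<Sum>t\<leftarrow>ts. L \<Omega> t) \<le> m} \<le> (\<Sum>k<K. (Q ^ k) $ m)"
    using U_tail[of m K] sum_power_tail_le[of K m] by (simp add: sum_power_eq U_max_def)
  then have "U $ m - U_max * measure_pmf.prob (replicate_pmf K gw) {ts. (\<Sum>t\<leftarrow>ts. L \<Omega> t) \<le> m} - U_max * (real K * s)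
      \<le> (\<Sum>k<K. (small_fps D ^ k) $ m)"
    using diff by (simp add: sum_subtractf U_max_def)
  then have "w * (U $ m - U_max * measure_pmf.prob (replicate_pmf K gw) {ts. (\<Sum>t\<leftarrow>ts. L \<Omega> t) \<le> m} - U_max * (real K * s))
      \<le> w * (\<Sum>k<K. (small_fps D ^ k) $ m)"
    by (rule mult_left_mono[OF _ w])
  also have "\<dots> \<le> (\<Sum>k<K. pmf \<xi> (D + k) * (small_fps D ^ k) $ m)"
    unfolding sum_distrib_left by (intro sum_mono mult_right_mono D) (auto simp: small_fps_power)
  finally show ?thesis by (simp add: s_def)
qed

end

lemma measure_cond_spmf_of_pmf:
  "measure (measure_spmf (cond_spmf (spmf_of_pmf p) A)) B * measure_pmf.prob p A = measure_pmf.prob p (A \<inter> B)"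
proof (cases "measure_pmf.prob p A = 0")
  case True
  moreover have "measure_pmf.prob p (A \<inter> B) \<le> measure_pmf.prob p A"
    by (intro measure_pmf.finite_measure_mono) auto
  ultimately show ?thesis
    using measure_nonneg[of "measure_pmf p" "A \<inter> B"] by simp
next
  case False
  then have pos: "0 < measure_pmf.prob p A" by (simp add: zero_less_measure_iff)
  have "ennreal (measure (measure_spmf (cond_spmf (spmf_of_pmf p) A)) B * measure_pmf.prob p A)
      = (\<integral>\<^sup>+x. ennreal (spmf (cond_spmf (spmf_of_pmf p) A) x) \<partial>count_space B) * ennreal (measure_pmf.prob p A)"
    by (simp add: nn_integral_spmf measure_spmf.emeasure_eq_measure ennreal_mult del: spmf_cond_spmf)
  also have "\<dots> = (\<integral>\<^sup>+x. ennreal (pmf p x) * indicator A x \<partial>count_space B)"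
    unfolding nn_integral_multc[OF borel_measurable_count_space, symmetric]
    using pos by (intro nn_integral_cong) (auto simp: ennreal_mult[symmetric] indicator_def)
  also have "\<dots> = (\<integral>\<^sup>+x. ennreal (pmf p x) \<partial>count_space (A \<inter> B))"
    by (subst nn_integral_count_space_indicator[of B], simp, subst nn_integral_count_space_indicator[of "A \<inter> B"])
      (auto intro!: nn_integral_cong simp: indicator_def)
  also have "\<dots> = ennreal (measure_pmf.prob p (A \<inter> B))"
    by (simp add: nn_integral_pmf measure_pmf.emeasure_eq_measure)
  finally show ?thesis
    by (subst (asm) ennreal_inj) auto
qed

lemma pair_spmf_of_pmf: "pair_spmf (spmf_of_pmf p) (spmf_of_pmf q) = spmf_of_pmf (pair_pmf p q)"
  by (rule spmf_eqI) (auto simp: pmf_pair split_paired_all)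

section \<open>Typical prefixes\<close>

text \<open>A one-sided comparison suffices, since excess mass of \<open>P\<close> on some event is a deficit on the complement.\<close>

lemma tv_dist_le:
  fixes P Q :: "'a spmf"
  assumes Q: "lossless_spmf Q" and e: "0 \<le> e"
    and G: "measure (measure_spmf Q) (- G) \<le> d"
    and le: "\<And>x. x \<in> G \<Longrightarrow> (1 - e) * spmf Q x \<le> spmf P x"
  shows "tv_dist (measure_spmf P) (measure_spmf Q) \<le> e + d"
proof -
  have one: "measure (measure_spmf Q) A - measure (measure_spmf P) A \<le> e + d" for A
  proof -
    have le': "(1 - e) * measure (measure_spmf Q) (A \<inter> G) \<le> measure (measure_spmf P) (A \<inter> G)"
    proof (cases "e \<le> 1")
      case True
      have "ennreal ((1 - e) * measure (measure_spmf Q) (A \<inter> G))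
          = ennreal (1 - e) * (\<integral>\<^sup>+x. ennreal (spmf Q x) \<partial>count_space (A \<inter> G))"
        using True by (simp add: nn_integral_spmf measure_spmf.emeasure_eq_measure ennreal_mult)
      also have "\<dots> = (\<integral>\<^sup>+x. ennreal ((1 - e) * spmf Q x) \<partial>count_space (A \<inter> G))"
        using True by (simp add: nn_integral_cmult[symmetric] ennreal_mult)
      also have "\<dots> \<le> (\<integral>\<^sup>+x. ennreal (spmf P x) \<partial>count_space (A \<inter> G))"
        by (intro nn_integral_mono ennreal_leI le) auto
      also have "\<dots> = ennreal (measure (measure_spmf P) (A \<inter> G))"
        by (simp add: nn_integral_spmf measure_spmf.emeasure_eq_measure)
      finally show ?thesis by (simp add: ennreal_le_iff)
    next
      case False
      then have "(1 - e) * measure (measure_spmf Q) (A \<inter> G) \<le> 0"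
        by (intro mult_nonpos_nonneg) auto
      then show ?thesis
        using measure_nonneg[of "measure_spmf P" "A \<inter> G"] by linarith
    qed
    have "measure (measure_spmf Q) A \<le> measure (measure_spmf Q) ((A \<inter> G) \<union> (- G))"
      by (intro measure_spmf.finite_measure_mono) auto
    also have "\<dots> \<le> measure (measure_spmf Q) (A \<inter> G) + measure (measure_spmf Q) (- G)"
      by (rule measure_Un_le) auto
    finally have "measure (measure_spmf Q) A \<le> measure (measure_spmf Q) (A \<inter> G) + d"
      using G by linarith
    moreover have "measure (measure_spmf P) (A \<inter> G) \<le> measure (measure_spmf P) A"
      by (intro measure_spmf.finite_measure_mono) auto
    moreover have "e * measure (measure_spmf Q) (A \<inter> G) \<le> e * 1"
      using e by (intro mult_left_mono measure_spmf.subprob_measure_le_1) auto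
    ultimately show ?thesis
      using le' by (simp add: left_diff_distrib)
  qed
  have compl: "measure (measure_spmf R) (- A) = weight_spmf R - measure (measure_spmf R) A" for R :: "'a spmf" and A
    using measure_spmf.finite_measure_compl[of A R]
    by (simp add: weight_spmf_def Compl_eq_Diff_UNIV space_measure_spmf)
  have two: "measure (measure_spmf P) A - measure (measure_spmf Q) A \<le> e + d" for A
    using one[of "- A"] Q weight_spmf_le_1[of P] by (simp add: compl lossless_spmf_def)
  show ?thesis
    unfolding tv_dist_def
    by (rule cSUP_least) (use one two in \<open>auto simp: abs_le_iff\<close>)
qed

lemma tv_dist_nonneg:
  fixes P Q :: "'a spmf"
  shows "0 \<le> tv_dist (measure_spmf P) (measure_spmf Q)"
proof -
  have "\<bar>measure (measure_spmf P) {} - measure (measure_spmf Q) {}\<bar> \<le> tv_dist (measure_spmf P) (measure_spmf Q)"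
    unfolding tv_dist_def
  proof (rule cSUP_upper)
    have "\<bar>measure (measure_spmf P) A - measure (measure_spmf Q) A\<bar> \<le> 1" for A
      using measure_spmf.subprob_measure_le_1[of P A] measure_spmf.subprob_measure_le_1[of Q A]
        measure_nonneg[of "measure_spmf P" A] measure_nonneg[of "measure_spmf Q" A] by linarith
    then show "bdd_above ((\<lambda>A. \<bar>measure (measure_spmf P) A - measure (measure_spmf Q) A\<bar>) ` sets (measure_spmf P))"
      by (intro bdd_aboveI2[where M = 1]) auto
  qed auto
  then show ?thesis by simp
qed

text \<open>The product of \<open>n\<close> and the probability is at most the expectation of \<open>X\<close> over the event \<open>X \<ge> n\<close>,
  which tends to zero by dominated convergence.\<close>

lemma prob_ge_tail:
  assumes "integrable (measure_pmf p) (\<lambda>x. real (X x))"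
  shows "(\<lambda>n. real n * measure_pmf.prob p {x. X x \<ge> n}) \<longlonglongrightarrow> 0"
proof -
  have "(\<lambda>n. \<integral>x. real (X x) * indicator {x. X x \<ge> n} x \<partial>p) \<longlonglongrightarrow> (\<integral>x. 0 \<partial>measure_pmf p)"
  proof (rule integral_dominated_convergence[where w = "\<lambda>x. real (X x)"])
    show "AE x in measure_pmf p. (\<lambda>n. real (X x) * indicator {x. X x \<ge> n} x) \<longlonglongrightarrow> 0"
    proof (rule AE_I2, rule tendsto_eventually)
      fix x
      show "\<forall>\<^sub>F n in sequentially. real (X x) * indicator {x. X x \<ge> n} x = 0"
        using eventually_gt_at_top[of "X x"] by eventually_elim auto
    qed
  qed (use assms in \<open>auto simp: indicator_def\<close>)
  then have lim: "(\<lambda>n. \<integral>x. real (X x) * indicator {x. X x \<ge> n} x \<partial>p) \<longlonglongrightarrow> 0"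
    by simp
  have "real n * measure_pmf.prob p {x. X x \<ge> n} \<le> (\<integral>x. real (X x) * indicator {x. X x \<ge> n} x \<partial>p)" for n
  proof -
    have "real n * measure_pmf.prob p {x. X x \<ge> n} = (\<integral>x. real n * indicator {x. X x \<ge> n} x \<partial>p)"
      by simp
    also have "\<dots> \<le> (\<integral>x. real (X x) * indicator {x. X x \<ge> n} x \<partial>p)"
    proof (rule integral_mono)
      show "integrable (measure_pmf p) (\<lambda>x. real n * indicator {x. X x \<ge> n} x)"
        by (intro measure_pmf.integrable_const_bound[where B = "real n"]) (auto simp: indicator_def)
      show "integrable (measure_pmf p) (\<lambda>x. real (X x) * indicator {x. X x \<ge> n} x)"
        by (rule Bochner_Integration.integrable_bound[OF assms]) (auto simp: indicator_def)
    qed (auto simp: indicator_def)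
    finally show ?thesis .
  qed
  then show ?thesis
    by (intro tendsto_sandwich[OF _ _ tendsto_const lim]) auto
qed

lemma prob_replicate_ex_le:
  "measure_pmf.prob (replicate_pmf k p) {xs. \<exists>x\<in>set xs. x \<in> B} \<le> real k * measure_pmf.prob p B"
proof -
  have "ennreal (measure_pmf.prob (replicate_pmf k p) {xs. \<exists>x\<in>set xs. x \<in> B})
      = (\<integral>\<^sup>+xs. indicator {xs. \<exists>x\<in>set xs. x \<in> B} xs \<partial>replicate_pmf k p)"
    by (simp add: measure_pmf.emeasure_eq_measure)
  also have "\<dots> \<le> (\<integral>\<^sup>+xs. (\<Sum>x\<leftarrow>xs. indicator B x) \<partial>replicate_pmf k p)"
  proof (rule nn_integral_mono)
    fix xs :: "'a list"
    show "indicator {xs. \<exists>x\<in>set xs. x \<in> B} xs \<le> (\<Sum>x\<leftarrow>xs. indicator B x :: ennreal)"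
    proof (cases "\<exists>x\<in>set xs. x \<in> B")
      case True
      then obtain x where x: "x \<in> set xs" "x \<in> B" by blast
      then have "indicator B x \<le> (\<Sum>x\<leftarrow>xs. indicator B x :: ennreal)"
        by (intro member_le_sum_list) (simp_all only: list.set_map imageI zero_le)
      moreover have "indicator {xs. \<exists>x\<in>set xs. x \<in> B} xs = (1::ennreal)"
        using True by (simp add: indicator_def)
      ultimately show ?thesis using x(2) by (simp only: indicator_simps(1))
    qed (simp add: indicator_def)
  qed
  also have "\<dots> = ennreal (real k * measure_pmf.prob p B)"
    by (simp add: nn_integral_replicate_pmf_sum measure_pmf.emeasure_eq_measure
        ennreal_of_nat_eq_real_of_nat ennreal_mult)
  finally show ?thesis by (simp add: ennreal_le_iff)
qed

context heavy_tailed
begin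

text \<open>The forest has about \<open>c n - r n\<close> trees. Explore it for \<open>M n\<close> steps, a number
  chosen such that the walk is expected to have exhausted the forest with a margin of order \<open>r n\<close>, while
  the expected number of steps in \<open>\<Omega>\<close> still is below \<open>n\<close> by a margin of order \<open>r n\<close>. Both margins
  exceed the fluctuations.\<close>

lemma forest_not_too_large:
  fixes a :: "nat \<Rightarrow> real" and r :: "nat \<Rightarrow> nat"
  assumes tight: "\<And>e. e > 0 \<Longrightarrow> \<exists>K>0. \<forall>\<^sub>F n in sequentially. measure_pmf.prob (replicate_pmf n \<xi>)
      {xs. \<bar>real (sum_list xs) - mean \<xi> * real n\<bar> \<le> K * a n} > 1 - e"
    and scale: "\<And>b b'. 0 < b \<Longrightarrow> \<exists>B>0. \<forall>\<^sub>F n in sequentially. \<forall>M.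
      b * real n \<le> real M \<and> real M \<le> b' * real n \<longrightarrow> a M \<le> B * a n"
    and sqrt: "d > 0" "\<forall>\<^sub>F n in sequentially. d * sqrt (real n) \<le> a n"
    and r: "filterlim (\<lambda>n. real (r n) / a n) at_top sequentially" "(\<lambda>n. real (r n)) \<in> o(\<lambda>n. real n)"
    and e: "e > 0"
  shows "\<forall>\<^sub>F n in sequentially. measure_pmf.prob (replicate_pmf (nat \<lfloor>c * real n - real (r n)\<rfloor>) gw)
    {ts. real n - j < real (\<Sum>t\<leftarrow>ts. L \<Omega> t)} < e"
proof -
  define p where "p = measure_pmf.prob \<xi> \<Omega>"
  define \<mu> where "\<mu> = mean \<xi>"
  have p: "0 < p" "p \<le> 1" using Omega_pos by (auto simp: p_def)
  define \<nu> where "\<nu> = 1 - \<mu>"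
  have mu: "0 < \<nu>" "\<nu> \<le> 1" using sub mean_nonneg by (auto simp: \<mu>_def \<nu>_def)
  have c: "c = \<nu> / p" by (simp add: c_def p_def \<mu>_def \<nu>_def)
  \<comment> \<open>Half of the slack \<open>r n\<close> is spent on the length of the exploration; \<open>t\<close> is half of the resulting
    margin for the number of steps in \<open>\<Omega>\<close>.\<close>
  define M where "M n = nat \<lfloor>real n / p - real (r n) / (2 * \<nu>)\<rfloor>" for n
  define N where "N n = nat \<lfloor>c * real n - real (r n)\<rfloor>" for n
  define t where "t n = p * real (r n) / (4 * \<nu>)" for n
  obtain K where K: "K > 0" "\<forall>\<^sub>F n in sequentially. measure_pmf.prob (replicate_pmf n \<xi>)
      {xs. \<bar>real (sum_list xs) - \<mu> * real n\<bar> \<le> K * a n} > 1 - e / 2"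
    using tight[of "e / 2"] e by (auto simp: \<mu>_def)
  obtain B where B: "B > 0" "\<forall>\<^sub>F n in sequentially. \<forall>M.
      1 / (2 * p) * real n \<le> real M \<and> real M \<le> 1 / p * real n \<longrightarrow> a M \<le> B * a n"
    using scale[of "1 / (2 * p)" "1 / p"] p by auto
  have r_small: "\<forall>\<^sub>F n in sequentially. real (r n) \<le> b * real n" if "b > 0" for b
    using landau_o.smallD[OF r(2) that] by simp
  have a_pos: "\<forall>\<^sub>F n in sequentially. 0 < a n"
    using sqrt(2) eventually_gt_at_top[of 0]
  proof eventually_elim
    case (elim n)
    then have "0 < d * sqrt (real n)" using sqrt(1) by simp
    with elim show ?case by linarith
  qed
  have r_big: "\<forall>\<^sub>F n in sequentially. b * a n \<le> real (r n)" for b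
    using a_pos r(1)[unfolded filterlim_at_top, rule_format, of b]
    by eventually_elim (simp add: field_simps)
  have r_sqrt: "\<forall>\<^sub>F n in sequentially. b * sqrt (real n) \<le> real (r n)" if b: "b \<ge> 0" for b
    using sqrt(2) r_big[of "b / d"]
  proof eventually_elim
    case (elim n)
    have "b * sqrt (real n) = b / d * (d * sqrt (real n))" using sqrt(1) by simp
    also have "\<dots> \<le> b / d * a n"
      using elim b sqrt(1) by (intro mult_left_mono) auto
    finally show ?case using elim by linarith
  qed
  have r_top: "\<forall>\<^sub>F n in sequentially. b \<le> real (r n)" for b
  proof -
    have "\<forall>\<^sub>F n in sequentially. b \<le> 1 * sqrt (real n)" by real_asymp
    then show ?thesis using r_sqrt[OF zero_le_one] by eventually_elim auto
  qed
  have M_lower: "\<forall>\<^sub>F n in sequentially. real n / p - real (r n) / (2 * \<nu>) - 1 \<le> real (M n)"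
    by (intro always_eventually allI) (unfold M_def, linarith)
  have M_upper: "\<forall>\<^sub>F n in sequentially. real (M n) \<le> real n / p - real (r n) / (2 * \<nu>)"
    using r_small[of "2 * \<nu> / p"]
  proof -
    have "\<forall>\<^sub>F n in sequentially. real (r n) \<le> 2 * \<nu> / p * real n"
      using p mu by (intro r_small) auto
    then show ?thesis
    proof eventually_elim
      case (elim n)
      then have "0 \<le> real n / p - real (r n) / (2 * \<nu>)"
        using p mu by (simp add: field_simps)
      then show ?case unfolding M_def by linarith
    qed
  qed
  have M_half: "\<forall>\<^sub>F n in sequentially. 1 / (2 * p) * real n \<le> real (M n)"
  proof -
    have "\<forall>\<^sub>F n in sequentially. real (r n) \<le> \<nu> / (2 * p) * real n"
      using p mu by (intro r_small) auto
    moreover have "\<forall>\<^sub>F n in sequentially. 4 * p \<le> real n" by real_asymp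
    ultimately show ?thesis using M_lower
    proof eventually_elim
      case (elim n)
      have "real (r n) / (2 * \<nu>) \<le> (\<nu> / (2 * p) * real n) / (2 * \<nu>)"
        using elim mu by (intro divide_right_mono) auto
      also have "\<dots> = 1 / (4 * p) * real n" using mu by (simp add: field_simps)
      finally have "real n / p - 1 / (4 * p) * real n - 1 \<le> real (M n)" using elim by linarith
      moreover have "1 \<le> 1 / (4 * p) * real n" using elim p by (simp add: field_simps)
      moreover have "real n / p = 4 * (1 / (4 * p) * real n)" "1 / (2 * p) * real n = 2 * (1 / (4 * p) * real n)"
        by simp_all
      ultimately show ?case by linarith
    qed
  qed
  have M_top: "filterlim M at_top sequentially"
  proof -
    have "filterlim (\<lambda>n. 1 / (2 * p) * real n) at_top sequentially"
      using p by real_asymp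
    then have "filterlim (\<lambda>n. real (M n)) at_top sequentially"
      by (rule filterlim_at_top_mono[OF _ M_half])
    then show ?thesis by (simp add: filterlim_sequentially_iff_filterlim_real)
  qed
  have walk: "\<forall>\<^sub>F n in sequentially. measure_pmf.prob (replicate_pmf (M n) \<xi>)
      {xs. \<not> (N n + sum_list xs \<le> M n)} < e / 2"
    using eventually_compose_filterlim[OF K(2) M_top] B(2) M_half M_upper M_lower r_top[of 4] r_big[of "4 * K * B"]
      r_small[of c, OF c_pos]
  proof eventually_elim
    case (elim n)
    have aM: "K * a (M n) \<le> real (r n) / 4"
    proof -
      have "0 \<le> real (r n) / (2 * \<nu>)" using mu by simp
      then have "real (M n) \<le> 1 / p * real n" using elim(4) by simp
      then have "a (M n) \<le> B * a n" using elim(2,3) by blast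
      then have "K * a (M n) \<le> K * (B * a n)" using K(1) by (intro mult_left_mono) auto
      then show ?thesis using elim(7) by simp
    qed
    have N: "real (N n) \<le> c * real n - real (r n)"
      using elim(8) unfolding N_def by linarith
    have "\<nu> * (real n / p - real (r n) / (2 * \<nu>) - 1) \<le> \<nu> * real (M n)"
      using elim(5) mu by (intro mult_left_mono) auto
    moreover have "\<nu> * (real n / p - real (r n) / (2 * \<nu>) - 1) = c * real n - real (r n) / 2 - \<nu>"
      using mu by (simp add: c right_diff_distrib)
    ultimately have "real (N n) + real (r n) / 4 \<le> \<nu> * real (M n)"
      using N elim(6) mu by linarith
    then have key: "real (N n) + K * a (M n) \<le> real (M n) - \<mu> * real (M n)"
      using aM by (simp add: \<nu>_def left_diff_distrib)
    let ?A = "{xs. \<bar>real (sum_list xs) - \<mu> * real (M n)\<bar> \<le> K * a (M n)}"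
    have "measure_pmf.prob (replicate_pmf (M n) \<xi>) {xs. \<not> (N n + sum_list xs \<le> M n)}
        \<le> measure_pmf.prob (replicate_pmf (M n) \<xi>) (UNIV - ?A)"
    proof (intro measure_pmf.finite_measure_mono subsetI)
      fix xs assume "xs \<in> {xs. \<not> (N n + sum_list xs \<le> M n)}"
      then have "real (N n) + real (sum_list xs) > real (M n)" by simp
      then show "xs \<in> UNIV - ?A" using key by (simp add: abs_le_iff)
    qed auto
    also have "\<dots> = 1 - measure_pmf.prob (replicate_pmf (M n) \<xi>) ?A"
      using measure_pmf.prob_compl[of ?A "replicate_pmf (M n) \<xi>"] by simp
    finally show ?case using elim(1) by linarith
  qed
  have count: "\<forall>\<^sub>F n in sequentially. measure_pmf.prob (replicate_pmf (M n) \<xi>)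
      {xs. real n - j < real (\<Sum>x\<leftarrow>xs. of_bool (x \<in> \<Omega>))} < e / 2"
  proof -
    define w where "w = max 0 (- ln (e / 4))"
    have w: "exp (- w) < e / 2"
    proof -
      have "exp (- w) \<le> exp (ln (e / 4))" by (simp add: w_def)
      then show ?thesis using e by simp
    qed
    define b where "b = 8 * \<nu> / p * sqrt (w / p)"
    have b: "b \<ge> 0" using mu p by (simp add: b_def w_def)
    have "\<forall>\<^sub>F n in sequentially. real (r n) \<le> 4 * \<nu> / p / p * real n"
      using p mu by (intro r_small) auto
    then show ?thesis
      using M_upper M_half r_top[of "4 * \<nu> / p * \<bar>j\<bar>"] r_sqrt[OF b] eventually_gt_at_top[of 0]
    proof eventually_elim
      case (elim n)
      have t0: "0 \<le> t n" using p mu by (simp add: t_def)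
      have "t n \<le> 1 / p * real n"
      proof -
        have "t n = real (r n) * (p / (4 * \<nu>))" by (simp add: t_def)
        also have "\<dots> \<le> (4 * \<nu> / p / p * real n) * (p / (4 * \<nu>))"
          using elim(1) p mu by (intro mult_right_mono) auto
        also have "\<dots> = 1 / p * real n" using p mu by simp
        finally show ?thesis .
      qed
      then have t2: "t n \<le> 2 * real (M n)" using elim(3) by simp
      have "p * real (M n) \<le> p * (real n / p - real (r n) / (2 * \<nu>))"
        using elim(2) p by (intro mult_left_mono) auto
      also have "\<dots> = real n - 2 * t n"
        using p mu by (simp add: t_def right_diff_distrib)
      finally have pM: "p * real (M n) + t n \<le> real n - t n" by simp
      have "\<bar>j\<bar> \<le> t n"
      proof -
        have "\<bar>j\<bar> = (4 * \<nu> / p * \<bar>j\<bar>) * (p / (4 * \<nu>))" using p mu by simp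
        also have "\<dots> \<le> real (r n) * (p / (4 * \<nu>))"
          using elim(4) p mu by (intro mult_right_mono) auto
        also have "\<dots> = t n" by (simp add: t_def)
        finally show ?thesis .
      qed
      then have "p * real (M n) + t n \<le> real n - j" using pM by linarith
      moreover have ind: "real (\<Sum>x\<leftarrow>xs. of_bool (x \<in> \<Omega>)) = (\<Sum>x\<leftarrow>xs. indicator \<Omega> x)" for xs
        by (induction xs) auto
      ultimately have "measure_pmf.prob (replicate_pmf (M n) \<xi>) {xs. real n - j < real (\<Sum>x\<leftarrow>xs. of_bool (x \<in> \<Omega>))}
          \<le> measure_pmf.prob (replicate_pmf (M n) \<xi>) {xs. p * real (M n) + t n \<le> (\<Sum>x\<leftarrow>xs. indicator \<Omega> x)}"
        by (intro measure_pmf.finite_measure_mono) auto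
      also have "\<dots> \<le> exp (- (t n)\<^sup>2 / (4 * real (M n)))"
        unfolding p_def by (rule replicate_pmf_count_upper[OF t0 t2])
      also have "\<dots> \<le> exp (- w)"
      proof -
        have "2 * sqrt (w / p) * sqrt (real n) = b * sqrt (real n) * (p / (4 * \<nu>))"
          using p mu by (simp add: b_def)
        also have "\<dots> \<le> real (r n) * (p / (4 * \<nu>))"
          using elim(5) p mu by (intro mult_right_mono) auto
        also have "\<dots> = t n" by (simp add: t_def)
        finally have "(2 * sqrt (w / p) * sqrt (real n))\<^sup>2 \<le> (t n)\<^sup>2"
          using p by (intro power_mono) (auto simp: w_def)
        then have "4 * (w / p) * real n \<le> (t n)\<^sup>2"
          using p by (simp add: power_mult_distrib w_def)
        moreover have "w * (4 * real (M n)) \<le> 4 * (w / p) * real n"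
        proof -
          have "0 \<le> real (r n) / (2 * \<nu>)" using mu by simp
          then have "real (M n) \<le> real n / p" using elim(2) by linarith
          then have "w * (4 * real (M n)) \<le> w * (4 * (real n / p))"
            by (intro mult_left_mono) (auto simp: w_def)
          then show ?thesis by (simp add: mult_ac)
        qed
        ultimately have "w * (4 * real (M n)) \<le> (t n)\<^sup>2" by linarith
        moreover have "0 < 4 * real (M n)"
        proof -
          have "0 < 1 / (2 * p) * real n" using p elim(6) by simp
          then show ?thesis using elim(3) by linarith
        qed
        ultimately have "w \<le> (t n)\<^sup>2 / (4 * real (M n))" by (simp add: pos_le_divide_eq)
        then show ?thesis by simp
      qed
      finally show ?case using w by linarith
    qed
  qed
  show ?thesis
    using walk count eventually_ge_at_top[of "nat \<lceil>\<bar>j\<bar>\<rceil>"]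
  proof eventually_elim
    case (elim n)
    define b where "b = nat \<lfloor>real n - j\<rfloor>"
    have "0 \<le> real n - j" using elim(3) by linarith
    then have le_b: "x \<le> b \<longleftrightarrow> real x \<le> real n - j" for x :: nat
      unfolding b_def by (simp add: le_nat_floor le_nat_iff le_floor_iff)
    let ?E = "{xs. N n + sum_list xs \<le> M n \<and> (\<Sum>x\<leftarrow>xs. of_bool (x \<in> \<Omega>)) \<le> b}"
    let ?F = "{ts. (\<Sum>t\<leftarrow>ts. L \<Omega> t) \<le> b}"
    have "measure_pmf.prob (replicate_pmf (N n) gw) {ts. real n - j < real (\<Sum>t\<leftarrow>ts. L \<Omega> t)}
        = measure_pmf.prob (replicate_pmf (N n) gw) (UNIV - ?F)"
      by (intro arg_cong[where f = "measure_pmf.prob _"]) (auto simp: le_b not_le)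
    also have "\<dots> = 1 - measure_pmf.prob (replicate_pmf (N n) gw) ?F"
      using measure_pmf.prob_compl[of ?F "replicate_pmf (N n) gw"] by simp
    also have "\<dots> \<le> 1 - measure_pmf.prob (replicate_pmf (M n) \<xi>) ?E"
      using prob_walk_le_forest[of "M n" "N n" \<Omega> b] by simp
    also have "\<dots> = measure_pmf.prob (replicate_pmf (M n) \<xi>) (UNIV - ?E)"
      using measure_pmf.prob_compl[of ?E "replicate_pmf (M n) \<xi>"] by simp
    also have "\<dots> \<le> measure_pmf.prob (replicate_pmf (M n) \<xi>)
        ({xs. \<not> (N n + sum_list xs \<le> M n)} \<union> {xs. real n - j < real (\<Sum>x\<leftarrow>xs. of_bool (x \<in> \<Omega>))})"
      by (intro measure_pmf.finite_measure_mono) (auto simp: le_b not_le)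
    also have "\<dots> \<le> measure_pmf.prob (replicate_pmf (M n) \<xi>) {xs. \<not> (N n + sum_list xs \<le> M n)}
        + measure_pmf.prob (replicate_pmf (M n) \<xi>) {xs. real n - j < real (\<Sum>x\<leftarrow>xs. of_bool (x \<in> \<Omega>))}"
      by (rule measure_Un_le) auto
    finally show ?case using elim by (simp add: N_def)
  qed
qed

end

context heavy_tailed
begin

text \<open>The number of trees in the statement of the theorem.\<close>

definition prefix_size :: "(nat \<Rightarrow> nat) \<Rightarrow> nat \<Rightarrow> nat" where
  "prefix_size r n = nat \<lfloor>c * real n - real (r n)\<rfloor>"

lemma prefix_size_bounds:
  assumes r: "(\<lambda>n. real (r n)) \<in> o(\<lambda>n. real n)" and b: "b > 0"
  shows "\<forall>\<^sub>F n in sequentially. \<bar>real (prefix_size r n) - c * real n\<bar> \<le> b * real n"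
proof -
  have "\<forall>\<^sub>F n in sequentially. real (r n) \<le> min c (b / 2) * real n"
    using landau_o.smallD[OF r, of "min c (b / 2)"] b c_pos by simp
  moreover have "\<forall>\<^sub>F n in sequentially. 1 \<le> b / 2 * real n"
    using b by real_asymp
  ultimately show ?thesis
  proof eventually_elim
    case (elim n)
    have "min c (b / 2) * real n \<le> c * real n" "min c (b / 2) * real n \<le> b / 2 * real n"
      by (intro mult_right_mono; simp)+
    then have "real (r n) \<le> c * real n" "real (r n) \<le> b / 2 * real n"
      using elim(1) by linarith+
    moreover from this have "c * real n - real (r n) - 1 \<le> real (prefix_size r n)"
      "real (prefix_size r n) \<le> c * real n - real (r n)"
      unfolding prefix_size_def by linarith+
    moreover have "b * real n = b / 2 * real n + b / 2 * real n" by simp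
    ultimately show ?case
      using elim(2) unfolding abs_le_iff by linarith
  qed
qed

lemma prefix_size_top:
  assumes r: "(\<lambda>n. real (r n)) \<in> o(\<lambda>n. real n)"
  shows "filterlim (prefix_size r) at_top sequentially"
proof -
  have half_pos: "c / 2 > 0" using c_pos by simp
  have "\<forall>\<^sub>F n in sequentially. c / 2 * real n \<le> real (prefix_size r n)"
    using prefix_size_bounds[OF r half_pos]
    by eventually_elim (unfold abs_le_iff, linarith)
  moreover have "filterlim (\<lambda>n. c / 2 * real n) at_top sequentially"
    using c_pos by real_asymp
  ultimately have "filterlim (\<lambda>n. real (prefix_size r n)) at_top sequentially"
    by (rule filterlim_at_top_mono[rotated])
  then show ?thesis by (simp add: filterlim_sequentially_iff_filterlim_real)
qed

lemma prefix_size_tail: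
  assumes r: "(\<lambda>n. real (r n)) \<in> o(\<lambda>n. real n)"
  shows "(\<lambda>n. real n * measure_pmf.prob \<xi> {prefix_size r n..}) \<longlonglongrightarrow> 0"
proof -
  have "(\<lambda>n. real n * measure_pmf.prob \<xi> {n..}) \<longlonglongrightarrow> 0"
    using prob_ge_tail[of \<xi> "\<lambda>x. x"] int by (simp add: atLeast_def)
  then have "(\<lambda>n. real (prefix_size r n) * measure_pmf.prob \<xi> {prefix_size r n..}) \<longlonglongrightarrow> 0"
    by (rule filterlim_compose[OF _ prefix_size_top[OF r]])
  then have lim: "(\<lambda>n. 2 / c * (real (prefix_size r n) * measure_pmf.prob \<xi> {prefix_size r n..})) \<longlonglongrightarrow> 0"
    by (rule tendsto_mult_right_zero)
  have half_pos: "c / 2 > 0" using c_pos by simp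
  have "\<forall>\<^sub>F n in sequentially. real n * measure_pmf.prob \<xi> {prefix_size r n..}
      \<le> 2 / c * (real (prefix_size r n) * measure_pmf.prob \<xi> {prefix_size r n..})"
    using prefix_size_bounds[OF r half_pos]
  proof eventually_elim
    case (elim n)
    then have "c * real n \<le> 2 * real (prefix_size r n)" unfolding abs_le_iff by linarith
    then have "real n \<le> 2 / c * real (prefix_size r n)"
      using c_pos by (simp add: field_simps)
    then have "real n * measure_pmf.prob \<xi> {prefix_size r n..} \<le> 2 / c * real (prefix_size r n) * measure_pmf.prob \<xi> {prefix_size r n..}"
      by (rule mult_right_mono) simp
    then show ?case by simp
  qed
  then show ?thesis
    by (intro tendsto_sandwich[OF _ _ tendsto_const lim]) auto
qed

text \<open>The bounds on the sizes imply that \<open>n\<close> exceeds the total size of the marked tree and the trees in the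
  list by an amount between \<open>J - I\<close> and \<open>\<kappa> n\<close>.\<close>

definition typical :: "nat \<Rightarrow> nat \<Rightarrow> nat \<Rightarrow> real \<Rightarrow> nat \<Rightarrow> (marked_tree \<times> plane_tree list) set" where
  "typical D I J \<kappa> n = {((S, v), ts). L \<Omega> S \<le> I \<and> L {D..} S = 0 \<and> (\<forall>t\<in>set ts. L {D..} t = 0)
    \<and> real (\<Sum>t\<leftarrow>ts. L \<Omega> t) \<le> real n - real J \<and> (1 - \<kappa>) * real n \<le> real (\<Sum>t\<leftarrow>ts. L \<Omega> t)}"

lemma L_antimono: "D \<le> D' \<Longrightarrow> L {D'..} T \<le> L {D..} T"
  unfolding L_def by (intro card_mono) (auto intro: finite_subset[OF _ finite_vertices])

lemma bullet_bounded:
  assumes e: "e > 0"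
  shows "\<exists>I. measure_pmf.prob gw_bullet {x. \<not> (L \<Omega> (fst x) \<le> I \<and> L {I..} (fst x) = 0)} < e"
proof -
  define A where "A I = {x :: marked_tree. I < L \<Omega> (fst x) \<or> I \<le> max_outdegree (fst x)}" for I
  have "(\<lambda>I. measure_pmf.prob gw_bullet (A I)) \<longlonglongrightarrow> measure_pmf.prob gw_bullet (\<Inter>I. A I)"
    by (rule measure_pmf.finite_Lim_measure_decseq) (auto simp: decseq_def A_def)
  moreover have "(\<Inter>I. A I) = {}"
  proof -
    have "x \<notin> A (Suc (L \<Omega> (fst x) + max_outdegree (fst x)))" for x
      by (auto simp: A_def)
    then show ?thesis by blast
  qed
  ultimately have "\<forall>\<^sub>F I in sequentially. measure_pmf.prob gw_bullet (A I) < e"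
    by (intro order_tendstoD(2)) (use e in auto)
  then obtain I where I: "measure_pmf.prob gw_bullet (A I) < e"
    by (auto simp: eventually_sequentially)
  have "measure_pmf.prob gw_bullet {x. \<not> (L \<Omega> (fst x) \<le> I \<and> L {I..} (fst x) = 0)} \<le> measure_pmf.prob gw_bullet (A I)"
    using L_eq_0_of_max_outdegree[of _ I]
    by (intro measure_pmf.finite_measure_mono) (auto simp: A_def not_le not_less)
  with I show ?thesis by (intro exI[of _ I]) linarith
qed

text \<open>The law of the marked tree does not depend on \<open>n\<close>, a first moment bound excludes large outdegrees,
  the law of large numbers bounds the total size from below, and the assumption bounds it from above.\<close>

lemma typical_whp:
  fixes r :: "nat \<Rightarrow> nat"
  assumes r: "(\<lambda>n. real (r n)) \<in> o(\<lambda>n. real n)" and e: "e > 0" and \<kappa>: "\<kappa> > 0"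
    and not_large: "\<And>e j. e > 0 \<Longrightarrow> \<forall>\<^sub>F n in sequentially. measure_pmf.prob (replicate_pmf (prefix_size r n) gw)
    {ts. real n - j < real (\<Sum>t\<leftarrow>ts. L \<Omega> t)} < e"
  shows "\<exists>I. \<forall>J. \<forall>\<^sub>F n in sequentially.
    measure_pmf.prob (pair_pmf gw_bullet (replicate_pmf (prefix_size r n) gw)) (- typical (prefix_size r n) I J \<kappa> n) < e"
proof -
  define N where "N = prefix_size r"
  obtain I where I: "measure_pmf.prob gw_bullet {x. \<not> (L \<Omega> (fst x) \<le> I \<and> L {I..} (fst x) = 0)} < e / 4"
    using bullet_bounded[of "e / 4"] e by auto
  have "\<forall>\<^sub>F n in sequentially.
    measure_pmf.prob (pair_pmf gw_bullet (replicate_pmf (N n) gw)) (- typical (N n) I J \<kappa> n) < e" for J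
  proof -
    have "(\<lambda>n. (c + 1) / (1 - mean \<xi>) * (real n * measure_pmf.prob \<xi> {N n..})) \<longlonglongrightarrow> 0"
      unfolding N_def by (intro tendsto_mult_right_zero prefix_size_tail r)
    then have "\<forall>\<^sub>F n in sequentially. (c + 1) / (1 - mean \<xi>) * (real n * measure_pmf.prob \<xi> {N n..}) < e / 4"
      by (rule order_tendstoD) (use e in simp)
    moreover have "\<forall>\<^sub>F n in sequentially. \<bar>real (N n) - c * real n\<bar> \<le> 1 * real n"
      unfolding N_def by (rule prefix_size_bounds[OF r]) simp
    moreover have "\<forall>\<^sub>F n in sequentially. measure_pmf.prob (replicate_pmf (N n) gw)
        {ts. real (\<Sum>t\<leftarrow>ts. L \<Omega> t) \<le> (1 / c - \<kappa> / (2 * c)) * real (N n)} < e / 4"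
      using weak_law_L_lower[OF _ prefix_size_top[OF r], of "\<kappa> / (2 * c)"] \<kappa> c_pos e
      unfolding N_def by (intro order_tendstoD(2)) auto
    moreover have "\<forall>\<^sub>F n in sequentially. \<bar>real (N n) - c * real n\<bar> \<le> (\<kappa> * c / 4) * real n"
      unfolding N_def by (rule prefix_size_bounds[OF r]) (use \<kappa> c_pos in simp)
    moreover have "\<forall>\<^sub>F n in sequentially. measure_pmf.prob (replicate_pmf (N n) gw)
        {ts. real n - real J < real (\<Sum>t\<leftarrow>ts. L \<Omega> t)} < e / 4"
      unfolding N_def using e by (intro not_large) auto
    moreover have "\<forall>\<^sub>F n in sequentially. I \<le> N n"
      using prefix_size_top[OF r] by (simp add: filterlim_at_top N_def)
    ultimately show ?thesis
    proof eventually_elim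
      case (elim n)
      define R where "R = replicate_pmf (N n) gw"
      define A1 where "A1 = {x :: marked_tree. \<not> (L \<Omega> (fst x) \<le> I \<and> L {I..} (fst x) = 0)}"
      define A2 where "A2 = {ts. \<exists>t\<in>set ts. t \<in> {t. L {N n..} t \<noteq> 0}}"
      define A3 where "A3 = {ts. real n - real J < real (\<Sum>t\<leftarrow>ts. L \<Omega> t)}"
      define A4 where "A4 = {ts. real (\<Sum>t\<leftarrow>ts. L \<Omega> t) \<le> (1 / c - \<kappa> / (2 * c)) * real (N n)}"
      have low: "(1 - \<kappa>) * real n \<le> (1 / c - \<kappa> / (2 * c)) * real (N n) \<or> (1 - \<kappa>) * real n \<le> 0"
      proof (cases "\<kappa> \<le> 1")
        case True
        have "(1 - \<kappa> / 4) * real n \<le> 1 / c * real (N n)"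
        proof -
          have "c * real n - \<kappa> * c / 4 * real n \<le> real (N n)" using elim(4) unfolding abs_le_iff by linarith
          then have "1 / c * (c * real n - \<kappa> * c / 4 * real n) \<le> 1 / c * real (N n)"
            using c_pos by (intro mult_left_mono) auto
          moreover have "1 / c * (c * real n - \<kappa> * c / 4 * real n) = (1 - \<kappa> / 4) * real n"
            using c_pos by (simp add: field_simps)
          ultimately show ?thesis by simp
        qed
        then have "(1 - \<kappa> / 2) * ((1 - \<kappa> / 4) * real n) \<le> (1 - \<kappa> / 2) * (1 / c * real (N n))"
          using True by (intro mult_left_mono) auto
        also have "\<dots> = (1 / c - \<kappa> / (2 * c)) * real (N n)"
          using c_pos by (simp add: field_simps)
        finally have "(1 - \<kappa> / 2) * ((1 - \<kappa> / 4) * real n) \<le> (1 / c - \<kappa> / (2 * c)) * real (N n)" .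
        moreover have "(1 - \<kappa>) * real n \<le> ((1 - \<kappa> / 2) * (1 - \<kappa> / 4)) * real n"
          using \<kappa> by (intro mult_right_mono) (auto simp: algebra_simps)
        ultimately show ?thesis by (simp add: mult.assoc)
      next
        case False
        then show ?thesis by (auto intro: mult_nonpos_nonneg)
      qed
      have "- typical (N n) I J \<kappa> n \<subseteq> fst -` A1 \<union> snd -` (A2 \<union> (A3 \<union> A4))"
      proof
        fix z assume z: "z \<in> - typical (N n) I J \<kappa> n"
        obtain S v ts where zz: "z = ((S, v), ts)" by (metis surj_pair)
        show "z \<in> fst -` A1 \<union> snd -` (A2 \<union> (A3 \<union> A4))"
        proof (rule ccontr)
          assume "z \<notin> fst -` A1 \<union> snd -` (A2 \<union> (A3 \<union> A4))"
          then have "L \<Omega> S \<le> I" "L {I..} S = 0" "\<forall>t\<in>set ts. L {N n..} t = 0"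
            "real (\<Sum>t\<leftarrow>ts. L \<Omega> t) \<le> real n - real J"
            "(1 / c - \<kappa> / (2 * c)) * real (N n) < real (\<Sum>t\<leftarrow>ts. L \<Omega> t)"
            by (auto simp: zz A1_def A2_def A3_def A4_def)
          moreover have "L {N n..} S \<le> L {I..} S"
            using elim(6) by (rule L_antimono)
          moreover have "(1 - \<kappa>) * real n \<le> real (\<Sum>t\<leftarrow>ts. L \<Omega> t)"
            using low calculation(5) of_nat_0_le_iff[of "\<Sum>t\<leftarrow>ts. L \<Omega> t"] by linarith
          ultimately have "z \<in> typical (N n) I J \<kappa> n"
            by (auto simp: zz typical_def)
          with z show False by simp
        qed
      qed
      then have "measure_pmf.prob (pair_pmf gw_bullet R) (- typical (N n) I J \<kappa> n)
          \<le> measure_pmf.prob (pair_pmf gw_bullet R) (fst -` A1 \<union> snd -` (A2 \<union> (A3 \<union> A4)))"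
        by (intro measure_pmf.finite_measure_mono) auto
      also have "\<dots> \<le> measure_pmf.prob (pair_pmf gw_bullet R) (fst -` A1) + measure_pmf.prob (pair_pmf gw_bullet R) (snd -` (A2 \<union> (A3 \<union> A4)))"
        by (rule measure_Un_le) auto
      also have "measure_pmf.prob (pair_pmf gw_bullet R) (fst -` A1) = measure_pmf.prob gw_bullet A1"
        by (subst measure_map_pmf[symmetric]) (simp add: map_fst_pair_pmf)
      also have "measure_pmf.prob (pair_pmf gw_bullet R) (snd -` (A2 \<union> (A3 \<union> A4))) = measure_pmf.prob R (A2 \<union> (A3 \<union> A4))"
        by (subst measure_map_pmf[symmetric]) (simp add: map_snd_pair_pmf)
      also have "\<dots> \<le> measure_pmf.prob R A2 + (measure_pmf.prob R A3 + measure_pmf.prob R A4)"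
        by (intro order_trans[OF measure_Un_le] add_left_mono measure_Un_le) auto
      finally have "measure_pmf.prob (pair_pmf gw_bullet R) (- typical (N n) I J \<kappa> n)
          \<le> measure_pmf.prob gw_bullet A1 + (measure_pmf.prob R A2 + (measure_pmf.prob R A3 + measure_pmf.prob R A4))"
        by simp
      moreover have "measure_pmf.prob gw_bullet A1 < e / 4"
        using I by (simp add: A1_def)
      moreover have "measure_pmf.prob R A2 < e / 4"
      proof -
        have "measure_pmf.prob R A2 \<le> real (N n) * measure_pmf.prob gw {t. L {N n..} t \<noteq> 0}"
          unfolding R_def A2_def by (rule prob_replicate_ex_le)
        also have "\<dots> \<le> ((c + 1) * real n) * (measure_pmf.prob \<xi> {N n..} / (1 - mean \<xi>))"
          using elim(2) c_pos by (intro mult_mono prob_L_pos_le) (auto simp: abs_le_iff algebra_simps)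
        also have "\<dots> = (c + 1) / (1 - mean \<xi>) * (real n * measure_pmf.prob \<xi> {N n..})"
          by simp
        finally show ?thesis using elim(1) by linarith
      qed
      moreover have "measure_pmf.prob R A3 < e / 4" "measure_pmf.prob R A4 < e / 4"
        using elim(3,5) by (simp_all add: R_def A3_def A4_def)
      ultimately show ?case by (simp add: R_def)
    qed
  qed
  then show ?thesis unfolding N_def by blast
qed

end

section \<open>Convergence in total variation\<close>

context heavy_tailed
begin

text \<open>The sum in \<open>prob_decomposed_ge\<close> over \<open>k < K\<close> with \<open>K = \<delta> n / 4\<close> is compared with the upper bound for
  the probability of the conditioning event. The size \<open>m\<close> that remains is at most of order \<open>\<kappa> n\<close>, where \<open>\<kappa>\<close> is small
  compared with \<open>\<delta>\<close>, and is therefore passed before time \<open>K\<close>, while \<open>N + k\<close> stays in the window around \<open>c n\<close>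
  where \<open>\<xi>\<close> has nearly constant probabilities.\<close>

lemma typical_ratio:
  fixes r :: "nat \<Rightarrow> nat"
  assumes r: "(\<lambda>n. real (r n)) \<in> o(\<lambda>n. real n)" and e: "0 < e" "e \<le> 1"
  shows "\<exists>\<kappa>>0. \<forall>I. \<exists>J. \<forall>\<^sub>F n in sequentially. \<forall>x v ts.
    ((x, v), ts) \<in> typical (prefix_size r n) I J \<kappa> n \<and> length ts = prefix_size r n \<longrightarrow>
    (1 - e) * (pmf gw_bullet (x, v) * prod_list (map (pmf gw) ts)) * measure_pmf.prob gw {T. L \<Omega> T = n}
    \<le> measure_pmf.prob gw {T. L \<Omega> T = n \<and> F0 T = (x, v) \<and> take (prefix_size r n) (Fs T) = ts}"
proof -
  define N where "N = prefix_size r"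
  define e0 where "e0 = min 1 (e * c / (5 + c))"
  have e0: "0 < e0" "e0 \<le> 1" using e c_pos by (auto simp: e0_def)
  have "e0 * (5 + c) \<le> e * c / (5 + c) * (5 + c)"
    using c_pos by (intro mult_right_mono) (auto simp: e0_def)
  also have "\<dots> = e * c" using c_pos by simp
  finally have "e0 * (5 + c) \<le> e * c" .
  moreover have "0 \<le> e0 * (3 * e0)" "0 \<le> e * e0" using e e0 by auto
  ultimately have e0_le: "(1 - e) * (c + e0) \<le> (1 - e0) * (c - 3 * e0)"
    using e0 unfolding left_diff_distrib right_diff_distrib distrib_left distrib_right mult_1_left
    by linarith
  obtain \<delta> where d: "0 < \<delta>" "\<delta> < c"
    and near: "\<forall>\<^sub>F n in sequentially. \<forall>d. \<bar>real d - c * real n\<bar> \<le> \<delta> * real n \<longrightarrow>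
      (1 - e0) * jump n \<le> pmf \<xi> d \<and> pmf \<xi> d \<le> (1 + e0) * jump n"
    using pmf_near_jump[OF e0(1)] by blast
  define \<kappa> where "\<kappa> = \<delta> / (16 * c)"
  have \<kappa>: "\<kappa> > 0" "4 * c * \<kappa> = \<delta> / 4" using d c_pos by (auto simp: \<kappa>_def)
  define K where "K n = nat \<lceil>\<delta> / 4 * real n\<rceil>" for n
  have K_top: "filterlim K at_top sequentially"
    unfolding K_def using d by real_asymp
  have "\<forall>\<^sub>F n in sequentially. dist (U $ n) c < e0"
    using U_lim e0(1) by (rule tendstoD)
  then obtain M where M0: "\<And>i. i \<ge> M \<Longrightarrow> dist (U $ i) c < e0"
    by (auto simp: eventually_sequentially)
  have M: "U $ i \<ge> c - e0" if "i \<ge> M" for i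
    using M0[OF that] by (auto simp: dist_real_def abs_less_iff)
  have "\<forall>\<^sub>F n in sequentially. \<forall>x v ts.
    ((x, v), ts) \<in> typical (N n) I (M + I + 1) \<kappa> n \<and> length ts = N n \<longrightarrow>
    (1 - e) * (pmf gw_bullet (x, v) * prod_list (map (pmf gw) ts)) * measure_pmf.prob gw {T. L \<Omega> T = n}
    \<le> measure_pmf.prob gw {T. L \<Omega> T = n \<and> F0 T = (x, v) \<and> take (N n) (Fs T) = ts}" for I
  proof -
    have "(\<lambda>n. (U_max * (\<delta> / 4 + 1) / (1 - mean \<xi>)) * (real n * measure_pmf.prob \<xi> {N n..})) \<longlonglongrightarrow> 0"
      unfolding N_def by (intro tendsto_mult_right_zero prefix_size_tail r)
    then have "\<forall>\<^sub>F n in sequentially. (U_max * (\<delta> / 4 + 1) / (1 - mean \<xi>)) * (real n * measure_pmf.prob \<xi> {N n..}) < e0"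
      by (rule order_tendstoD) (rule e0(1))
    moreover note near
    moreover have "\<forall>\<^sub>F n in sequentially. \<bar>real (N n) - c * real n\<bar> \<le> \<delta> / 2 * real n"
      unfolding N_def by (rule prefix_size_bounds[OF r]) (use d in simp)
    moreover have "\<forall>\<^sub>F n in sequentially. 1 \<le> \<delta> / 4 * real n"
      using d by real_asymp
    moreover have "\<forall>\<^sub>F n in sequentially. 1 \<le> \<kappa> * real n"
      using \<kappa> by real_asymp
    moreover have "\<forall>\<^sub>F n in sequentially. measure_pmf.prob gw {T. L \<Omega> T = n} * (1 - mean \<xi>) \<le> (c + e0) * jump n"
      by (rule prob_L_upper[OF e0(1)])
    moreover have "\<forall>\<^sub>F n in sequentially. \<forall>k\<ge>N n. k \<in> \<Omega> \<longleftrightarrow> eventually_in"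
      unfolding N_def
      by (rule eventually_compose_filterlim[OF _ prefix_size_top[OF r]]) (rule eventually_all_ge_at_top[OF eventually_in])
    moreover have "\<forall>\<^sub>F n in sequentially. measure_pmf.prob (replicate_pmf (K n) gw)
        {ts. real (\<Sum>t\<leftarrow>ts. L \<Omega> t) \<le> (1 / c - 1 / (2 * c)) * real (K n)} < e0 / U_max"
      using weak_law_L_lower[OF _ K_top, of "1 / (2 * c)"] c_pos e0 U_max_pos
      by (intro order_tendstoD(2)) auto
    moreover note jump_pos
    moreover have "\<forall>\<^sub>F n in sequentially. 1 \<le> N n"
      using prefix_size_top[OF r] by (simp add: filterlim_at_top N_def)
    ultimately show ?thesis
      using eventually_ge_at_top[of 1]
    proof eventually_elim
      case (elim n)
      have K: "real (K n) \<le> \<delta> / 4 * real n + 1" "\<delta> / 4 * real n \<le> real (K n)"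
        unfolding K_def using d by (auto simp: of_nat_ceiling)
      show ?case
      proof (intro allI impI)
        fix S v ts assume x: "((S, v), ts) \<in> typical (N n) I (M + I + 1) \<kappa> n \<and> length ts = N n"
        define w where "w = pmf gw_bullet (S, v) * prod_list (map (pmf gw) ts)"
        have w: "0 \<le> w" unfolding w_def by (intro mult_nonneg_nonneg prod_list_nonneg) auto
        define P where "P = measure_pmf.prob gw {T. L \<Omega> T = n \<and> F0 T = (S, v) \<and> take (N n) (Fs T) = ts}"
        show "(1 - e) * (pmf gw_bullet (S, v) * prod_list (map (pmf gw) ts)) * measure_pmf.prob gw {T. L \<Omega> T = n}
          \<le> measure_pmf.prob gw {T. L \<Omega> T = n \<and> F0 T = (S, v) \<and> take (N n) (Fs T) = ts}"
        proof (cases "marked_leaf S v")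
          case False
          then show ?thesis by (simp add: pmf_gw_bullet)
        next
          case True
          have ty: "L \<Omega> S \<le> I" "L {N n..} S = 0" "\<And>t. t \<in> set ts \<Longrightarrow> L {N n..} t = 0"
            "real (\<Sum>t\<leftarrow>ts. L \<Omega> t) \<le> real n - real (M + I + 1)" "(1 - \<kappa>) * real n \<le> real (\<Sum>t\<leftarrow>ts. L \<Omega> t)"
            using x by (auto simp: typical_def)
          define m where "m = n + of_bool (0 \<in> \<Omega>) - (L \<Omega> S + of_bool eventually_in + (\<Sum>t\<leftarrow>ts. L \<Omega> t))"
          have ob: "of_bool b \<le> (1::nat)" for b by simp
          have sum_le: "(\<Sum>t\<leftarrow>ts. L \<Omega> t) + (M + I + 1) \<le> n" using ty(4) by linarith
          have m: "L \<Omega> S + of_bool eventually_in + (\<Sum>t\<leftarrow>ts. L \<Omega> t) + m = n + of_bool (0 \<in> \<Omega>)"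
            and mM: "M \<le> m" and m_le: "m \<le> n + 1 - (\<Sum>t\<leftarrow>ts. L \<Omega> t)"
            using sum_le ty(1) ob[of eventually_in] ob[of "0 \<in> \<Omega>"] unfolding m_def by linarith+
          have "real m \<le> \<kappa> * real n + 1"
            using m_le sum_le ty(5) by (simp add: left_diff_distrib)
          also have "\<dots> \<le> 2 * (\<kappa> * real n)" using elim(5) by simp
          also have "\<dots> = 1 / (2 * c) * (4 * c * \<kappa> * real n)" using c_pos by simp
          also have "\<dots> \<le> 1 / (2 * c) * real (K n)"
            unfolding \<kappa>(2) using c_pos K(2) by (intro mult_left_mono) auto
          also have "1 / (2 * c) = 1 / c - 1 / (2 * c)" by simp
          finally have m_K: "real m \<le> (1 / c - 1 / (2 * c)) * real (K n)" .
          have "measure_pmf.prob (replicate_pmf (K n) gw) {ts. (\<Sum>t\<leftarrow>ts. L \<Omega> t) \<le> m}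
              \<le> measure_pmf.prob (replicate_pmf (K n) gw) {ts. real (\<Sum>t\<leftarrow>ts. L \<Omega> t) \<le> (1 / c - 1 / (2 * c)) * real (K n)}"
            using m_K by (intro measure_pmf.finite_measure_mono) auto
          then have "U_max * measure_pmf.prob (replicate_pmf (K n) gw) {ts. (\<Sum>t\<leftarrow>ts. L \<Omega> t) \<le> m} \<le> U_max * (e0 / U_max)"
            using elim(8) U_max_pos by (intro mult_left_mono) auto
          then have tail1: "U_max * measure_pmf.prob (replicate_pmf (K n) gw) {ts. (\<Sum>t\<leftarrow>ts. L \<Omega> t) \<le> m} \<le> e0"
            using U_max_pos by simp
          have "U_max * (real (K n) * (measure_pmf.prob \<xi> {N n..} / (1 - mean \<xi>)))
              \<le> U_max * (((\<delta> / 4 + 1) * real n) * (measure_pmf.prob \<xi> {N n..} / (1 - mean \<xi>)))"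
            using K(1) elim(11) sub U_max_pos
            by (intro mult_left_mono mult_right_mono) (auto simp: distrib_right)
          also have "\<dots> = (U_max * (\<delta> / 4 + 1) / (1 - mean \<xi>)) * (real n * measure_pmf.prob \<xi> {N n..})"
            by simp
          finally have tail2: "U_max * (real (K n) * (measure_pmf.prob \<xi> {N n..} / (1 - mean \<xi>))) \<le> e0"
            using elim(1) by linarith
          have jump0: "0 \<le> (1 - e0) * jump n" using e0 elim(9) by auto
          have lower: "(1 - e0) * jump n \<le> pmf \<xi> (N n + k)" if k: "k < K n" for k
          proof -
            have "real k + 1 \<le> real (K n)" using k by linarith
            then have "real k \<le> \<delta> / 4 * real n" using K(1) by linarith
            moreover have "\<delta> * real n = \<delta> / 2 * real n + \<delta> / 4 * real n + \<delta> / 4 * real n" "0 \<le> real k" by simp_all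
            ultimately have "\<bar>real (N n + k) - c * real n\<bar> \<le> \<delta> * real n"
              using elim(3,4) unfolding abs_le_iff of_nat_add by linarith
            then show ?thesis using elim(2) by blast
          qed
          \<comment> \<open>The three errors \<open>e0\<close> come from the renewal theorem, from the visits after time \<open>K\<close> and from the
            discarded trees.\<close>
          have "(1 - e0) * jump n * (c - 3 * e0) \<le> (1 - e0) * jump n * (U $ m
              - U_max * measure_pmf.prob (replicate_pmf (K n) gw) {ts. (\<Sum>t\<leftarrow>ts. L \<Omega> t) \<le> m}
              - U_max * (real (K n) * (measure_pmf.prob \<xi> {N n..} / (1 - mean \<xi>))))"
            using M[OF mM] tail1 tail2 by (intro mult_left_mono jump0) linarith
          also have "\<dots> \<le> (\<Sum>k<K n. pmf \<xi> (N n + k) * (small_fps (N n) ^ k) $ m)"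
            by (rule small_visits_ge[OF lower jump0])
          finally have visits: "(1 - e0) * jump n * (c - 3 * e0) \<le> (\<Sum>k<K n. pmf \<xi> (N n + k) * (small_fps (N n) ^ k) $ m)" .
          have "(1 - mean \<xi>) * ((1 - e) * w * measure_pmf.prob gw {T. L \<Omega> T = n})
              = (1 - e) * w * (measure_pmf.prob gw {T. L \<Omega> T = n} * (1 - mean \<xi>))"
            by simp
          also have "\<dots> \<le> (1 - e) * w * ((c + e0) * jump n)"
            using e w elim(6) by (intro mult_left_mono) auto
          also have "\<dots> = w * jump n * ((1 - e) * (c + e0))" by simp
          also have "\<dots> \<le> w * jump n * ((1 - e0) * (c - 3 * e0))"
            using w elim(9) e0_le by (intro mult_left_mono) auto
          also have "\<dots> = w * ((1 - e0) * jump n * (c - 3 * e0))" by simp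
          also have "\<dots> \<le> w * (\<Sum>k<K n. pmf \<xi> (N n + k) * (small_fps (N n) ^ k) $ m)"
            using w visits by (intro mult_left_mono)
          also have "\<dots> \<le> (1 - mean \<xi>) * P"
            unfolding w_def P_def using x elim(10) elim(7)
            by (intro prob_decomposed_ge[OF True] ty(2,3) m) auto
          finally have "(1 - mean \<xi>) * ((1 - e) * w * measure_pmf.prob gw {T. L \<Omega> T = n}) \<le> (1 - mean \<xi>) * P" .
          then show ?thesis
            using sub by (simp add: w_def P_def)
        qed
      qed
    qed
  qed
  then show ?thesis
    using \<kappa>(1) unfolding N_def by blast
qed

lemma tv_dist_prefix:
  fixes r :: "nat \<Rightarrow> nat"
  assumes r: "(\<lambda>n. real (r n)) \<in> o(\<lambda>n. real n)"
    and not_large: "\<And>e j. e > 0 \<Longrightarrow> \<forall>\<^sub>F n in sequentially. measure_pmf.prob (replicate_pmf (prefix_size r n) gw)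
    {ts. real n - j < real (\<Sum>t\<leftarrow>ts. L \<Omega> t)} < e"
  shows "(\<lambda>n. tv_dist
            (measure_spmf (map_spmf (\<lambda>T. (F0 T, take (prefix_size r n) (Fs T))) (GW_cond \<xi> \<Omega> n)))
            (measure_spmf (pair_spmf (GW_bullet \<xi>) (iid_spmf (prefix_size r n) (GW \<xi>)))))
         \<longlonglongrightarrow> 0"
proof (rule LIMSEQ_I)
  fix d :: real assume d: "d > 0"
  define e where "e = min 1 (d / 4)"
  have e: "0 < e" "e \<le> 1" "e + e < d" using d by (auto simp: e_def)
  define N where "N = prefix_size r"
  obtain \<kappa> where \<kappa>: "\<kappa> > 0" and ratio: "\<forall>I. \<exists>J. \<forall>\<^sub>F n in sequentially. \<forall>x v ts.
    ((x, v), ts) \<in> typical (N n) I J \<kappa> n \<and> length ts = N n \<longrightarrow>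
    (1 - e) * (pmf gw_bullet (x, v) * prod_list (map (pmf gw) ts)) * measure_pmf.prob gw {T. L \<Omega> T = n}
    \<le> measure_pmf.prob gw {T. L \<Omega> T = n \<and> F0 T = (x, v) \<and> take (N n) (Fs T) = ts}"
    using typical_ratio[OF r e(1,2)] unfolding N_def by blast
  obtain I where I: "\<And>J. \<forall>\<^sub>F n in sequentially.
    measure_pmf.prob (pair_pmf gw_bullet (replicate_pmf (N n) gw)) (- typical (N n) I J \<kappa> n) < e"
    using typical_whp[OF r e(1) \<kappa> not_large] unfolding N_def by blast
  obtain J where J: "\<forall>\<^sub>F n in sequentially. \<forall>x v ts.
    ((x, v), ts) \<in> typical (N n) I J \<kappa> n \<and> length ts = N n \<longrightarrow>
    (1 - e) * (pmf gw_bullet (x, v) * prod_list (map (pmf gw) ts)) * measure_pmf.prob gw {T. L \<Omega> T = n}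
    \<le> measure_pmf.prob gw {T. L \<Omega> T = n \<and> F0 T = (x, v) \<and> take (N n) (Fs T) = ts}"
    using ratio by blast
  have "\<forall>\<^sub>F n in sequentially. tv_dist
            (measure_spmf (map_spmf (\<lambda>T. (F0 T, take (N n) (Fs T))) (GW_cond \<xi> \<Omega> n)))
            (measure_spmf (pair_spmf (GW_bullet \<xi>) (iid_spmf (N n) (GW \<xi>)))) < d"
    using I[of J] J q_pos
  proof eventually_elim
    case (elim n)
    define P where "P = map_spmf (\<lambda>T. (F0 T, take (N n) (Fs T))) (GW_cond \<xi> \<Omega> n)"
    have Q: "pair_spmf (GW_bullet \<xi>) (iid_spmf (N n) (GW \<xi>)) = spmf_of_pmf (pair_pmf gw_bullet (replicate_pmf (N n) gw))"
      by (simp add: GW_eq GW_bullet_eq iid_spmf_of_pmf pair_spmf_of_pmf)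
    have pos: "0 < measure_pmf.prob gw {T. L \<Omega> T = n}" using elim(3) by (simp add: q_def)
    have P_eq: "spmf P ((x, v), ts) * measure_pmf.prob gw {T. L \<Omega> T = n}
        = measure_pmf.prob gw {T. L \<Omega> T = n \<and> F0 T = (x, v) \<and> take (N n) (Fs T) = ts}" for x v ts
    proof -
      have "{T. L \<Omega> T = n} \<inter> (\<lambda>T. (F0 T, take (N n) (Fs T))) -` {((x, v), ts)}
          = {T. L \<Omega> T = n \<and> F0 T = (x, v) \<and> take (N n) (Fs T) = ts}"
        by auto
      then show ?thesis
        unfolding P_def GW_cond_def GW_eq spmf_map measure_cond_spmf_of_pmf by simp
    qed
    have "tv_dist (measure_spmf P) (measure_spmf (spmf_of_pmf (pair_pmf gw_bullet (replicate_pmf (N n) gw)))) \<le> e + e"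
    proof (rule tv_dist_le)
      show "measure (measure_spmf (spmf_of_pmf (pair_pmf gw_bullet (replicate_pmf (N n) gw)))) (- typical (N n) I J \<kappa> n) \<le> e"
        using elim(1) by simp
      fix z assume z: "z \<in> typical (N n) I J \<kappa> n"
      obtain x v ts where zz: "z = ((x, v), ts)" by (metis surj_pair)
      show "(1 - e) * spmf (spmf_of_pmf (pair_pmf gw_bullet (replicate_pmf (N n) gw))) z \<le> spmf P z"
      proof (cases "length ts = N n")
        case True
        then have "(1 - e) * spmf (spmf_of_pmf (pair_pmf gw_bullet (replicate_pmf (N n) gw))) z * measure_pmf.prob gw {T. L \<Omega> T = n}
            \<le> spmf P z * measure_pmf.prob gw {T. L \<Omega> T = n}"
          using elim(2) z by (simp add: zz P_eq pmf_pair pmf_replicate_pmf)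
        then show ?thesis using pos by simp
      qed (simp add: zz pmf_pair pmf_replicate_pmf)
    qed (use e in auto)
    then show ?case
      using e(3) by (simp add: P_def Q)
  qed
  then show "\<exists>n0. \<forall>n\<ge>n0. norm (tv_dist
            (measure_spmf (map_spmf (\<lambda>T. (F0 T, take (prefix_size r n) (Fs T))) (GW_cond \<xi> \<Omega> n)))
            (measure_spmf (pair_spmf (GW_bullet \<xi>) (iid_spmf (prefix_size r n) (GW \<xi>)))) - 0) < d"
    by (simp add: eventually_sequentially N_def abs_of_nonneg tv_dist_nonneg)
qed

end

theorem corollary1p3:
  fixes \<xi> :: "nat pmf" and \<Omega> :: "nat set" and f g h :: "real \<Rightarrow> real" and \<alpha> \<theta> :: real
    and M :: "'a measure" and X :: "real \<Rightarrow> 'a \<Rightarrow> real" and r :: "nat \<Rightarrow> nat"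
  assumes "pmf \<xi> 0 > 0"
    and "measure_pmf.prob \<xi> {..1} < 1"
    and "integrable (measure_pmf \<xi>) real" and "mean \<xi> < 1"
    and "slowly_varying f" and "\<alpha> > 1"
    and "\<forall>\<^sub>F n in sequentially. pmf \<xi> n = f (real n) * real n powr (- 1 - \<alpha>)"
    and "\<theta> = min \<alpha> 2"
    and "\<Omega> \<noteq> {}" and "measure_pmf.prob \<xi> \<Omega> > 0" and "finite \<Omega> \<or> finite (- \<Omega>)"
    and "levy_process M X" and "spectrally_positive M X"
    and "\<forall>t\<ge>0. \<forall>u\<ge>0. has_bochner_integral M (\<lambda>\<omega>. exp (- u * X t \<omega>)) (exp (t * u powr \<theta>))"
    and "\<forall>x. h x \<ge> 0" and "continuous_on UNIV h"
    and "distributed M lborel (X 1) (\<lambda>x. ennreal (h x))"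
    and "slowly_varying g"
    and "(\<lambda>n. SUP l::int. ereal \<bar>g (real n) * real n powr (1 / \<theta>) *
              measure_pmf.prob (replicate_pmf n \<xi>) {xs. int (sum_list xs) = l}
            - h ((real_of_int l - real n * mean \<xi>) / (g (real n) * real n powr (1 / \<theta>)))\<bar>)
          \<longlonglongrightarrow> 0"
    and "\<forall>n\<ge>1. r n > 0"
    and "filterlim (\<lambda>n. real (r n) / (g (real n) * real n powr (1 / \<theta>))) at_top sequentially"
    and "(\<lambda>n. real (r n)) \<in> o(\<lambda>n. real n)"
  defines "N \<equiv> (\<lambda>n. nat \<lfloor>inverse (measure_pmf.prob \<xi> \<Omega>) * (1 - mean \<xi>) * real n - real (r n)\<rfloor>)"
  shows "(\<lambda>n. tv_dist
            (measure_spmf (map_spmf (\<lambda>T. (F0 T, take (N n) (Fs T))) (GW_cond \<xi> \<Omega> n)))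
            (measure_spmf (pair_spmf (GW_bullet \<xi>) (iid_spmf (N n) (GW \<xi>)))))
         \<longlonglongrightarrow> 0"
proof -
  interpret heavy_tailed \<xi> f \<alpha> \<Omega>
    by unfold_locales (fact assms)+
  define a where "a n = g (real n) * real n powr (1 / \<theta>)" for n
  have \<theta>: "\<theta> > 0" using assms(6,8) by simp
  have a_top: "filterlim a at_top sequentially"
    unfolding a_def by (rule scale_top[OF assms(18) \<theta>])
  define Z where "Z n = map_pmf (\<lambda>xs. int (sum_list xs)) (replicate_pmf n \<xi>)" for n
  have pmf_Z: "pmf (Z n) l = measure_pmf.prob (replicate_pmf n \<xi>) {xs. int (sum_list xs) = l}" for n l
    by (simp add: Z_def pmf_map vimage_def)
  have llt: "\<forall>\<^sub>F n in sequentially. \<forall>l. \<bar>a n * pmf (Z n) l - h ((real_of_int l - real n * mean \<xi>) / a n)\<bar> \<le> e"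
    if "e > 0" for e
  proof -
    have "\<forall>\<^sub>F n in sequentially. (SUP l::int. ereal \<bar>a n * pmf (Z n) l - h ((real_of_int l - real n * mean \<xi>) / a n)\<bar>) < ereal e"
      using order_tendstoD(2)[OF assms(19), of "ereal e"] that by (simp add: a_def pmf_Z)
    then show ?thesis
    proof eventually_elim
      case (elim n)
      show ?case
      proof
        fix l
        have upper: "ereal \<bar>a n * pmf (Z n) l - h ((real_of_int l - real n * mean \<xi>) / a n)\<bar>
            \<le> (SUP l::int. ereal \<bar>a n * pmf (Z n) l - h ((real_of_int l - real n * mean \<xi>) / a n)\<bar>)"
          by (rule SUP_upper) simp
        show "\<bar>a n * pmf (Z n) l - h ((real_of_int l - real n * mean \<xi>) / a n)\<bar> \<le> e"
          using le_less_trans[OF upper elim] by simp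
      qed
    qed
  qed
  have h_int: "(\<integral>\<^sup>+x. ennreal (h x) \<partial>lborel) = 1"
  proof -
    interpret prob_space M
      using assms(12) by (simp add: levy_process_def)
    have "emeasure M (X 1 -` UNIV \<inter> space M) = (\<integral>\<^sup>+x. ennreal (h x) * indicator UNIV x \<partial>lborel)"
      by (rule distributed_emeasure[OF assms(17)]) simp
    then show ?thesis
      by (simp add: emeasure_space_1)
  qed
  have tight: "\<exists>K>0. \<forall>\<^sub>F n in sequentially. measure_pmf.prob (replicate_pmf n \<xi>)
      {xs. \<bar>real (sum_list xs) - mean \<xi> * real n\<bar> \<le> K * a n} > 1 - e" if "e > 0" for e
  proof -
    have "\<exists>K>0. \<forall>\<^sub>F n in sequentially. measure_pmf.prob (Z n) {l. \<bar>real_of_int l - real n * mean \<xi>\<bar> \<le> K * a n} > 1 - e"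
      using assms(15) by (intro tight_of_local_limit[OF _ assms(16) h_int a_top llt that]) auto
    moreover have "measure_pmf.prob (Z n) {l. \<bar>real_of_int l - real n * mean \<xi>\<bar> \<le> y}
        = measure_pmf.prob (replicate_pmf n \<xi>) {xs. \<bar>real (sum_list xs) - mean \<xi> * real n\<bar> \<le> y}" for n y
      by (simp add: Z_def vimage_def mult.commute)
    ultimately show ?thesis by simp
  qed
  obtain j where j: "pmf \<xi> j > 0" "pmf \<xi> (Suc j) > 0"
    using pmf_pos unfolding eventually_sequentially by (meson le_refl le_SucI)
  obtain d where d: "d > 0" "\<forall>\<^sub>F n in sequentially. d * sqrt (real n) \<le> a n"
  proof -
    obtain K where "K > 0" "\<forall>\<^sub>F n in sequentially. measure_pmf.prob (replicate_pmf n \<xi>)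
      {xs. \<bar>real (sum_list xs) - mean \<xi> * real n\<bar> \<le> K * a n} > 1 - 1 / 8"
      using tight[of "1 / 8"] by auto
    then show ?thesis
      using scale_ge_sqrt[OF j, of K "mean \<xi>" a] that by auto
  qed
  have N: "N = prefix_size r"
    by (simp add: N_def prefix_size_def c_def fun_eq_iff divide_inverse mult.commute)
  show ?thesis
    unfolding N
  proof (rule tv_dist_prefix[OF assms(22)])
    fix e j :: real assume "e > 0"
    then show "\<forall>\<^sub>F n in sequentially. measure_pmf.prob (replicate_pmf (prefix_size r n) gw)
        {ts. real n - j < real (\<Sum>t\<leftarrow>ts. L \<Omega> t)} < e"
      unfolding prefix_size_def
    proof (intro forest_not_too_large[where a = a, OF tight _ d _ assms(22)])
      show "filterlim (\<lambda>n. real (r n) / a n) at_top sequentially"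
        unfolding a_def by (rule assms(21))
      show "\<exists>B>0. \<forall>\<^sub>F n in sequentially. \<forall>M. b * real n \<le> real M \<and> real M \<le> b' * real n \<longrightarrow> a M \<le> B * a n"
        if "0 < b" for b b'
        unfolding a_def by (rule scale_comparable[OF assms(18) \<theta> that])
    qed
  qed
qed

end
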